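(* Let $\mathcal I=\{f_i=rR_\theta\cdot+a_i\}_{i=1}^m$ be an IFS on $\mathbb R^2$ with $r\in(0,1)$, $\theta\in[0,2\pi)$, $a_i\in\mathbb R^2$, and suppose $\theta/\pi$ is irrational. Let $\mu=\Phi\nu$ be the random measure defined below. Then almost surely, for all $\beta\in[0,\pi)$, $$\dim_H\pi_\beta\mu=\min(1,\dim_H\mu).$$
   Context: $R_\theta$ is rotation by angle $\theta$. $\Lambda=\{1,\dots,m\}$, $\Sigma=\Lambda^{\mathbb N}$, $\Phi:\Sigma\to\mathbb R^2$ the canonical coding map $\Phi(i_1i_2\dots)=\lim_n f_{i_1}\circ\cdots\circ f_{i_n}(0)$. $(\Omega,\mathcal A,\mathbb P)$ is a probability space, $X:\Omega\to\{(p_1,\dots,p_m)\in[0,1]^m:\sum_ip_i=1\}$ a random probability vector (zero entries allowed), and $X^{(n)}$, $n\in\mathbb N$, i.i.d. copies of $X$ (coordinates of $\Omega^{\mathbb N}$ with $\mathbb P^{\otimes\mathbb N}$). The random measure $\nu$ on $\Sigma$ is given by $\nu([i_1\dots i_k])=X^{(1)}_{i_1}\cdots X^{(k)}_{i_k}$, and $\mu=\Phi\nu$ is its image, $\mu(A)=\nu(\Phi^{-1}A)$. $\pi_\beta$ is orthogonal projection onto the line through the origin making angle $\beta$ with the $x$-axis, $\pi_\beta\mu$ the image measure. For a measure $\lambda$, $\dim_H\lambda=\inf\{\dim_H A: A \text{ Borel},\ \lambda(A)>0\}$. *)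

theory Defs
  imports "HOL-Probability.Probability"
begin

(* The plane R^2 is modelled by the type complex (Euclidean metric). *)

definition rot :: "real \<Rightarrow> complex \<Rightarrow> complex" where
  "rot \<theta> z = cis \<theta> * z"

definition ifs_map :: "real \<Rightarrow> real \<Rightarrow> (nat \<Rightarrow> complex) \<Rightarrow> nat \<Rightarrow> complex \<Rightarrow> complex" where
  "ifs_map r \<theta> a i z = complex_of_real r * rot \<theta> z + a i"

(* ifs_iter f \<omega> n z = f_{i_1} o ... o f_{i_n} (z), where \<omega> k = i_{k+1} *)
fun ifs_iter :: "(nat \<Rightarrow> complex \<Rightarrow> complex) \<Rightarrow> (nat \<Rightarrow> nat) \<Rightarrow> nat \<Rightarrow> complex \<Rightarrow> complex" where
  "ifs_iter f \<omega> 0 z = z"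
| "ifs_iter f \<omega> (Suc n) z = ifs_iter f \<omega> n (f (\<omega> n) z)"

definition coding :: "(nat \<Rightarrow> complex \<Rightarrow> complex) \<Rightarrow> (nat \<Rightarrow> nat) \<Rightarrow> complex" where
  "coding f \<omega> = lim (\<lambda>n. ifs_iter f \<omega> n 0)"

(* Symbolic space Sigma = {1..m}^N: sequences \<omega> with \<omega> k = i_{k+1}.
   The random measure nu (for the sample point w of Omega^N, X^(n)(w) = X (w n))
   is the product of the distributions on {1..m} with weights X^(k); it is the
   measure with nu([i_1 ... i_k]) = X^(1)_{i_1} ... X^(k)_{i_k}. *)
definition random_nu :: "nat \<Rightarrow> ('w \<Rightarrow> nat \<Rightarrow> real) \<Rightarrow> (nat \<Rightarrow> 'w) \<Rightarrow> (nat \<Rightarrow> nat) measure" where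
  "random_nu m X w = (\<Pi>\<^sub>M k\<in>UNIV. point_measure {1..m} (\<lambda>i. ennreal (X (w k) i)))"

definition random_mu :: "real \<Rightarrow> real \<Rightarrow> (nat \<Rightarrow> complex) \<Rightarrow> nat \<Rightarrow> ('w \<Rightarrow> nat \<Rightarrow> real)
    \<Rightarrow> (nat \<Rightarrow> 'w) \<Rightarrow> complex measure" where
  "random_mu r \<theta> a m X w = distr (random_nu m X w) borel (coding (ifs_map r \<theta> a))"

definition proj_line :: "real \<Rightarrow> complex \<Rightarrow> complex" where
  "proj_line \<beta> z = complex_of_real (Re z * cos \<beta> + Im z * sin \<beta>) * cis \<beta>"

definition hausdorff_pre :: "real \<Rightarrow> real \<Rightarrow> 'a::metric_space set \<Rightarrow> ennreal" where
  "hausdorff_pre s \<delta> A =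
     (INF U \<in> {U :: nat \<Rightarrow> 'a set. A \<subseteq> (\<Union>n. U n) \<and> (\<forall>n. bounded (U n) \<and> diameter (U n) \<le> \<delta>)}.
        (\<Sum>n. ennreal (diameter (U n) powr s)))"

definition hausdorff_measure :: "real \<Rightarrow> 'a::metric_space set \<Rightarrow> ennreal" where
  "hausdorff_measure s A = (SUP \<delta> \<in> {0<..}. hausdorff_pre s \<delta> A)"

definition hausdorff_dim :: "'a::metric_space set \<Rightarrow> real" where
  "hausdorff_dim A = Inf {s. 0 \<le> s \<and> hausdorff_measure s A = 0}"

definition hausdorff_dim_measure :: "'a::metric_space measure \<Rightarrow> real" where
  "hausdorff_dim_measure N = Inf {hausdorff_dim A | A. A \<in> sets borel \<and> emeasure N A > 0}"

end

theory Submission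
  imports Defs "HOL-Real_Asymp.Real_Asymp"
begin

text \<open>
  The measure \<open>\<mu>\<close> is the law of the random sum \<open>\<Sum>j. S ^ j * a (i j)\<close>, \<open>S = r * cis \<theta>\<close>, with independent digits
  \<open>i j\<close> of law \<open>X (w j)\<close>. Splitting off the first \<open>n\<close> digits shows that the sums
  \<open>\<Sum>c. q c powr (1 + t)\<close> over the masses \<open>q c\<close> of the cells of length \<open>r ^ n\<close> of the projection in
  direction \<open>\<beta>\<close> are submultiplicative along the rotation \<open>\<beta> \<mapsto> \<beta> - n * \<theta>\<close>, with an error \<open>C powr t\<close>
  that costs only \<open>O(1)\<close> after taking \<open>- ln\<close> and dividing by \<open>t\<close>, however small \<open>t\<close> is. By
  Hoeffding's inequality over blocks of digits and equidistribution of the irrational rotation,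
  almost surely all projections have dimension at least a common rate, the supremum over block
  lengths of the direction-averaged expected entropy per scale.

  Conversely, for typical weights, digits and directions the information of the projection at scale
  \<open>r ^ n\<close> is close to this rate infinitely often, since its mean is at most the rate and its lower tail
  is negligible. If the dimension of \<open>\<mu>\<close> exceeded some \<open>s < 1\<close> above the rate, almost all balls would have
  mass at most \<open>r ^ (n * s)\<close>; averaging over directions as in Marstrand's projection theorem, most
  projected cells would have nearly as small a mass, that is, too much information. Hence the
  minimum of 1 and the dimension of \<open>\<mu>\<close> is at most the rate.
\<close>

section \<open>Power sums of the atoms of a finite partition\<close>

text \<open>Power sums with exponent 1 + t are used instead of Shannon entropy because they are
  moments: submultiplicativity holds for every realisation of the weights, and Markov's inequality
  turns them into the exponential tail bounds for ball masses that Borel--Cantelli needs. The price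
  is the choice of t. It is m^-k for blocks of length k; tail bounds for words of length n much
  larger than k keep this fixed exponent, whereas the bound on the mean information uses m^-n. Both
  are compared with \<open>dim_rate\<close>. The exceptional null set must not depend on the
  direction. Hence estimates are made on a finite grid of mesh comparable to \<open>r ^ k\<close>,
  and other directions are reached at a bounded additive cost. No separation of the maps is assumed,
  so the masses are those of projected cells, not of words. Every loss (rotation, grid, deviation,
  overlap of cells) is a constant per block, independent of k; \<open>C4\<close> collects them, and
  its share \<open>C4 / (k * ell)\<close> of the rate vanishes as k grows. For the converse,
  information averaged over directions suffices, because the projection theorem is an average as
  well.\<close>

lemma powr_tangent:
  fixes x y t :: real
  assumes "x \<ge> 0" "y > 0" "t \<ge> 0"
  shows "x powr (1 + t) \<ge> y powr (1 + t) + (1 + t) * y powr t * (x - y)"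
proof (cases "x = 0")
  case True
  have "y powr (1 + t) = y * y powr t" using assms by (simp add: powr_add)
  then have "y powr (1 + t) + (1 + t) * y powr t * (x - y) = - (t * y * y powr t)"
    using True by (simp add: algebra_simps)
  also have "\<dots> \<le> 0" using assms by simp
  finally show ?thesis using True by simp
next
  case False
  then have x: "x > 0" using assms by simp
  define s where "s = x / y"
  have s: "s > 0" using x assms s_def by simp
  \<comment> \<open>Scaling by y reduces the tangent inequality to Bernoulli's inequality at s,
    obtained from \<open>exp u >= 1 + u\<close> and \<open>ln s >= 1 - 1 / s\<close>.\<close>
  have b: "s powr (1 + t) \<ge> 1 + (1 + t) * (s - 1)"
  proof -
    have "(1 + t) * ln s \<ge> (1+t) * (1 - 1 / s)"
      using ln_le_minus_one[of "1/s"] s assms by (intro mult_left_mono) (auto simp: ln_div)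
    have "s * s powr t \<ge> s * (1 + t * ln s)"
      using exp_ge_add_one_self[of "t * ln s"] s by (simp add: powr_def)
    moreover have "t * s * ln s \<ge> t * s * (1 - 1/s)"
      using ln_le_minus_one[of "1/s"] s assms by (intro mult_left_mono) (auto simp: ln_div)
    moreover have "t * s * (1 - 1/s) = t * s - t" using s by (simp add: algebra_simps)
    moreover have "s powr (1+t) = s * s powr t" using s by (simp add: powr_add)
    ultimately show ?thesis by (simp add: algebra_simps)
  qed
  have xs: "x = s * y" using s_def assms by simp
  have "x powr (1 + t) = s powr (1 + t) * y powr (1 + t)"
    unfolding xs using s assms by (simp add: powr_mult)
  also have "\<dots> \<ge> (1 + (1 + t) * (s - 1)) * y powr (1 + t)"
    using b by (intro mult_right_mono) auto
  also have "(1 + (1 + t) * (s - 1)) * y powr (1 + t) = y powr (1 + t) + (1 + t) * y powr t * (x - y)"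
  proof -
    have "y powr (1 + t) = y * y powr t" using assms by (simp add: powr_add)
    then show ?thesis unfolding xs by (simp add: algebra_simps)
  qed
  finally show ?thesis .
qed

text \<open>Summing the tangent inequality at the barycentre \<open>y = B / A\<close> kills the
  linear term. The weights are not normalised, which is why their total appears to the power
  t.\<close>

lemma jensen_powr:
  fixes W g :: "'u \<Rightarrow> real"
  assumes "finite U" "\<And>u. u \<in> U \<Longrightarrow> W u \<ge> 0" "\<And>u. u \<in> U \<Longrightarrow> g u \<ge> 0" "t \<ge> 0"
  shows "(\<Sum>u\<in>U. W u * g u) powr (1 + t) \<le> (\<Sum>u\<in>U. W u) powr t * (\<Sum>u\<in>U. W u * g u powr (1 + t))"
proof -
  define A where "A = (\<Sum>u\<in>U. W u)"
  define B where "B = (\<Sum>u\<in>U. W u * g u)"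
  have A0: "A \<ge> 0" and B0: "B \<ge> 0" unfolding A_def B_def using assms by (auto intro!: sum_nonneg)
  have R0: "(\<Sum>u\<in>U. W u * g u powr (1 + t)) \<ge> 0" using assms by (auto intro!: sum_nonneg)
  show ?thesis
  proof (cases "B = 0")
    case True then show ?thesis using R0 A0 unfolding A_def[symmetric] B_def[symmetric] by simp
  next
    case False
    then have B: "B > 0" using B0 by simp
    have A: "A > 0"
    proof (rule ccontr)
      assume "\<not> A > 0"
      then have "A = 0" using A0 by simp
      then have "\<forall>u\<in>U. W u = 0" unfolding A_def using assms by (subst (asm) sum_nonneg_eq_0_iff) auto
      then have "B = 0" unfolding B_def by simp
      then show False using B by simp
    qed
    define y where "y = B / A"
    have y: "y > 0" using A B y_def by simp
    have "A * y powr (1 + t) = (\<Sum>u\<in>U. W u * (y powr (1 + t) + (1 + t) * y powr t * (g u - y)))"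
    proof -
      have "(\<Sum>u\<in>U. W u * (y powr (1 + t) + (1 + t) * y powr t * (g u - y)))
         = (\<Sum>u\<in>U. W u * y powr (1 + t) + (1 + t) * y powr t * (W u * g u) - (1+t) * y powr t * y * W u)"
        by (intro sum.cong) (auto simp: algebra_simps)
      also have "\<dots> = A * y powr (1 + t) + (1 + t) * y powr t * B - (1+t) * y powr t * y * A"
        by (simp add: sum.distrib sum_subtractf A_def B_def sum_distrib_left sum_distrib_right)
      also have "\<dots> = A * y powr (1 + t)" using A by (simp add: y_def)
      finally show ?thesis by simp
    qed
    also have "\<dots> \<le> (\<Sum>u\<in>U. W u * g u powr (1 + t))"
      using assms y by (intro sum_mono mult_left_mono powr_tangent) auto
    finally have *: "A * y powr (1 + t) \<le> (\<Sum>u\<in>U. W u * g u powr (1 + t))" .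
    have "B powr (1 + t) = A powr t * (A * y powr (1 + t))"
    proof -
      have "B = A * y" using A y_def by simp
      then have "B powr (1 + t) = A powr (1 + t) * y powr (1 + t)" using A y by (simp add: powr_mult)
      also have "A powr (1 + t) = A powr t * A" using A by (simp add: powr_add)
      finally show ?thesis by simp
    qed
    also have "\<dots> \<le> A powr t * (\<Sum>u\<in>U. W u * g u powr (1 + t))" using * by (intro mult_left_mono) auto
    finally show ?thesis unfolding A_def B_def .
  qed
qed

lemma sum_powr_le:
  fixes g :: "'u \<Rightarrow> real"
  assumes "finite U" "\<And>u. u \<in> U \<Longrightarrow> g u \<ge> 0" "t \<ge> 0"
  shows "(\<Sum>u\<in>U. g u) powr (1 + t) \<le> card U powr t * (\<Sum>u\<in>U. g u powr (1 + t))"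
  using jensen_powr[of U "\<lambda>_. 1" g t] assms by simp

lemma powr_sum_superadd:
  fixes g :: "'u \<Rightarrow> real"
  assumes "finite U" "\<And>u. u \<in> U \<Longrightarrow> g u \<ge> 0" "t \<ge> 0"
  shows "(\<Sum>u\<in>U. g u powr (1 + t)) \<le> (\<Sum>u\<in>U. g u) powr (1 + t)"
proof -
  define G where "G = (\<Sum>u\<in>U. g u)"
  have G: "g u \<le> G" if "u \<in> U" for u unfolding G_def using assms that by (intro member_le_sum) auto
  have G0: "G \<ge> 0" unfolding G_def using assms by (intro sum_nonneg)
  have pw: "x powr (1 + t) = x * x powr t" if "x \<ge> 0" for x :: real
    using that by (cases "x = 0") (auto simp: powr_add)
  have "(\<Sum>u\<in>U. g u powr (1 + t)) = (\<Sum>u\<in>U. g u * g u powr t)" using assms pw by (intro sum.cong) auto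
  also have "\<dots> \<le> (\<Sum>u\<in>U. g u * G powr t)"
    using assms G by (intro sum_mono mult_left_mono powr_mono2) auto
  also have "\<dots> = G powr (1 + t)" using pw[OF G0] by (simp add: G_def sum_distrib_right)
  finally show ?thesis unfolding G_def .
qed

section \<open>Push-forward masses and comparison of partitions\<close>

definition mass :: "('u \<Rightarrow> real) \<Rightarrow> 'u set \<Rightarrow> ('u \<Rightarrow> 'c) \<Rightarrow> 'c \<Rightarrow> real" where
  "mass W U f c = (\<Sum>u | u \<in> U \<and> f u = c. W u)"

text \<open>For total weight 1 this is exp (- t H), where H is the Renyi entropy of order 1 + t of
  the partition into fibres of f.\<close>

definition power_sum :: "real \<Rightarrow> ('u \<Rightarrow> real) \<Rightarrow> 'u set \<Rightarrow> ('u \<Rightarrow> 'c) \<Rightarrow> real" where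
  "power_sum t W U f = (\<Sum>c\<in>f ` U. mass W U f c powr (1 + t))"

lemma mass_nonneg: "(\<And>u. u \<in> U \<Longrightarrow> W u \<ge> 0) \<Longrightarrow> mass W U f c \<ge> 0"
  unfolding mass_def by (intro sum_nonneg) auto

lemma mass_eq_0: "c \<notin> f ` U \<Longrightarrow> mass W U f c = 0"
  unfolding mass_def by (rule sum.neutral) auto

lemma sum_mass: "finite U \<Longrightarrow> finite C \<Longrightarrow> f ` U \<subseteq> C \<Longrightarrow> (\<Sum>c\<in>C. mass W U f c) = (\<Sum>u\<in>U. W u)"
proof -
  assume a: "finite U" "finite C" "f ` U \<subseteq> C"
  have "(\<Sum>c\<in>C. mass W U f c) = (\<Sum>c\<in>C. \<Sum>u\<in>{u\<in>U. f u = c}. W u)" unfolding mass_def ..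
  also have "\<dots> = (\<Sum>u\<in>U. W u)" using a by (intro sum.group) auto
  finally show ?thesis .
qed

lemma sum_mass_mult: "finite U \<Longrightarrow> (\<Sum>c\<in>f`U. mass W U f c * h c) = (\<Sum>u\<in>U. W u * h (f u))"
proof -
  assume a: "finite U"
  have "(\<Sum>c\<in>f`U. mass W U f c * h c) = (\<Sum>c\<in>f`U. \<Sum>u\<in>{u\<in>U. f u = c}. W u * h (f u))"
    unfolding mass_def sum_distrib_right by (intro sum.cong) auto
  also have "\<dots> = (\<Sum>u\<in>U. W u * h (f u))" using a by (intro sum.group) auto
  finally show ?thesis .
qed

lemma power_sum_superset:
  assumes "finite C" "f ` U \<subseteq> C"
  shows "power_sum t W U f = (\<Sum>c\<in>C. mass W U f c powr (1 + t))"
  unfolding power_sum_def using assms by (intro sum.mono_neutral_left) (auto simp: mass_eq_0)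

text \<open>Both sides are compared with the joint partition: splitting a \<gamma>-fibre into at
  most K pieces costs K^t by the power mean inequality, and merging the pieces of an \<alpha>-fibre
  only increases the power sum. Thus \<alpha> need not refine \<gamma>; a bounded number of
  \<alpha>-cells in each \<gamma>-cell is enough.\<close>

lemma power_sum_cmp:
  assumes fin: "finite U" and W: "\<And>u. u \<in> U \<Longrightarrow> W u \<ge> 0" and t: "t \<ge> 0"
    and K: "\<And>b. real (card (\<alpha> ` {u \<in> U. \<gamma> u = b})) \<le> K"
  shows "power_sum t W U \<gamma> \<le> K powr t * power_sum t W U \<alpha>"
proof -
  define J where "J a b = mass W {u \<in> U. \<gamma> u = b} \<alpha> a" for a b
  have J0: "J a b \<ge> 0" for a b unfolding J_def by (rule mass_nonneg) (use W in auto)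
  have g: "mass W U \<gamma> b = (\<Sum>a\<in>\<alpha> ` {u \<in> U. \<gamma> u = b}. J a b)" for b
    unfolding J_def using fin by (subst sum_mass) (auto simp: mass_def)
  have a: "mass W U \<alpha> a = (\<Sum>b\<in>\<gamma> ` U. J a b)" for a
  proof -
    have "mass W U \<alpha> a = (\<Sum>b\<in>\<gamma>`U. mass W {u\<in>U. \<alpha> u = a} \<gamma> b)"
      using fin by (subst sum_mass) (auto simp: mass_def)
    also have "\<dots> = (\<Sum>b\<in>\<gamma> ` U. J a b)"
      unfolding J_def mass_def by (intro sum.cong) (auto intro!: arg_cong2[where f=sum])
    finally show ?thesis .
  qed
  have "power_sum t W U \<gamma> \<le> (\<Sum>b\<in>\<gamma> ` U. K powr t * (\<Sum>a\<in>\<alpha> ` U. J a b powr (1 + t)))"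
    unfolding power_sum_def
  proof (intro sum_mono)
    fix b assume "b \<in> \<gamma> ` U"
    let ?A = "\<alpha> ` {u \<in> U. \<gamma> u = b}"
    have "mass W U \<gamma> b powr (1 + t) \<le> card ?A powr t * (\<Sum>a\<in>?A. J a b powr (1 + t))"
      unfolding g using fin J0 t by (intro sum_powr_le) auto
    also have "\<dots> \<le> K powr t * (\<Sum>a\<in>\<alpha> ` U. J a b powr (1 + t))"
      using K[of b] t fin by (intro mult_mono powr_mono2 sum_mono2) (auto intro!: sum_nonneg)
    finally show "mass W U \<gamma> b powr (1 + t) \<le> K powr t * (\<Sum>a\<in>\<alpha> ` U. J a b powr (1 + t))" .
  qed
  also have "\<dots> = K powr t * (\<Sum>a\<in>\<alpha> ` U. \<Sum>b\<in>\<gamma> ` U. J a b powr (1 + t))"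
    unfolding sum_distrib_left[symmetric] by (subst sum.swap) simp
  also have "\<dots> \<le> K powr t * power_sum t W U \<alpha>"
    unfolding power_sum_def a using fin J0 t by (intro mult_left_mono sum_mono powr_sum_superadd) auto
  finally show ?thesis .
qed

lemma card_int_interval_le:
  fixes T :: "int set" and x y :: real
  assumes "\<And>z. z \<in> T \<Longrightarrow> x \<le> of_int z \<and> of_int z \<le> y" and xy: "x \<le> y + 1"
  shows "finite T" "real (card T) \<le> y - x + 1"
proof -
  have s: "T \<subseteq> {\<lceil>x\<rceil>..\<lfloor>y\<rfloor>}" using assms by (auto simp: ceiling_le_iff le_floor_iff)
  then show "finite T" by (rule finite_subset) simp
  have "card T \<le> card {\<lceil>x\<rceil>..\<lfloor>y\<rfloor>}" using s by (intro card_mono) auto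
  then have "real (card T) \<le> real (nat (\<lfloor>y\<rfloor> - \<lceil>x\<rceil> + 1))" by simp
  also have "\<dots> \<le> y - x + 1"
  proof (cases "\<lfloor>y\<rfloor> - \<lceil>x\<rceil> + 1 \<ge> 0")
    case True
    then have "real (nat (\<lfloor>y\<rfloor> - \<lceil>x\<rceil> + 1)) = real_of_int (\<lfloor>y\<rfloor> - \<lceil>x\<rceil> + 1)" by simp
    also have "\<dots> \<le> y - x + 1" by simp linarith
    finally show ?thesis .
  next
    case False
    then show ?thesis using xy by simp
  qed
  finally show "real (card T) \<le> y - x + 1" .
qed

lemma mass_le_total:
  assumes "finite U" "\<And>u. u \<in> U \<Longrightarrow> W u \<ge> 0"
  shows "mass W U f c \<le> (\<Sum>u\<in>U. W u)"
  unfolding mass_def using assms by (intro sum_mono2) auto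

lemma power_sum_le_one:
  assumes "finite U" "\<And>u. u \<in> U \<Longrightarrow> W u \<ge> 0" "(\<Sum>u\<in>U. W u) = 1" "t \<ge> 0"
  shows "power_sum t W U f \<le> 1"
proof -
  have "power_sum t W U f \<le> (\<Sum>c\<in>f`U. mass W U f c) powr (1+t)"
    unfolding power_sum_def using assms by (intro powr_sum_superadd mass_nonneg) auto
  then show ?thesis using assms by (simp add: sum_mass)
qed

text \<open>Comparison with the one-cell partition, whose power sum is 1.\<close>

lemma power_sum_ge:
  assumes "finite U" "\<And>u. u \<in> U \<Longrightarrow> W u \<ge> 0" "(\<Sum>u\<in>U. W u) = 1" "t \<ge> 0"
  shows "power_sum t W U f \<ge> real (card U) powr (-t)"
proof -
  have U: "card U > 0" using assms by (auto simp: card_gt_0_iff)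
  have "power_sum t W U (\<lambda>_. ()) \<le> real (card U) powr t * power_sum t W U f"
    using assms by (intro power_sum_cmp) (auto intro!: order_trans[OF card_image_le] card_mono)
  moreover have "power_sum t W U (\<lambda>_. ()) = 1"
  proof -
    have "power_sum t W U (\<lambda>_. ()) = mass W U (\<lambda>_. ()) () powr (1 + t)"
      by (subst power_sum_superset[of "{()}"]) auto
    also have "mass W U (\<lambda>_. ()) () = 1" unfolding mass_def using assms(3) by simp
    finally show ?thesis by simp
  qed
  ultimately have "1 \<le> real (card U) powr t * power_sum t W U f" by simp
  then show ?thesis using U by (simp add: powr_minus field_simps)
qed

lemma x_ln_sq_le: "0 < (x::real) \<Longrightarrow> x \<le> 1 \<Longrightarrow> x * (ln x)\<^sup>2 \<le> 2"
proof -
  assume x: "0 < x" "x \<le> 1"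
  define y where "y = - ln x"
  have y: "y \<ge> 0" using x y_def by simp
  have "1 + y + y\<^sup>2/2 \<le> exp y" using exp_lower_Taylor_quadratic[OF y] by simp
  then have "y\<^sup>2 \<le> 2 * exp y" using y by simp
  also have "exp y = 1 / x" using x by (simp add: y_def exp_minus field_simps)
  finally have "y\<^sup>2 \<le> 2 / x" by simp
  then show ?thesis using x by (simp add: y_def field_simps)
qed

text \<open>Reverse, up to 1, of the usual inequality between Renyi and Shannon entropy. Expanding
  q^(1+t) to second order in t leaves an error of at most t^2 per cell, since q (ln q)^2 is bounded
  by 2; over at most \<open>card U\<close>, hence at most 1 / t, cells this adds up to t, and to 1
  after division by t.\<close>

lemma entropy_le_renyi:
  assumes "finite U" "\<And>u. u \<in> U \<Longrightarrow> W u \<ge> 0" "(\<Sum>u\<in>U. W u) = 1" "t > 0"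
    and tU: "t * real (card U) \<le> 1"
  shows "(\<Sum>u\<in>U. W u * - ln (mass W U f (f u))) \<le> - ln (power_sum t W U f) / t + 1"
proof -
  define q where "q = mass W U f"
  have q0: "q c \<ge> 0" for c unfolding q_def using assms by (intro mass_nonneg) auto
  have q1: "q c \<le> 1" for c unfolding q_def using mass_le_total[of U W f c] assms(1,2,3) by simp
  have ent: "(\<Sum>u\<in>U. W u * - ln (mass W U f (f u))) = (\<Sum>c\<in>f`U. q c * - ln (q c))"
    unfolding q_def using sum_mass_mult[OF assms(1), of W f "\<lambda>c. - ln (mass W U f c)"] by simp
  have pt: "q c powr (1 + t) \<le> q c + t * (q c * ln (q c)) + t\<^sup>2" for c
  proof (cases "q c = 0")
    case True then show ?thesis by simp
  next
    case False
    then have p: "q c > 0" using q0[of c] by simp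
    define s where "s = - ln (q c)"
    have s: "s \<ge> 0" using p q1 s_def by simp
    have es: "exp (- (t * s)) \<le> 1 - t * s + (t * s)\<^sup>2/2"
    proof -
      have "0 \<le> t * s" using s assms by simp
      define z where "z = t * s"
      have z: "z \<ge> 0" using \<open>0 \<le> t * s\<close> z_def by simp
      define g where "g z = 1 - z + z\<^sup>2/2 - exp (- z)" for z :: real
      have "g 0 \<le> g z"
      proof (rule DERIV_nonneg_imp_nondecreasing[OF z])
        fix x :: real assume "0 \<le> x" "x \<le> z"
        have "(g has_real_derivative (- 1 + x + exp (- x))) (at x)"
          unfolding g_def by (auto intro!: derivative_eq_intros)
        moreover have "- 1 + x + exp (- x) \<ge> 0" using exp_ge_add_one_self[of "-x"] by simp
        ultimately show "\<exists>y. (g has_real_derivative y) (at x) \<and> 0 \<le> y" by blast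
      qed
      then show ?thesis unfolding g_def z_def by simp
    qed
    have "q c powr (1 + t) = q c * exp (- (t * s))" using p by (simp only: powr_add s_def) (simp add: powr_def)
    also have "\<dots> \<le> q c * (1 - t * s + (t * s)\<^sup>2/2)" using es p by (intro mult_left_mono) auto
    also have "\<dots> = q c + t * (q c * ln (q c)) + t\<^sup>2 * (q c * (ln (q c))\<^sup>2) / 2"
      by (simp add: s_def algebra_simps power2_eq_square)
    also have "\<dots> \<le> q c + t * (q c * ln (q c)) + t\<^sup>2"
    proof -
      have "t\<^sup>2 * (q c * (ln (q c))\<^sup>2) \<le> t\<^sup>2 * 2" using x_ln_sq_le[OF p q1] by (intro mult_left_mono) auto
      then show ?thesis by simp
    qed
    finally show ?thesis .
  qed
  have "power_sum t W U f \<le> (\<Sum>c\<in>f`U. q c + t * (q c * ln (q c)) + t\<^sup>2)"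
    unfolding power_sum_def q_def[symmetric] by (intro sum_mono pt)
  also have "\<dots> = 1 - t * (\<Sum>c\<in>f`U. q c * - ln (q c)) + real (card (f`U)) * t\<^sup>2"
    using assms(1,3) sum_mass[of U "f`U" f W] by (simp add: sum.distrib sum_distrib_left q_def sum_negf)
  also have "\<dots> \<le> 1 - t * (\<Sum>c\<in>f`U. q c * - ln (q c)) + t"
  proof -
    have "real (card (f`U)) * t\<^sup>2 \<le> real (card U) * t\<^sup>2"
      using card_image_le[OF assms(1), of f] by (intro mult_right_mono) auto
    also have "\<dots> = t * (t * real (card U))" by (simp add: power2_eq_square)
    also have "\<dots> \<le> t * 1" using tU assms by (intro mult_left_mono) auto
    finally show ?thesis by simp
  qed
  finally have ps: "power_sum t W U f \<le> 1 - t * (\<Sum>c\<in>f`U. q c * - ln (q c)) + t" .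
  have pos: "power_sum t W U f > 0"
  proof -
    have "card U > 0" using assms by (auto simp: card_gt_0_iff)
    then have "0 < real (card U) powr (-t)" by simp
    also have "\<dots> \<le> power_sum t W U f" using assms by (intro power_sum_ge) auto
    finally show ?thesis .
  qed
  have "ln (power_sum t W U f) \<le> power_sum t W U f - 1" using pos by (rule ln_le_minus_one)
  also have "\<dots> \<le> - t * (\<Sum>c\<in>f`U. q c * - ln (q c)) + t" using ps by simp
  finally show ?thesis unfolding ent using \<open>t > 0\<close> by (simp add: field_simps)
qed

section \<open>Hausdorff measures and dimensions\<close>

lemma hausdorff_pre_le_sum:
  fixes Q :: "nat \<Rightarrow> 'c \<Rightarrow> 'a::metric_space set"
  assumes fin: "\<And>n. finite (C n)" and A: "A \<subseteq> (\<Union>n. \<Union>c\<in>C n. Q n c)"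
    and Q: "\<And>n c. c \<in> C n \<Longrightarrow> bounded (Q n c) \<and> diameter (Q n c) \<le> d n"
    and d: "\<And>n. 0 \<le> d n \<and> d n \<le> \<delta>" and s: "s \<ge> 0"
  shows "hausdorff_pre s \<delta> A \<le> (\<Sum>n. ennreal (real (card (C n)) * d n powr s))"
proof -
  have "\<forall>n. \<exists>e. bij_betw e {..<card (C n)} (C n)"
    using ex_bij_betw_nat_finite[OF fin] by (simp add: lessThan_atLeast0)
  then obtain e where e: "\<And>n. bij_betw (e n) {..<card (C n)} (C n)" by metis
  have e_in: "e n i \<in> C n" if "i < card (C n)" for n i
    using e[of n] that by (auto simp: bij_betw_def)
  \<comment> \<open>Indices beyond the finite family are filled with the empty set, which
    contributes nothing: \<open>0 powr s = 0\<close> even for \<open>s = 0\<close>.\<close>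
  define U where "U = (\<lambda>(n, i). if i < card (C n) then Q n (e n i) else {})"
  have U: "bounded (U x) \<and> diameter (U x) \<le> d (fst x)" for x
    unfolding U_def using Q e_in d by (auto split: prod.split)
  have "hausdorff_pre s \<delta> A \<le> (\<Sum>k. ennreal (diameter (U (prod_decode k)) powr s))"
    unfolding hausdorff_pre_def
  proof (rule INF_lower, safe)
    fix x assume "x \<in> A"
    then obtain n c where nc: "c \<in> C n" "x \<in> Q n c" using A by auto
    then obtain i where i: "i < card (C n)" "c = e n i" using e[of n] by (auto simp: bij_betw_def)
    have "x \<in> U (prod_decode (prod_encode (n, i)))" using nc i by (simp add: U_def)
    then show "x \<in> (\<Union>k. U (prod_decode k))" by blast
  next
    fix k show "bounded (U (prod_decode k))" using U by blast
    show "diameter (U (prod_decode k)) \<le> \<delta>" using U[of "prod_decode k"] d by (meson order_trans)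
  qed
  also have "\<dots> = (\<Sum>n. \<Sum>i. ennreal (diameter (U (n, i)) powr s))"
    by (rule suminf_ennreal_2dimen) simp
  also have "\<dots> \<le> (\<Sum>n. ennreal (real (card (C n)) * d n powr s))"
  proof (intro suminf_le allI)
    fix n
    have "(\<Sum>i. ennreal (diameter (U (n, i)) powr s)) = (\<Sum>i<card (C n). ennreal (diameter (U (n, i)) powr s))"
      by (intro suminf_finite) (auto simp: U_def)
    also have "\<dots> \<le> (\<Sum>i<card (C n). ennreal (d n powr s))"
      using U[of "(n, _)"] s diameter_ge_0 by (intro sum_mono ennreal_leI powr_mono2) auto
    also have "\<dots> = ennreal (real (card (C n)) * d n powr s)"
      by (simp add: ennreal_mult ennreal_of_nat_eq_real_of_nat)
    finally show "(\<Sum>i. ennreal (diameter (U (n, i)) powr s)) \<le> ennreal (real (card (C n)) * d n powr s)" .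
  qed auto
  finally show ?thesis .
qed

text \<open>The Hausdorff--Cantelli lemma: every tail of the families covers A, and the tails of a
  convergent series tend to 0.\<close>

lemma hausdorff_measure_limsup_cover:
  fixes Q :: "nat \<Rightarrow> 'c \<Rightarrow> 'a::metric_space set"
  assumes fin: "\<And>n. finite (C n)" and A: "\<And>x N. x \<in> A \<Longrightarrow> \<exists>n\<ge>N. \<exists>c\<in>C n. x \<in> Q n c"
    and Q: "\<And>n c. c \<in> C n \<Longrightarrow> bounded (Q n c) \<and> diameter (Q n c) \<le> d n"
    and d0: "\<And>n. 0 \<le> d n" and dlim: "d \<longlonglongrightarrow> 0" and s: "s \<ge> 0"
    and sm: "summable (\<lambda>n. real (card (C n)) * d n powr s)"
  shows "hausdorff_measure s A = 0"
proof -
  have "hausdorff_pre s \<delta> A = 0" if \<delta>: "\<delta> > 0" for \<delta>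
  proof -
    have "hausdorff_pre s \<delta> A \<le> ennreal \<epsilon>" if \<epsilon>: "\<epsilon> > 0" for \<epsilon>
    proof -
      from suminf_exist_split[OF \<epsilon> sm] obtain N1 where
        N1: "\<forall>n\<ge>N1. norm (\<Sum>i. real (card (C (i + n))) * d (i + n) powr s) < \<epsilon>" by auto
      have "eventually (\<lambda>n. d n < \<delta>) sequentially" using dlim \<delta> by (intro order_tendstoD) auto
      then obtain N2 where N2: "\<And>n. n \<ge> N2 \<Longrightarrow> d n < \<delta>" by (auto simp: eventually_sequentially)
      define N where "N = max N1 N2"
      have "hausdorff_pre s \<delta> A \<le> (\<Sum>n. ennreal (real (card (C (n + N))) * d (n + N) powr s))"
      proof (rule hausdorff_pre_le_sum[where Q = "\<lambda>n. Q (n + N)"])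
        show "A \<subseteq> (\<Union>n. \<Union>c\<in>C (n + N). Q (n + N) c)"
        proof
          fix x assume "x \<in> A"
          then obtain n c where "n \<ge> N" "c \<in> C n" "x \<in> Q n c" using A by blast
          then have "c \<in> C (n - N + N)" "x \<in> Q (n - N + N) c" by simp_all
          then show "x \<in> (\<Union>n. \<Union>c\<in>C (n + N). Q (n + N) c)" by blast
        qed
        show "0 \<le> d (n + N) \<and> d (n + N) \<le> \<delta>" for n
          using d0[of "n + N"] N2[of "n + N"] by (auto simp: N_def intro!: less_imp_le)
      qed (use fin Q s in auto)
      also have "\<dots> = ennreal (\<Sum>n. real (card (C (n + N))) * d (n + N) powr s)"
      proof (rule suminf_ennreal2)
        show "summable (\<lambda>n. real (card (C (n + N))) * d (n + N) powr s)"
          using summable_ignore_initial_segment[OF sm] .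
      qed auto
      also have "\<dots> \<le> ennreal \<epsilon>" using N1[rule_format, of N] by (intro ennreal_leI) (auto simp: N_def)
      finally show ?thesis .
    qed
    then have "hausdorff_pre s \<delta> A \<le> 0 + ennreal e" if "e > 0" for e using that by simp
    then have "hausdorff_pre s \<delta> A \<le> 0" by (rule ennreal_le_epsilon)
    then show ?thesis by simp
  qed
  then show ?thesis unfolding hausdorff_measure_def by (simp add: SUP_eq_const)
qed

lemma hausdorff_pre_eq_0:
  "hausdorff_measure s A = 0 \<Longrightarrow> \<delta> > 0 \<Longrightarrow> hausdorff_pre s \<delta> A = 0"
proof -
  assume a: "hausdorff_measure s A = 0" "\<delta> > 0"
  have "hausdorff_pre s \<delta> A \<le> hausdorff_measure s A" unfolding hausdorff_measure_def using a by (intro SUP_upper) auto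
  then show ?thesis using a by simp
qed

lemma hausdorff_dim_le: "hausdorff_measure s A = 0 \<Longrightarrow> 0 \<le> s \<Longrightarrow> hausdorff_dim A \<le> s"
  unfolding hausdorff_dim_def by (rule cInf_lower) (auto intro!: bdd_belowI[of _ 0])

section \<open>Square grids, and dimensions as genuine infima\<close>

definition square :: "real \<Rightarrow> int \<times> int \<Rightarrow> complex set" where
  "square h c = {z. \<lfloor>Re z / h\<rfloor> = fst c \<and> \<lfloor>Im z / h\<rfloor> = snd c}"

lemma square_norm_diff:
  assumes "h > 0" "x \<in> square h c" "y \<in> square h c"
  shows "norm (x - y) \<le> 2 * h"
proof -
  have *: "\<bar>u - v\<bar> \<le> h" if "\<lfloor>u / h\<rfloor> = \<lfloor>v / h\<rfloor>" for u v
  proof -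
    have "\<bar>u / h - v / h\<bar> \<le> 1" using that by linarith
    then have "\<bar>(u - v) / h\<bar> \<le> 1" by (simp add: diff_divide_distrib)
    then show ?thesis using assms(1) by (simp add: abs_divide)
  qed
  have "norm (x - y) \<le> \<bar>Re (x - y)\<bar> + \<bar>Im (x - y)\<bar>" by (rule cmod_le)
  also have "\<dots> \<le> h + h" using *[of "Re x" "Re y"] *[of "Im x" "Im y"] assms by (intro add_mono) (auto simp: square_def)
  finally show ?thesis by simp
qed

lemma square_diam: "h > 0 \<Longrightarrow> bounded (square h c) \<and> diameter (square h c) \<le> 2 * h"
proof
  assume h: "h > 0"
  show "bounded (square h c)"
  proof (cases "square h c = {}")
    case False
    then obtain x where x: "x \<in> square h c" by auto
    have "square h c \<subseteq> cball x (2 * h)" using square_norm_diff[OF h x] by (auto simp: dist_norm)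
    then show ?thesis by (rule bounded_subset[OF bounded_cball])
  qed simp
  show "diameter (square h c) \<le> 2 * h" using square_norm_diff[OF h] h by (intro diameter_le) auto
qed

lemma square_borel: "square h c \<in> sets borel"
  unfolding square_def by measurable

text \<open>Ensures that the infimum in \<open>hausdorff_dim\<close> is taken over a nonempty set
  and so has its intended meaning. Any exponent above 2 would do. The windows of half-width n grow,
  so that every point lies in all late covers.\<close>

lemma hausdorff_measure_3_complex: "hausdorff_measure 3 (A :: complex set) = 0"
proof (rule hausdorff_measure_limsup_cover[where C = "\<lambda>n. {- int (n * 2 ^ n)..int (n * 2 ^ n)} \<times> {- int (n * 2 ^ n)..int (n * 2 ^ n)}"
      and Q = "\<lambda>n. square (1 / 2 ^ n)" and d = "\<lambda>n. 2 * (1 / 2 ^ n)"])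
  fix x :: complex and N :: nat
  define n where "n = max N (nat \<lceil>norm x\<rceil> + 1)"
  have nx: "norm x + 1 \<le> real n" unfolding n_def by linarith
  have *: "\<lfloor>u / (1 / 2 ^ n)\<rfloor> \<in> {- int (n * 2 ^ n)..int (n * 2 ^ n)}" if u: "\<bar>u\<bar> \<le> norm x" for u :: real
  proof -
    have "\<bar>u\<bar> \<le> real n - 1" using u nx by simp
    then have "\<bar>u * 2 ^ n\<bar> \<le> (real n - 1) * 2 ^ n" by (simp add: abs_mult)
    moreover have "(1::real) \<le> 2 ^ n" by simp
    moreover have "(real n - 1) * 2 ^ n = real (n * 2 ^ n) - 2 ^ n" by (simp add: left_diff_distrib)
    ultimately have "- real (n * 2 ^ n) \<le> u * 2 ^ n" "u * 2 ^ n \<le> real (n * 2 ^ n)"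
      by linarith+
    then have "- real_of_int (int (n * 2 ^ n)) \<le> u * 2 ^ n" "u * 2 ^ n \<le> real_of_int (int (n * 2 ^ n))" by simp_all
    then have "- int (n * 2 ^ n) \<le> \<lfloor>u * 2 ^ n\<rfloor>" "\<lfloor>u * 2 ^ n\<rfloor> \<le> int (n * 2 ^ n)"
      by (auto simp only: le_floor_iff floor_le_iff of_int_minus)
    then show ?thesis by simp
  qed
  have "x \<in> square (1 / 2 ^ n) (\<lfloor>Re x / (1 / 2 ^ n)\<rfloor>, \<lfloor>Im x / (1 / 2 ^ n)\<rfloor>)" by (simp add: square_def)
  moreover have "(\<lfloor>Re x / (1 / 2 ^ n)\<rfloor>, \<lfloor>Im x / (1 / 2 ^ n)\<rfloor>) \<in> {- int (n * 2 ^ n)..int (n * 2 ^ n)} \<times> {- int (n * 2 ^ n)..int (n * 2 ^ n)}"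
    using *[OF abs_Re_le_cmod] *[OF abs_Im_le_cmod] by blast
  ultimately show "\<exists>n\<ge>N. \<exists>c\<in>{- int (n * 2 ^ n)..int (n * 2 ^ n)} \<times> {- int (n * 2 ^ n)..int (n * 2 ^ n)}. x \<in> square (1 / 2 ^ n) c"
    unfolding n_def by (metis max.cobounded1)
next
  show "bounded (square (1 / 2 ^ n) c) \<and> diameter (square (1 / 2 ^ n) c) \<le> 2 * (1 / 2 ^ n)" for n c
    by (rule square_diam) simp
  show "(\<lambda>n. 2 * (1 / 2 ^ n) :: real) \<longlonglongrightarrow> 0" by real_asymp
  have bnd: "real (card ({- int (n * 2 ^ n)..int (n * 2 ^ n)} \<times> {- int (n * 2 ^ n)..int (n * 2 ^ n)})) * (2 * (1 / 2 ^ n)) powr 3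
      = (2 * real n * 2 ^ n + 1)\<^sup>2 * (2 / 2 ^ n) ^ 3" for n
  proof -
    have "real (card {- int (n * 2 ^ n)..int (n * 2 ^ n)}) = 2 * real n * 2 ^ n + 1"
      by (simp add: nat_add_distrib nat_mult_distrib nat_power_eq)
    moreover have "(2 * (1 / 2 ^ n) :: real) powr 3 = (2 / 2 ^ n) ^ 3"
      by (subst powr_realpow[symmetric]) auto
    ultimately show ?thesis by (simp add: card_cartesian_product power2_eq_square mult.assoc)
  qed
  show "summable (\<lambda>n. real (card ({- int (n * 2 ^ n)..int (n * 2 ^ n)} \<times> {- int (n * 2 ^ n)..int (n * 2 ^ n)})) * (2 * (1 / 2 ^ n)) powr 3)"
    unfolding bnd
  proof (rule summable_comparison_test_bigo)
    show "summable (\<lambda>n. norm (1 / real n ^ 2))"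
      using inverse_power_summable[of 2, where 'a=real] by (simp add: inverse_eq_divide)
    show "(\<lambda>n. (2 * real n * 2 ^ n + 1)\<^sup>2 * (2 / 2 ^ n) ^ 3) \<in> O(\<lambda>n. 1 / real n ^ 2)" by real_asymp
  qed
qed auto

lemma hausdorff_dim_ge:
  fixes A :: "complex set"
  assumes "\<And>s'. 0 \<le> s' \<Longrightarrow> s' < s \<Longrightarrow> hausdorff_measure s' A \<noteq> 0"
  shows "s \<le> hausdorff_dim A"
  unfolding hausdorff_dim_def
proof (rule cInf_greatest)
  show "{s. 0 \<le> s \<and> hausdorff_measure s A = 0} \<noteq> {}" using hausdorff_measure_3_complex[of A] by (intro ex_in_conv[THEN iffD1] exI[of _ 3]) simp
  fix x assume "x \<in> {s. 0 \<le> s \<and> hausdorff_measure s A = 0}"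
  then show "s \<le> x" using assms[of x] by force
qed

lemma hausdorff_dim_nonneg: "0 \<le> hausdorff_dim (A :: complex set)"
  by (rule hausdorff_dim_ge) simp

lemma hausdorff_dim_measure_le:
  fixes N :: "complex measure"
  shows "A \<in> sets borel \<Longrightarrow> emeasure N A > 0 \<Longrightarrow> hausdorff_dim_measure N \<le> hausdorff_dim A"
  unfolding hausdorff_dim_measure_def
  by (rule cInf_lower) (auto intro!: bdd_belowI[of _ 0] hausdorff_dim_nonneg)

lemma hausdorff_dim_measure_ge:
  fixes N :: "complex measure"
  assumes "emeasure N UNIV > 0" "\<And>A. A \<in> sets borel \<Longrightarrow> emeasure N A > 0 \<Longrightarrow> s \<le> hausdorff_dim A"
  shows "s \<le> hausdorff_dim_measure N"
  unfolding hausdorff_dim_measure_def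
proof (rule cInf_greatest)
  have "hausdorff_dim (UNIV::complex set) \<in> {hausdorff_dim A |A. A \<in> sets borel \<and> 0 < emeasure N A}" using assms(1) by force
  then show "{hausdorff_dim A |A. A \<in> sets borel \<and> 0 < emeasure N A} \<noteq> {}" by blast
qed (use assms(2) in auto)

text \<open>A 1-Lipschitz map turns covers into covers of the image with no larger
  diameters.\<close>

lemma hausdorff_dim_image_le:
  fixes f :: "complex \<Rightarrow> complex"
  assumes f: "\<And>x y. dist (f x) (f y) \<le> dist x y" and sub: "K \<subseteq> A"
  shows "hausdorff_dim (f ` K) \<le> hausdorff_dim A"
proof (rule ccontr)
  assume "\<not> ?thesis"
  then have lt: "hausdorff_dim A < hausdorff_dim (f ` K)" by simp
  have "hausdorff_dim (f ` K) \<le> hausdorff_dim A"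
  proof (rule hausdorff_dim_ge)
    fix s assume s: "0 \<le> s" "s < hausdorff_dim (f ` K)"
    show "hausdorff_measure s A \<noteq> 0"
    proof
      assume z: "hausdorff_measure s A = 0"
      have "hausdorff_pre s \<delta> (f ` K) \<le> hausdorff_pre s \<delta> A" for \<delta>
        unfolding hausdorff_pre_def
      proof (rule INF_greatest)
        fix U :: "nat \<Rightarrow> complex set" assume U: "U \<in> {U. A \<subseteq> (\<Union>n. U n) \<and> (\<forall>n. bounded (U n) \<and> diameter (U n) \<le> \<delta>)}"
        have b: "bounded (f ` U n) \<and> diameter (f ` U n) \<le> diameter (U n)" for n
        proof
          have bU: "bounded (U n)" using U by auto
          show "bounded (f ` U n)"
          proof -
            obtain x e where "\<forall>y\<in>U n. dist x y \<le> e" using bU by (auto simp: bounded_def)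
            then have "\<forall>y\<in>f ` U n. dist (f x) y \<le> e" using f order_trans by blast
            then show ?thesis unfolding bounded_def by blast
          qed
          show "diameter (f ` U n) \<le> diameter (U n)"
          proof (rule diameter_le)
            show "f ` U n \<noteq> {} \<or> 0 \<le> diameter (U n)" using diameter_ge_0[OF bU] by simp
            fix x y assume "x \<in> f ` U n" "y \<in> f ` U n"
            then obtain x' y' where "x' \<in> U n" "y' \<in> U n" "x = f x'" "y = f y'" by auto
            then show "norm (x - y) \<le> diameter (U n)"
              using order_trans[OF f[of x' y'] diameter_bounded_bound[OF bU]] by (simp add: dist_norm)
          qed
        qed
        have "(INF U\<in>{U. f ` K \<subseteq> (\<Union>n. U n) \<and> (\<forall>n. bounded (U n) \<and> diameter (U n) \<le> \<delta>)}. \<Sum>n. ennreal (diameter (U n) powr s))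
          \<le> (\<Sum>n. ennreal (diameter (f ` U n) powr s))"
        proof (rule INF_lower)
          have "f ` K \<subseteq> (\<Union>n. f ` U n)" using U sub by blast
          moreover have "bounded (f ` U n) \<and> diameter (f ` U n) \<le> \<delta>" for n using b[of n] U by (auto intro: order_trans)
          ultimately show "(\<lambda>n. f ` U n) \<in> {U. f ` K \<subseteq> (\<Union>n. U n) \<and> (\<forall>n. bounded (U n) \<and> diameter (U n) \<le> \<delta>)}" by blast
        qed
        also have "\<dots> \<le> (\<Sum>n. ennreal (diameter (U n) powr s))"
          using b s diameter_ge_0 by (intro suminf_le allI ennreal_leI powr_mono2) auto
        finally show "(INF U\<in>{U. f ` K \<subseteq> (\<Union>n. U n) \<and> (\<forall>n. bounded (U n) \<and> diameter (U n) \<le> \<delta>)}. \<Sum>n. ennreal (diameter (U n) powr s))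
          \<le> (\<Sum>n. ennreal (diameter (U n) powr s))" .
      qed
      then have "hausdorff_measure s (f ` K) \<le> hausdorff_measure s A"
        unfolding hausdorff_measure_def by (rule SUP_mono') 
      then have "hausdorff_measure s (f ` K) = 0" using z by simp
      then have "hausdorff_dim (f ` K) \<le> s" using s(1) by (rule hausdorff_dim_le)
      then show False using s by simp
    qed
  qed
  then show False using lt by simp
qed

text \<open>The image of a Borel set need not be Borel. Inner regularity replaces A by a compact
  subset of positive measure, whose image is compact.\<close>

lemma hausdorff_dim_measure_image_le:
  fixes N :: "complex measure" and f :: "complex \<Rightarrow> complex"
  assumes N: "sets N = sets borel" "finite_measure N"
    and pos: "emeasure N UNIV > 0"
    and f: "\<And>x y. dist (f x) (f y) \<le> dist x y"
  shows "hausdorff_dim_measure (distr N borel f) \<le> hausdorff_dim_measure N"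
proof (rule hausdorff_dim_measure_ge[OF pos])
  fix A :: "complex set" assume A: "A \<in> sets borel" "emeasure N A > 0"
  have cont: "continuous_on UNIV f"
    unfolding continuous_on_iff using f by (meson le_less_trans)
  then have fm: "f \<in> borel_measurable borel" by (rule borel_measurable_continuous_onI)
  have "emeasure N A = (SUP K \<in> {K. K \<subseteq> A \<and> compact K}. emeasure N K)"
    using N A by (intro inner_regular) (auto simp: finite_measure.emeasure_finite)
  then have "0 < (SUP K \<in> {K. K \<subseteq> A \<and> compact K}. emeasure N K)" using A by simp
  then obtain K where K: "K \<subseteq> A" "compact K" "emeasure N K > 0" unfolding less_SUP_iff by auto
  have cK: "compact (f ` K)" using K cont by (intro compact_continuous_image) (auto intro: continuous_on_subset)
  then have bK: "f ` K \<in> sets borel" by (intro borel_closed compact_imp_closed)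
  have "f \<in> measurable N borel" using fm N by (simp cong: measurable_cong_sets)
  then have "emeasure (distr N borel f) (f ` K) = emeasure N (f -` (f ` K) \<inter> space N)"
    using bK by (rule emeasure_distr)
  also have "\<dots> \<ge> emeasure N K"
  proof (rule emeasure_mono)
    have "space N = UNIV" using N(1) sets_eq_imp_space_eq by fastforce
    then show "K \<subseteq> f -` f ` K \<inter> space N" by auto
    have "f -` (f ` K) \<inter> space N \<in> sets N" using \<open>f \<in> measurable N borel\<close> bK by (rule measurable_sets)
    then show "f -` f ` K \<inter> space N \<in> sets N" .
  qed
  finally have "emeasure (distr N borel f) (f ` K) > 0" using K by (simp add: less_le_trans)
  then have "hausdorff_dim_measure (distr N borel f) \<le> hausdorff_dim (f ` K)"
    using bK by (intro hausdorff_dim_measure_le) auto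
  also have "\<dots> \<le> hausdorff_dim A" using f K(1) by (rule hausdorff_dim_image_le)
  finally show "hausdorff_dim_measure (distr N borel f) \<le> hausdorff_dim A" .
qed

text \<open>Formulated for a random point g on an abstract space, so that ball masses of a
  projection can be estimated directly on the symbol sequences. A covering set that meets the image
  of E lies in a ball about one of its points there, with radius its diameter. At
  \<open>d = 0\<close> the assumption says that the fibres through E are null, as
  \<open>0 powr s = 0\<close>.\<close>

lemma mass_distribution:
  fixes g :: "'b \<Rightarrow> complex" and A :: "complex set"
  assumes fm: "finite_measure M" and g: "g \<in> borel_measurable M"
    and E: "E \<in> sets M" "emeasure M E > 0" "\<And>x. x \<in> E \<Longrightarrow> g x \<in> A"
    and C: "C > 0" "\<delta> > 0"
    and b: "\<And>x d. x \<in> E \<Longrightarrow> 0 \<le> d \<Longrightarrow> d < \<delta> \<Longrightarrow> measure M {y\<in>space M. dist (g y) (g x) \<le> d} \<le> C * d powr s"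
  shows "hausdorff_measure s A \<noteq> 0"
proof
  interpret finite_measure M by fact
  assume "hausdorff_measure s A = 0"
  then have "hausdorff_pre s (\<delta>/2) A = 0" using C by (intro hausdorff_pre_eq_0) auto
  moreover have "emeasure M E / ennreal C > 0" using E C by (simp add: ennreal_zero_less_divide)
  ultimately have "hausdorff_pre s (\<delta>/2) A < emeasure M E / ennreal C" by simp
  then obtain U where U: "A \<subseteq> (\<Union>n. U n)" "\<And>n. bounded (U n)" "\<And>n. diameter (U n) \<le> \<delta>/2"
    and lt: "(\<Sum>n. ennreal (diameter (U n) powr s)) < emeasure M E / ennreal C"
    unfolding hausdorff_pre_def INF_less_iff by auto
  define V where "V n = (if \<exists>x\<in>E. g x \<in> U n then {y\<in>space M. dist (g y) (g (SOME x. x \<in> E \<and> g x \<in> U n)) \<le> diameter (U n)} else {})" for n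
  have Vm: "V n \<in> sets M" for n unfolding V_def using g by (auto intro!: measurable_sets_Collect)
  have V: "emeasure M (V n) \<le> ennreal C * ennreal (diameter (U n) powr s)" for n
  proof (cases "\<exists>x\<in>E. g x \<in> U n")
    case True
    define x where "x = (SOME x. x \<in> E \<and> g x \<in> U n)"
    have x: "x \<in> E \<and> g x \<in> U n" unfolding x_def by (rule someI_ex) (use True in auto)
    have "measure M {y\<in>space M. dist (g y) (g x) \<le> diameter (U n)} \<le> C * diameter (U n) powr s"
      using x U(2,3)[of n] C by (intro b) (auto intro: diameter_ge_0 intro!: le_less_trans[OF U(3)])
    then show ?thesis using True C unfolding V_def x_def[symmetric]
      by (simp add: emeasure_eq_measure ennreal_mult[symmetric])
  next
    case False then show ?thesis by (auto simp: V_def)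
  qed
  have "E \<subseteq> (\<Union>n. V n)"
  proof
    fix y assume y: "y \<in> E"
    then obtain n where n: "g y \<in> U n" using E(3) U(1) by blast
    define x where "x = (SOME x. x \<in> E \<and> g x \<in> U n)"
    have x: "x \<in> E \<and> g x \<in> U n" unfolding x_def by (rule someI_ex) (use n y in auto)
    have "dist (g y) (g x) \<le> diameter (U n)" using n x U(2) by (intro diameter_bounded_bound) auto
    then have "y \<in> V n" unfolding V_def x_def[symmetric] using y n sets.sets_into_space[OF E(1)] by auto
    then show "y \<in> (\<Union>n. V n)" by blast
  qed
  then have "emeasure M E \<le> emeasure M (\<Union>n. V n)" using Vm by (intro emeasure_mono) auto
  also have "\<dots> \<le> (\<Sum>n. emeasure M (V n))" using Vm by (intro emeasure_subadditive_countably) auto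
  also have "\<dots> \<le> (\<Sum>n. ennreal C * ennreal (diameter (U n) powr s))" using V by (intro suminf_le) auto
  also have "\<dots> = ennreal C * (\<Sum>n. ennreal (diameter (U n) powr s))" by (rule ennreal_suminf_cmult)
  also have "\<dots> < ennreal C * (emeasure M E / ennreal C)"
    using lt C by (intro ennreal_mult_strict_left_mono) auto
  also have "\<dots> = emeasure M E" using C
    by (simp add: emeasure_eq_measure divide_ennreal ennreal_mult[symmetric])
  finally show False by simp
qed

section \<open>Words and their projections\<close>

primrec weight :: "(nat \<Rightarrow> nat \<Rightarrow> real) \<Rightarrow> nat list \<Rightarrow> real" where
  "weight p [] = 1"
| "weight p (i # l) = p 0 i * weight (\<lambda>j. p (Suc j)) l"

definition words :: "nat \<Rightarrow> nat \<Rightarrow> nat list set" where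
  "words m n = {l. set l \<subseteq> {1..m} \<and> length l = n}"

definition pvec :: "nat \<Rightarrow> (nat \<Rightarrow> nat \<Rightarrow> real) \<Rightarrow> bool" where
  "pvec m p \<longleftrightarrow> (\<forall>j. (\<forall>i\<in>{1..m}. 0 \<le> p j i) \<and> (\<Sum>i=1..m. p j i) = 1)"

text \<open>Signed coordinate along the unit vector \<open>cis \<beta>\<close>, so that cells are
  intervals of reals rather than pieces of a line in the plane.\<close>

definition dir :: "real \<Rightarrow> complex \<Rightarrow> real" where
  "dir \<beta> z = Re (z * cis (- \<beta>))"

definition nshift :: "nat \<Rightarrow> (nat \<Rightarrow> 'a) \<Rightarrow> nat \<Rightarrow> 'a" where
  "nshift n p = (\<lambda>j. p (n + j))"

lemma pvec_nshift: "pvec m p \<Longrightarrow> pvec m (nshift n p)"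
  by (simp add: pvec_def nshift_def)

lemma finite_words [simp]: "finite (words m n)"
  unfolding words_def using finite_lists_length_eq[of "{1..m}" n] by simp

lemma card_words: "card (words m n) = m ^ n"
  unfolding words_def using card_lists_length_eq[of "{1..m}" n] by simp

lemma weight_append: "weight p (u @ v) = weight p u * weight (nshift (length u) p) v"
  by (induction u arbitrary: p) (auto simp: nshift_def)

lemma weight_nonneg: "pvec m p \<Longrightarrow> set l \<subseteq> {1..m} \<Longrightarrow> weight p l \<ge> 0"
proof (induction l arbitrary: p)
  case (Cons i l)
  have "pvec m (\<lambda>j. p (Suc j))" using Cons.prems by (simp add: pvec_def)
  then show ?case using Cons by (auto simp: pvec_def)
qed simp

lemma weight_words_nonneg: "pvec m p \<Longrightarrow> l \<in> words m n \<Longrightarrow> weight p l \<ge> 0"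
  unfolding words_def using weight_nonneg[of m p l] by blast

lemma words_add_bij: "bij_betw (\<lambda>(u, v). u @ v) (words m n \<times> words m k) (words m (n + k))"
proof (rule bij_betw_byWitness[where f' = "\<lambda>l. (take n l, drop n l)"])
  show "(\<lambda>l. (take n l, drop n l)) ` words m (n + k) \<subseteq> words m n \<times> words m k"
    unfolding words_def by (auto dest!: in_set_takeD in_set_dropD)
  show "(\<lambda>(u, v). u @ v) ` (words m n \<times> words m k) \<subseteq> words m (n + k)"
    unfolding words_def by fastforce
qed (auto simp: words_def)

lemma sum_words_add:
  "(\<Sum>l\<in>words m (n + k). F l) = (\<Sum>u\<in>words m n. \<Sum>v\<in>words m k. F (u @ v))"
  unfolding sum.reindex_bij_betw[OF words_add_bij, symmetric]
  by (simp add: sum.cartesian_product split_def)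

lemma words_0: "words m 0 = {[]}"
  by (auto simp: words_def)

lemma words_1: "words m (Suc 0) = (\<lambda>i. [i]) ` {1..m}"
  by (auto simp: words_def length_Suc_conv)

lemma sum_weight: "pvec m p \<Longrightarrow> (\<Sum>l\<in>words m n. weight p l) = 1"
proof (induction n arbitrary: p)
  case 0 then show ?case by (simp add: words_0)
next
  case (Suc n)
  have "(\<Sum>l\<in>words m (1 + n). weight p l) = (\<Sum>u\<in>words m 1. \<Sum>v\<in>words m n. weight p (u @ v))"
    by (rule sum_words_add)
  also have "\<dots> = (\<Sum>u\<in>words m 1. weight p u * (\<Sum>v\<in>words m n. weight (nshift 1 p) v))"
    by (intro sum.cong) (auto simp: weight_append words_def sum_distrib_left)
  also have "\<dots> = (\<Sum>u\<in>words m 1. weight p u)"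
    using Suc.IH[OF pvec_nshift[OF Suc.prems]] by simp
  also have "\<dots> = (\<Sum>i=1..m. p 0 i)"
    by (simp add: words_1 sum.reindex inj_on_def)
  also have "\<dots> = 1" using Suc.prems by (simp add: pvec_def)
  finally show ?case by simp
qed

lemma dir_add: "dir \<beta> (x + y) = dir \<beta> x + dir \<beta> y"
  by (simp add: dir_def algebra_simps)

lemma dir_diff: "dir \<beta> (x - y) = dir \<beta> x - dir \<beta> y"
  by (simp add: dir_def algebra_simps)

lemma abs_dir_le: "\<bar>dir \<beta> z\<bar> \<le> norm z"
  unfolding dir_def using abs_Re_le_cmod[of "z * cis (-\<beta>)"] by (simp add: norm_mult)

lemma dir_period: "dir (\<beta> + 2 * pi * of_int j) z = dir \<beta> z"
proof -
  have "cis (- (\<beta> + 2 * pi * of_int j)) = cis (- \<beta>)"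
    using cis_multiple_2pi[of "- of_int j"] cis_mult[of "- \<beta>" "2 * pi * - of_int j"]
    by (simp add: algebra_simps)
  then show ?thesis by (simp add: dir_def)
qed

lemma norm_cis_diff_le: "norm (cis x - cis y) \<le> \<bar>x - y\<bar>"
proof -
  have "norm (cis x - cis y) = 2 * \<bar>sin ((x - y) / 2)\<bar>"
  proof -
    have "cis x = cis y * exp (\<i> * of_real (x - y))"
      using cis_mult[of y "x - y"] by (simp only: cis_conv_exp[symmetric]) simp
    then have "cis x - cis y = cis y * (exp (\<i> * of_real (x - y)) - 1)"
      by (simp only: right_diff_distrib mult_1_right)
    then show ?thesis using dist_exp_i_1[of "x - y"] by (simp add: norm_mult)
  qed
  also have "\<dots> \<le> 2 * \<bar>(x - y) / 2\<bar>" using abs_sin_x_le_abs_x[of "(x-y)/2"] by simp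
  finally show ?thesis by simp
qed

lemma dir_cont: "\<bar>dir \<beta> z - dir \<beta>' z\<bar> \<le> \<bar>\<beta> - \<beta>'\<bar> * norm z"
proof -
  have "\<bar>dir \<beta> z - dir \<beta>' z\<bar> = \<bar>Re (z * (cis (-\<beta>) - cis (-\<beta>')))\<bar>"
    by (simp add: dir_def algebra_simps)
  also have "\<dots> \<le> norm (z * (cis (-\<beta>) - cis (-\<beta>')))" by (rule abs_Re_le_cmod)
  also have "\<dots> \<le> norm z * \<bar>\<beta> - \<beta>'\<bar>"
    unfolding norm_mult using norm_cis_diff_le[of "-\<beta>" "-\<beta>'"]
    by (intro mult_left_mono) auto
  finally show ?thesis by (simp add: mult.commute)
qed

section \<open>Projected cells at scale \<open>r ^ n\<close> and submultiplicativity\<close>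

locale similarity_ifs =
  fixes r \<theta> :: real and m :: nat and a :: "nat \<Rightarrow> complex"
  assumes r0: "0 < r" and r1: "r < 1" and m1: "1 \<le> m"
begin

definition S :: complex where "S = complex_of_real r * cis \<theta>"

text \<open>Chosen so that \<open>norm (a i) + r * R <= R\<close> for every digit i: the disc of
  radius R about 0 is mapped into itself.\<close>

definition R :: real where "R = (\<Sum>i=1..m. norm (a i)) / (1 - r)"

text \<open>The image of 0 under the composition of the maps along the word, by
  \<open>ifs_iter_pos\<close>.\<close>

primrec pos :: "nat list \<Rightarrow> complex" where
  "pos [] = 0"
| "pos (i # l) = a i + S * pos l"

definition cell :: "nat \<Rightarrow> real \<Rightarrow> int" where "cell n x = \<lfloor>x / r ^ n\<rfloor>"

definition dcell :: "nat \<Rightarrow> real \<Rightarrow> nat list \<Rightarrow> int" where "dcell n \<beta> l = cell n (dir \<beta> (pos l))"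

definition rsum :: "real \<Rightarrow> (nat \<Rightarrow> nat \<Rightarrow> real) \<Rightarrow> nat \<Rightarrow> real \<Rightarrow> real" where
  "rsum t p n \<beta> = power_sum t (weight p) (words m n) (dcell n \<beta>)"

lemma norm_S: "norm S = r"
  using r0 by (simp add: S_def norm_mult)

lemma R_nonneg: "R \<ge> 0"
  unfolding R_def using r1 by (auto intro!: divide_nonneg_pos sum_nonneg)

lemma norm_a_le: "i \<in> {1..m} \<Longrightarrow> norm (a i) \<le> R * (1 - r)"
  unfolding R_def using r1 by (auto intro!: member_le_sum)

lemma norm_pos_le: "set l \<subseteq> {1..m} \<Longrightarrow> norm (pos l) \<le> R"
proof (induction l)
  case Nil then show ?case using R_nonneg by simp
next
  case (Cons i l)
  have "norm (pos (i # l)) \<le> norm (a i) + r * norm (pos l)"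
    using norm_triangle_ineq[of "a i" "S * pos l"] by (simp add: norm_mult norm_S)
  also have "\<dots> \<le> R * (1 - r) + r * R"
    using Cons r0 norm_a_le[of i] by (intro add_mono mult_left_mono) auto
  finally show ?case by (simp add: algebra_simps)
qed

lemma pos_append: "pos (u @ v) = pos u + S ^ length u * pos v"
  by (induction u) (auto simp: algebra_simps)

lemma dir_scale: "dir \<beta> (S ^ n * z) = r ^ n * dir (\<beta> - real n * \<theta>) z"
proof -
  have "S ^ n = complex_of_real (r ^ n) * cis (real n * \<theta>)"
    by (simp only: S_def power_mult_distrib Complex.DeMoivre of_real_power)
  then have "S ^ n * z * cis (- \<beta>) = complex_of_real (r ^ n) * (z * (cis (real n * \<theta>) * cis (- \<beta>)))"
    by (simp add: algebra_simps)
  also have "cis (real n * \<theta>) * cis (- \<beta>) = cis (- (\<beta> - real n * \<theta>))"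
    by (simp add: cis_mult algebra_simps)
  finally have "Re (S ^ n * z * cis (- \<beta>)) = Re (complex_of_real (r ^ n) * (z * cis (- (\<beta> - real n * \<theta>))))"
    by (rule arg_cong)
  also have "\<dots> = r ^ n * Re (z * cis (- (\<beta> - real n * \<theta>)))"
    by (simp only: times_complex.sel Re_complex_of_real Im_complex_of_real)
  finally show ?thesis unfolding dir_def .
qed

lemma rn: "0 < r ^ n" "r ^ n \<le> 1" using r0 r1 by (auto intro: power_le_one)

lemma cell_card:
  assumes "\<And>u. u \<in> U \<Longrightarrow> x * r ^ n \<le> f u \<and> f u \<le> y * r ^ n" "x \<le> y"
  shows "finite ((\<lambda>u. cell n (f u)) ` U)" "real (card ((\<lambda>u. cell n (f u)) ` U)) \<le> y - x + 2"
proof -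
  have *: "x - 1 \<le> of_int z \<and> of_int z \<le> y" if z: "z \<in> (\<lambda>u. cell n (f u)) ` U" for z
  proof -
    obtain u where u: "u \<in> U" "z = cell n (f u)" using z by auto
    have "x \<le> f u / r ^ n" "f u / r ^ n \<le> y"
      using assms(1)[OF u(1)] rn[of n] by (auto simp: field_simps)
    then show ?thesis unfolding u cell_def by linarith
  qed
  from card_int_interval_le[of "(\<lambda>u. cell n (f u)) ` U" "x - 1" y, OF *] assms(2)
  show "finite ((\<lambda>u. cell n (f u)) ` U)" "real (card ((\<lambda>u. cell n (f u)) ` U)) \<le> y - x + 2"
    by auto
qed

lemma cell_bounds: "cell n x = b \<Longrightarrow> of_int b * r ^ n \<le> x \<and> x \<le> (of_int b + 1) * r ^ n"
proof -
  assume "cell n x = b"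
  then have "of_int b \<le> x / r ^ n" "x / r ^ n \<le> of_int b + 1" unfolding cell_def by linarith+
  then show ?thesis using rn[of n] by (auto simp: field_simps)
qed

text \<open>A cell of g corresponds to values of f in an interval of \<open>1 + 2 * \<rho>\<close>
  cell lengths, which meets at most \<open>2 * \<rho> + 3\<close> cells.\<close>

lemma power_sum_cell_cmp:
  assumes fin: "finite U" and W: "\<And>u. u \<in> U \<Longrightarrow> W u \<ge> 0" and t: "t \<ge> 0"
    and d: "\<And>u. u \<in> U \<Longrightarrow> \<bar>f u - g u\<bar> \<le> \<rho> * r ^ n" and \<rho>: "\<rho> \<ge> 0"
  shows "power_sum t W U (\<lambda>u. cell n (g u)) \<le> (2 * \<rho> + 3) powr t * power_sum t W U (\<lambda>u. cell n (f u))"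
proof (rule power_sum_cmp[OF fin W t])
  fix b :: int
  have "real (card ((\<lambda>u. cell n (f u)) ` {u \<in> U. cell n (g u) = b})) \<le> (of_int b + 1 + \<rho>) - (of_int b - \<rho>) + 2"
  proof (rule cell_card)
    fix u assume u: "u \<in> {u \<in> U. cell n (g u) = b}"
    then have "of_int b * r ^ n \<le> g u \<and> g u \<le> (of_int b + 1) * r ^ n" by (intro cell_bounds) auto
    then show "(of_int b - \<rho>) * r ^ n \<le> f u \<and> f u \<le> (of_int b + 1 + \<rho>) * r ^ n"
      using d[of u] u by (auto simp: algebra_simps)
  qed (use \<rho> in simp)
  then show "real (card ((\<lambda>u. cell n (f u)) ` {u \<in> U. cell n (g u) = b})) \<le> 2 * \<rho> + 3" by simp
qed

text \<open>A cell of the long word is refined to the pair \<open>?\<alpha>\<close> that also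
  records the cell of the prefix. The suffix moves the point by at most \<open>R * r ^ n\<close>, so
  each long cell meets at most \<open>2 * R + 3\<close> prefix cells. Inside a prefix cell, the mass
  of a long cell is a weighted sum, over prefixes u, of masses of translates of the suffix law.
  Jensen's inequality takes the power inside this sum, and each translation costs a factor
  3^t.\<close>

lemma rsum_submult:
  assumes p: "pvec m p" and t: "t \<ge> 0"
  shows "rsum t p (n + k) \<beta> \<le> (3 * (2 * R + 3)) powr t * (rsum t p n \<beta> * rsum t (nshift n p) k (\<beta> - real n * \<theta>))"
proof -
  let ?\<gamma> = "dcell (n + k) \<beta>"
  let ?\<alpha> = "\<lambda>l. (dcell n \<beta> (take n l), ?\<gamma> l)"
  let ?p' = "nshift n p" and ?\<beta>' = "\<beta> - real n * \<theta>"
  let ?W = "weight p" and ?W' = "weight ?p'"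
  have p': "pvec m ?p'" using p by (rule pvec_nshift)
  have posapp: "dir \<beta> (pos (u @ v)) = dir \<beta> (pos u) + r ^ n * dir ?\<beta>' (pos v)"
    if "u \<in> words m n" for u v
    using that dir_scale[of \<beta> n "pos v"] by (simp add: pos_append dir_add words_def)
  have 1: "rsum t p (n + k) \<beta> \<le> (2 * R + 3) powr t * power_sum t ?W (words m (n + k)) ?\<alpha>"
    unfolding rsum_def
  proof (rule power_sum_cmp)
    fix b
    let ?U = "{u \<in> words m (n + k). ?\<gamma> u = b}"
    have "real (card (?\<alpha> ` ?U)) \<le> real (card ((\<lambda>l. cell n (dir \<beta> (pos (take n l)))) ` ?U))"
    proof -
      have "?\<alpha> ` ?U = (\<lambda>c. (c, b)) ` ((\<lambda>l. cell n (dir \<beta> (pos (take n l)))) ` ?U)"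
        by (auto simp: dcell_def image_image)
      then show ?thesis using card_image_le[of "(\<lambda>l. cell n (dir \<beta> (pos (take n l)))) ` ?U" "\<lambda>c. (c, b)"] by simp
    qed
    also have "\<dots> \<le> ((of_int b + 1) * r ^ k + R) - (of_int b * r ^ k - R) + 2"
    proof (rule cell_card)
      fix l assume l: "l \<in> ?U"
      have lb: "of_int b * r ^ (n + k) \<le> dir \<beta> (pos l) \<and> dir \<beta> (pos l) \<le> (of_int b + 1) * r ^ (n + k)"
        using l by (intro cell_bounds) (auto simp: dcell_def)
      have tw: "take n l \<in> words m n" "set (drop n l) \<subseteq> {1..m}" using l by (auto simp: words_def dest: in_set_takeD in_set_dropD)
      have e: "dir \<beta> (pos l) = dir \<beta> (pos (take n l)) + r ^ n * dir ?\<beta>' (pos (drop n l))"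
        using posapp[OF tw(1), of "drop n l"] by simp
      have "\<bar>dir ?\<beta>' (pos (drop n l))\<bar> \<le> R"
        using abs_dir_le[of ?\<beta>' "pos (drop n l)"] norm_pos_le[OF tw(2)] by linarith
      then have "r ^ n * \<bar>dir ?\<beta>' (pos (drop n l))\<bar> \<le> r ^ n * R" using rn[of n] by (intro mult_left_mono) auto
      then have "\<bar>r ^ n * dir ?\<beta>' (pos (drop n l))\<bar> \<le> r ^ n * R" using rn[of n] by (simp add: abs_mult)
      then show "(of_int b * r ^ k - R) * r ^ n \<le> dir \<beta> (pos (take n l)) \<and>
          dir \<beta> (pos (take n l)) \<le> ((of_int b + 1) * r ^ k + R) * r ^ n"
        using lb e by (auto simp: algebra_simps power_add)
    qed (use R_nonneg rn[of k] in \<open>auto simp: algebra_simps\<close>)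
    also have "\<dots> \<le> 2 * R + 3" using rn[of k] by (simp add: algebra_simps)
    finally show "real (card (?\<alpha> ` ?U)) \<le> 2 * R + 3" .
  qed (use t p in \<open>auto intro: weight_words_nonneg\<close>)
  let ?A = "dcell n \<beta> ` words m n" and ?B = "?\<gamma> ` words m (n + k)"
  let ?g = "\<lambda>u v. cell (n + k) (dir \<beta> (pos u) + r ^ n * dir ?\<beta>' (pos v))"
  have mass: "mass ?W (words m (n + k)) ?\<alpha> (I, J)
      = (\<Sum>u\<in>{u\<in>words m n. dcell n \<beta> u = I}. ?W u * mass ?W' (words m k) (?g u) J)" for I J
  proof -
    have "mass ?W (words m (n + k)) ?\<alpha> (I, J) = (\<Sum>l\<in>words m (n + k). if ?\<alpha> l = (I, J) then ?W l else 0)"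
      unfolding mass_def by (simp add: sum.inter_filter)
    also have "\<dots> = (\<Sum>u\<in>words m n. \<Sum>v\<in>words m k. if ?\<alpha> (u @ v) = (I, J) then ?W (u @ v) else 0)"
      by (rule sum_words_add)
    also have "\<dots> = (\<Sum>u\<in>words m n. if dcell n \<beta> u = I then ?W u * mass ?W' (words m k) (?g u) J else 0)"
    proof (intro sum.cong refl)
      fix u assume u: "u \<in> words m n"
      then have lu: "length u = n" by (simp add: words_def)
      have "(\<Sum>v\<in>words m k. if ?\<alpha> (u @ v) = (I, J) then ?W (u @ v) else 0)
        = (\<Sum>v\<in>words m k. if dcell n \<beta> u = I then ?W u * (if ?g u v = J then ?W' v else 0) else 0)"
        using lu posapp[OF u] by (intro sum.cong) (auto simp: weight_append dcell_def)
      also have "\<dots> = (if dcell n \<beta> u = I then ?W u * mass ?W' (words m k) (?g u) J else 0)"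
        unfolding mass_def by (simp add: sum.inter_filter sum_distrib_left)
      finally show "(\<Sum>v\<in>words m k. if ?\<alpha> (u @ v) = (I, J) then ?W (u @ v) else 0)
        = (if dcell n \<beta> u = I then ?W u * mass ?W' (words m k) (?g u) J else 0)" .
    qed
    also have "\<dots> = (\<Sum>u\<in>{u\<in>words m n. dcell n \<beta> u = I}. ?W u * mass ?W' (words m k) (?g u) J)"
      by (simp add: sum.inter_filter)
    finally show ?thesis .
  qed
  have Bu: "?g u ` words m k \<subseteq> ?B" if u: "u \<in> words m n" for u
  proof
    fix c assume "c \<in> ?g u ` words m k"
    then obtain v where v: "v \<in> words m k" "c = ?g u v" by auto
    then have "u @ v \<in> words m (n + k)" "c = ?\<gamma> (u @ v)"
      using u posapp[OF u, of v] by (auto simp: words_def dcell_def)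
    then show "c \<in> ?B" by blast
  qed
  \<comment> \<open>Prefixes in one cell have different offsets from the fine grid. An interval of
    one cell length meets at most 3 cells, whatever its offset.\<close>
  have gu: "power_sum t ?W' (words m k) (?g u) \<le> 3 powr t * rsum t ?p' k ?\<beta>'" for u
    unfolding rsum_def
  proof (rule power_sum_cmp)
    fix b
    let ?U = "{v \<in> words m k. ?g u v = b}"
    define c where "c = dir \<beta> (pos u) / r ^ (n + k)"
    have "real (card ((\<lambda>v. cell k (dir ?\<beta>' (pos v))) ` ?U)) \<le> (of_int b + 1 - c) - (of_int b - c) + 2"
    proof (rule cell_card)
      fix v assume "v \<in> ?U"
      then have v: "of_int b * r ^ (n + k) \<le> dir \<beta> (pos u) + r ^ n * dir ?\<beta>' (pos v) \<and>
         dir \<beta> (pos u) + r ^ n * dir ?\<beta>' (pos v) \<le> (of_int b + 1) * r ^ (n + k)"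
        by (intro cell_bounds) auto
      have cc: "dir \<beta> (pos u) = c * r ^ (n + k)" unfolding c_def using rn(1)[of "n+k"] by (metis less_irrefl nonzero_eq_divide_eq)
      have "r ^ n * ((of_int b - c) * r ^ k) \<le> r ^ n * dir ?\<beta>' (pos v) \<and>
          r ^ n * dir ?\<beta>' (pos v) \<le> r ^ n * ((of_int b + 1 - c) * r ^ k)"
        using v unfolding cc power_add by (auto simp: algebra_simps)
      then show "(of_int b - c) * r ^ k \<le> dir ?\<beta>' (pos v) \<and>
          dir ?\<beta>' (pos v) \<le> (of_int b + 1 - c) * r ^ k"
        using rn[of n] by simp
    qed simp
    then show "real (card (dcell k ?\<beta>' ` ?U)) \<le> 3" by (simp add: dcell_def[abs_def])
  qed (use t p' in \<open>auto intro: weight_words_nonneg\<close>)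
  have "power_sum t ?W (words m (n + k)) ?\<alpha> = (\<Sum>c\<in>?A \<times> ?B. mass ?W (words m (n + k)) ?\<alpha> c powr (1 + t))"
  proof (rule power_sum_superset)
    show "?\<alpha> ` words m (n + k) \<subseteq> ?A \<times> ?B"
    proof -
      have "take n l \<in> words m n" if "l \<in> words m (n + k)" for l
        using that by (auto simp: words_def dest: in_set_takeD)
      then show ?thesis by auto
    qed
  qed auto
  also have "\<dots> = (\<Sum>I\<in>?A. \<Sum>J\<in>?B. mass ?W (words m (n + k)) ?\<alpha> (I, J) powr (1 + t))"
    by (simp add: sum.cartesian_product)
  also have "\<dots> \<le> (\<Sum>I\<in>?A. mass ?W (words m n) (dcell n \<beta>) I powr (1 + t) * (3 powr t * rsum t ?p' k ?\<beta>'))"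
  proof (rule sum_mono)
    fix I assume "I \<in> ?A"
    let ?U = "{u\<in>words m n. dcell n \<beta> u = I}"
    let ?q = "mass ?W (words m n) (dcell n \<beta>) I"
    have q: "?q = (\<Sum>u\<in>?U. ?W u)" unfolding mass_def ..
    have W0: "?W u \<ge> 0" if "u \<in> ?U" for u using that p by (auto intro: weight_words_nonneg)
    have q0: "?q \<ge> 0" unfolding q using W0 by (intro sum_nonneg) auto
    have "(\<Sum>J\<in>?B. mass ?W (words m (n + k)) ?\<alpha> (I, J) powr (1 + t))
      \<le> (\<Sum>J\<in>?B. ?q powr t * (\<Sum>u\<in>?U. ?W u * mass ?W' (words m k) (?g u) J powr (1 + t)))"
      unfolding mass q using W0 t p'
      by (intro sum_mono jensen_powr) (auto intro!: mass_nonneg weight_words_nonneg)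
    also have "\<dots> = ?q powr t * (\<Sum>u\<in>?U. ?W u * (\<Sum>J\<in>?B. mass ?W' (words m k) (?g u) J powr (1 + t)))"
      unfolding sum_distrib_left[symmetric] by (subst sum.swap) (simp add: sum_distrib_left)
    also have "\<dots> = ?q powr t * (\<Sum>u\<in>?U. ?W u * power_sum t ?W' (words m k) (?g u))"
    proof -
      have "power_sum t ?W' (words m k) (?g u) = (\<Sum>J\<in>?B. mass ?W' (words m k) (?g u) J powr (1 + t))"
        if "u \<in> ?U" for u
        using that by (intro power_sum_superset Bu) auto
      then show ?thesis by simp
    qed
    also have "\<dots> \<le> ?q powr t * (\<Sum>u\<in>?U. ?W u * (3 powr t * rsum t ?p' k ?\<beta>'))"
      using W0 gu by (intro mult_left_mono sum_mono) auto
    also have "\<dots> = ?q powr t * ?q * (3 powr t * rsum t ?p' k ?\<beta>')"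
      unfolding q by (simp add: sum_distrib_right)
    also have "?q powr t * ?q = ?q powr (1 + t)"
      using q0 by (cases "?q = 0") (auto simp: powr_add)
    finally show "(\<Sum>J\<in>?B. mass ?W (words m (n + k)) ?\<alpha> (I, J) powr (1 + t))
        \<le> ?q powr (1 + t) * (3 powr t * rsum t ?p' k ?\<beta>')" .
  qed
  also have "\<dots> = 3 powr t * (rsum t p n \<beta> * rsum t ?p' k ?\<beta>')"
  proof -
    have "(\<Sum>I\<in>?A. mass ?W (words m n) (dcell n \<beta>) I powr (1 + t) * (3 powr t * rsum t ?p' k ?\<beta>'))
      = rsum t p n \<beta> * (3 powr t * rsum t ?p' k ?\<beta>')"
      unfolding sum_distrib_right[symmetric] rsum_def[of t p] power_sum_def[of t ?W "words m n"] ..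
    then show ?thesis by simp
  qed
  finally have "power_sum t ?W (words m (n + k)) ?\<alpha> \<le> 3 powr t * (rsum t p n \<beta> * rsum t ?p' k ?\<beta>')" .
  then have "rsum t p (n + k) \<beta> \<le> (2 * R + 3) powr t * (3 powr t * (rsum t p n \<beta> * rsum t ?p' k ?\<beta>'))"
    using 1 by (meson mult_left_mono order_trans powr_ge_zero)
  also have "\<dots> = (3 * (2 * R + 3)) powr t * (rsum t p n \<beta> * rsum t ?p' k ?\<beta>')"
    using R_nonneg by (subst powr_mult) auto
  finally show ?thesis .
qed

end

section \<open>Rotation averages and Renyi entropies\<close>

text \<open>Instead of continuity, f is only required to vary by at most C over distances 4 pi / q.
  The permutation \<open>h\<close> pairs the q orbit points with the q grid points. Half of the
  distance comes from rounding \<beta> to the grid, half from replacing \<alpha> by p / q, which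
  shifts the j-th point by at most 2 pi j / q^2.\<close>

lemma rotation_block_sum:
  fixes f :: "real \<Rightarrow> real" and p :: int and q :: nat
  assumes per: "\<And>x j. f (x + 2 * pi * of_int j) = f x"
    and q: "q > 0" and cop: "coprime p (int q)"
    and app: "\<bar>\<alpha> - of_int p / real q\<bar> \<le> 1 / (real q)\<^sup>2"
    and C: "\<And>x y. \<bar>x - y\<bar> \<le> 4 * pi / real q \<Longrightarrow> f x \<le> f y + C"
  shows "(\<Sum>i<q. f (2 * pi * real i / real q)) \<le> (\<Sum>j<q. f (\<beta> - 2 * pi * real j * \<alpha>)) + real q * C"
proof -
  define b where "b = \<lfloor>\<beta> * real q / (2 * pi)\<rfloor>"
  define h where "h j = nat ((b - int j * p) mod int q)" for j :: nat
  have hb: "bij_betw h {..<q} {..<q}"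
  proof -
    have "inj_on h {..<q}"
    proof (rule inj_onI)
      fix i j assume ij: "i \<in> {..<q}" "j \<in> {..<q}" "h i = h j"
      then have "(b - int i * p) mod int q = (b - int j * p) mod int q"
        unfolding h_def using q by (simp add: nat_eq_iff)
      then have "int q dvd (b - int i * p) - (b - int j * p)" by (simp add: mod_eq_dvd_iff)
      then have "int q dvd (int j - int i) * p" by (simp add: algebra_simps)
      then have "int q dvd int j - int i" using cop by (simp add: coprime_commute coprime_dvd_mult_left_iff)
      have "int j - int i = 0"
      proof (rule ccontr)
        assume "int j - int i \<noteq> 0"
        then have "\<bar>int q\<bar> \<le> \<bar>int j - int i\<bar>"
          using \<open>int q dvd int j - int i\<close> by (rule dvd_imp_le_int)
        then show False using ij by auto
      qed
      then show "i = j" by simp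
    qed
    moreover have "h ` {..<q} \<subseteq> {..<q}" unfolding h_def using q by (auto simp: nat_less_iff)
    ultimately show ?thesis by (simp add: bij_betw_def endo_inj_surj)
  qed
  have "(\<Sum>i<q. f (2 * pi * real i / real q)) = (\<Sum>j<q. f (2 * pi * real (h j) / real q))"
    using sum.reindex_bij_betw[OF hb, of "\<lambda>i. f (2 * pi * real i / real q)"] by simp
  also have "\<dots> \<le> (\<Sum>j<q. f (\<beta> - 2 * pi * real j * \<alpha>) + C)"
  proof (rule sum_mono)
    fix j assume j: "j \<in> {..<q}"
    define y where "y = b - int j * p"
    have hj: "real (h j) = of_int y - real q * of_int (y div int q)"
    proof -
      have "real (h j) = of_int (y mod int q)" unfolding h_def y_def using q by simp
      also have "y mod int q = y - int q * (y div int q)" by (simp add: minus_mult_div_eq_mod)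
      finally show ?thesis by simp
    qed
    have "f (2 * pi * real (h j) / real q) = f (2 * pi * of_int y / real q + 2 * pi * of_int (- (y div int q)))"
      unfolding hj using q by (intro arg_cong[where f=f]) (simp add: field_simps)
    also have "\<dots> = f (2 * pi * of_int y / real q)" by (rule per)
    also have "\<dots> \<le> f (\<beta> - 2 * pi * real j * \<alpha>) + C"
    proof (rule C)
      define e where "e = \<beta> * real q / (2 * pi) - of_int b"
      have e: "0 \<le> e" "e \<le> 1" unfolding e_def b_def by linarith+
      have be: "\<beta> = 2 * pi * (of_int b + e) / real q" unfolding e_def using q by (simp add: field_simps)
      define d where "d = \<alpha> - of_int p / real q"
      have al: "\<alpha> = of_int p / real q + d" by (simp add: d_def)
      have "2 * pi * of_int y / real q - (\<beta> - 2 * pi * real j * \<alpha>) = 2 * pi * (real j * d) - 2 * pi * e / real q"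
        unfolding be al y_def using q by (simp add: field_simps)
      moreover have "\<bar>2 * pi * (real j * d)\<bar> \<le> 2 * pi / real q"
      proof -
        have "real j * \<bar>d\<bar> \<le> real q * (1 / (real q)\<^sup>2)"
          using app j unfolding d_def[symmetric] by (intro mult_mono) auto
        also have "\<dots> = 1 / real q" by (simp add: power2_eq_square)
        finally have "2 * pi * (real j * \<bar>d\<bar>) \<le> 2 * pi * (1 / real q)" by (intro mult_left_mono) auto
        then show ?thesis by (simp add: abs_mult)
      qed
      moreover have "\<bar>2 * pi * e / real q\<bar> \<le> 2 * pi / real q"
        using e q by (simp add: abs_mult divide_right_mono)
      moreover have "4 * pi / real q = 2 * pi / real q + 2 * pi / real q" by simp
      ultimately show "\<bar>2 * pi * of_int y / real q - (\<beta> - 2 * pi * real j * \<alpha>)\<bar> \<le> 4 * pi / real q"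
        by linarith
    qed
    finally show "f (2 * pi * real (h j) / real q) \<le> f (\<beta> - 2 * pi * real j * \<alpha>) + C" .
  qed
  also have "\<dots> = (\<Sum>j<q. f (\<beta> - 2 * pi * real j * \<alpha>)) + real q * C"
    by (simp add: sum.distrib)
  finally show ?thesis .
qed

lemma rotation_sum:
  fixes f :: "real \<Rightarrow> real" and p :: int and q :: nat
  assumes per: "\<And>x j. f (x + 2 * pi * of_int j) = f x"
    and q: "q > 0" and cop: "coprime p (int q)"
    and app: "\<bar>\<alpha> - of_int p / real q\<bar> \<le> 1 / (real q)\<^sup>2"
    and C: "\<And>x y. \<bar>x - y\<bar> \<le> 4 * pi / real q \<Longrightarrow> f x \<le> f y + C"
  shows "real N * (\<Sum>i<q. f (2 * pi * real i / real q)) \<le> (\<Sum>j<q*N. f (\<beta> - 2 * pi * real j * \<alpha>)) + real (q * N) * C"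
proof (induction N)
  case 0 then show ?case by simp
next
  case (Suc N)
  define \<beta>' where "\<beta>' = \<beta> - 2 * pi * real (q * N) * \<alpha>"
  have split: "(\<Sum>j<q*N + n. g j) = (\<Sum>j<q*N. g j) + (\<Sum>j<n. g (q*N + j))" for g :: "nat \<Rightarrow> real" and n
    by (induction n) (auto simp: algebra_simps)
  have "(\<Sum>j<q * Suc N. f (\<beta> - 2 * pi * real j * \<alpha>)) =
     (\<Sum>j<q*N. f (\<beta> - 2 * pi * real j * \<alpha>)) + (\<Sum>j<q. f (\<beta> - 2 * pi * real (q*N + j) * \<alpha>))"
    using split[where n=q and g="\<lambda>j. f (\<beta> - 2 * pi * real j * \<alpha>)"] by (simp add: add.commute)
  also have "(\<Sum>j<q. f (\<beta> - 2 * pi * real (q*N + j) * \<alpha>)) = (\<Sum>j<q. f (\<beta>' - 2 * pi * real j * \<alpha>))"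
    unfolding \<beta>'_def by (intro sum.cong refl arg_cong[where f=f]) (simp add: algebra_simps)
  finally have "(\<Sum>j<q * Suc N. f (\<beta> - 2 * pi * real j * \<alpha>)) =
     (\<Sum>j<q*N. f (\<beta> - 2 * pi * real j * \<alpha>)) + (\<Sum>j<q. f (\<beta>' - 2 * pi * real j * \<alpha>))" .
  then show ?case using Suc.IH rotation_block_sum[OF per q cop app C, of "\<beta>'"]
    by (simp add: algebra_simps)
qed

lemma irrational_good_approx:
  assumes "\<alpha> \<notin> \<rat>"
  obtains p :: int and q :: nat where "q > K" "coprime p (int q)" "\<bar>\<alpha> - of_int p / real q\<bar> \<le> 1 / (real q)\<^sup>2"
proof -
  have "infinite (approx_set \<alpha>)" using assms rational_iff_finite_approx_set by blast
  then obtain h k where hk: "(h, k) \<in> approx_set \<alpha>" "k > int K" using infinite_approx_set by blast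
  show ?thesis
  proof (rule that[of "nat k" h])
    show "\<bar>\<alpha> - of_int h / real (nat k)\<bar> \<le> 1 / (real (nat k))\<^sup>2" using hk by (auto simp: approx_set_def)
  qed (use hk in \<open>auto simp: approx_set_def\<close>)
qed

lemma near_grid_angle:
  assumes "q > 0"
  obtains i :: nat and z :: int where "i < q" "\<bar>\<beta> - (2 * pi * real i / real q + 2 * pi * of_int z)\<bar> \<le> 2 * pi / real q"
proof -
  define b where "b = \<lfloor>\<beta> * real q / (2 * pi)\<rfloor>"
  define e where "e = \<beta> * real q / (2 * pi) - of_int b"
  have e: "0 \<le> e" "e \<le> 1" unfolding e_def b_def by linarith+
  have be: "\<beta> = 2 * pi * (of_int b + e) / real q" unfolding e_def using assms by (simp add: field_simps)
  have mean_high: "of_int b = real (nat (b mod int q)) + real q * of_int (b div int q)"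
  proof -
    have "of_int b = (of_int (b mod int q + int q * (b div int q)) :: real)" by simp
    also have "\<dots> = of_int (b mod int q) + real q * of_int (b div int q)"
      by (simp only: of_int_add of_int_mult of_int_of_nat_eq)
    also have "of_int (b mod int q) = real (nat (b mod int q))" using assms by simp
    finally show ?thesis .
  qed
  show ?thesis
  proof (rule that[of "nat (b mod int q)" "b div int q"])
    show "nat (b mod int q) < q" using assms by (simp add: nat_less_iff)
    have "\<beta> - (2 * pi * real (nat (b mod int q)) / real q + 2 * pi * of_int (b div int q)) = 2 * pi * e / real q"
      unfolding be mean_high using assms by (simp add: field_simps)
    then show "\<bar>\<beta> - (2 * pi * real (nat (b mod int q)) / real q + 2 * pi * of_int (b div int q))\<bar> \<le> 2 * pi / real q"
      using e assms by (simp add: abs_mult divide_right_mono)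
  qed
qed

section \<open>Renyi entropies of projected words\<close>

context similarity_ifs
begin

text \<open>The constant of \<open>rsum_submult\<close>. It enters the power sums to the power t,
  hence the entropy only as \<open>ln C0\<close> per block.\<close>

definition C0 :: real where "C0 = 3 * (2 * R + 3)"

text \<open>The exponent is so small that the Renyi entropy is within 1 of the Shannon entropy.\<close>

definition rexp :: "nat \<Rightarrow> real" where "rexp k = 1 / real m ^ k"

definition renyi :: "(nat \<Rightarrow> nat \<Rightarrow> real) \<Rightarrow> nat \<Rightarrow> real \<Rightarrow> real" where
  "renyi p k \<beta> = - ln (rsum (rexp k) p k \<beta>) / rexp k"

lemma rexp_pos: "rexp k > 0" unfolding rexp_def using m1 by simp

lemma C0_ge: "C0 \<ge> 9" unfolding C0_def using R_nonneg by simp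

lemma rsum_le_one: "pvec m p \<Longrightarrow> t \<ge> 0 \<Longrightarrow> rsum t p n \<beta> \<le> 1"
  unfolding rsum_def by (rule power_sum_le_one) (auto intro: weight_words_nonneg simp: sum_weight)

lemma rsum_ge: "pvec m p \<Longrightarrow> t \<ge> 0 \<Longrightarrow> rsum t p n \<beta> \<ge> (real m ^ n) powr (- t)"
  unfolding rsum_def using power_sum_ge[of "words m n" "weight p" t "dcell n \<beta>"]
  by (auto intro: weight_words_nonneg simp: sum_weight card_words)

lemma rsum_pos: "pvec m p \<Longrightarrow> t \<ge> 0 \<Longrightarrow> rsum t p n \<beta> > 0"
proof -
  assume a: "pvec m p" "t \<ge> 0"
  have "0 < (real m ^ n) powr (- t)" using m1 by simp
  also have "\<dots> \<le> rsum t p n \<beta>" using rsum_ge[OF a] .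
  finally show ?thesis .
qed

lemma rsum_iter:
  assumes p: "pvec m p" and t: "t \<ge> 0"
  shows "rsum t p (J * k) \<beta> \<le> (\<Prod>j<J. C0 powr t * rsum t (nshift (j * k) p) k (\<beta> - real (j * k) * \<theta>))"
proof (induction J)
  case 0 then show ?case using rsum_le_one[OF p t] by simp
next
  case (Suc J)
  have "rsum t p (Suc J * k) \<beta> = rsum t p (J * k + k) \<beta>" by (simp add: add.commute)
  also have "\<dots> \<le> C0 powr t * (rsum t p (J * k) \<beta> * rsum t (nshift (J * k) p) k (\<beta> - real (J * k) * \<theta>))"
    unfolding C0_def by (rule rsum_submult[OF p t])
  also have "\<dots> = rsum t p (J * k) \<beta> * (C0 powr t * rsum t (nshift (J * k) p) k (\<beta> - real (J * k) * \<theta>))" by simp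
  also have "\<dots> \<le> (\<Prod>j<J. C0 powr t * rsum t (nshift (j * k) p) k (\<beta> - real (j * k) * \<theta>))
      * (C0 powr t * rsum t (nshift (J * k) p) k (\<beta> - real (J * k) * \<theta>))"
    by (rule mult_right_mono[OF Suc])
      (intro mult_nonneg_nonneg powr_ge_zero less_imp_le[OF rsum_pos] pvec_nshift p t)
  finally show ?case by simp
qed

lemma rsum_eq_exp: "pvec m p \<Longrightarrow> rsum (rexp k) p k \<beta> = exp (- rexp k * renyi p k \<beta>)"
  unfolding renyi_def using rsum_pos[of p "rexp k" k \<beta>] rexp_pos[of k] by simp

lemma rsum_iter_exp:
  assumes p: "pvec m p"
  shows "rsum (rexp k) p (J * k) \<beta> \<le>
    exp (rexp k * (real J * ln C0 - (\<Sum>j<J. renyi (nshift (j * k) p) k (\<beta> - real (j * k) * \<theta>))))"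
proof -
  have "rsum (rexp k) p (J * k) \<beta> \<le> (\<Prod>j<J. C0 powr rexp k * rsum (rexp k) (nshift (j * k) p) k (\<beta> - real (j * k) * \<theta>))"
    using rexp_pos[of k] by (intro rsum_iter p) auto
  also have "\<dots> = (\<Prod>j<J. exp (rexp k * (ln C0 - renyi (nshift (j * k) p) k (\<beta> - real (j * k) * \<theta>))))"
    using C0_ge by (intro prod.cong refl)
      (simp add: rsum_eq_exp[OF pvec_nshift[OF p]] powr_def exp_add[symmetric] algebra_simps)
  also have "\<dots> = exp (rexp k * (real J * ln C0 - (\<Sum>j<J. renyi (nshift (j * k) p) k (\<beta> - real (j * k) * \<theta>))))"
    by (simp add: exp_sum[symmetric] sum_distrib_left[symmetric] sum_subtractf)
  finally show ?thesis .
qed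

lemma renyi_nonneg: "pvec m p \<Longrightarrow> renyi p k \<beta> \<ge> 0"
  unfolding renyi_def using rsum_le_one[of p "rexp k" k \<beta>] rsum_pos[of p "rexp k" k \<beta>] rexp_pos[of k]
  by (auto intro!: divide_nonpos_pos)

lemma renyi_le: "pvec m p \<Longrightarrow> renyi p k \<beta> \<le> real k * ln (real m)"
proof -
  assume p: "pvec m p"
  have t: "rexp k > 0" by (rule rexp_pos)
  have "ln ((real m ^ k) powr (- rexp k)) \<le> ln (rsum (rexp k) p k \<beta>)"
    using rsum_ge[OF p, of "rexp k" k \<beta>] t m1 by (intro ln_mono) auto
  then have "- ln (rsum (rexp k) p k \<beta>) \<le> rexp k * (real k * ln (real m))"
    using m1 by (simp add: ln_powr ln_realpow)
  then show ?thesis unfolding renyi_def using t by (simp add: field_simps)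
qed

text \<open>Turning the direction moves the projected points by at most \<open>c * R\<close> cell
  lengths. The resulting factor, raised to the power \<open>rexp k\<close>, becomes an additive
  constant independent of k after division by \<open>rexp k\<close>.\<close>

lemma renyi_cont:
  assumes p: "pvec m p" and c: "c \<ge> 0" and d: "\<bar>\<beta> - \<beta>'\<bar> \<le> c * r ^ k"
  shows "renyi p k \<beta> \<le> renyi p k \<beta>' + ln (2 * (c * R) + 3)"
proof -
  have t: "rexp k > 0" by (rule rexp_pos)
  have K: "2 * (c * R) + 3 > 0" using c R_nonneg by (simp add: add_nonneg_pos)
  have "rsum (rexp k) p k \<beta>' \<le> (2 * (c * R) + 3) powr (rexp k) * rsum (rexp k) p k \<beta>"
    unfolding rsum_def dcell_def[abs_def]
  proof (rule power_sum_cell_cmp)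
    fix u assume "u \<in> words m k"
    then have "norm (pos u) \<le> R" by (intro norm_pos_le) (auto simp: words_def)
    then have "\<bar>\<beta> - \<beta>'\<bar> * norm (pos u) \<le> (c * r ^ k) * R"
      using d by (intro mult_mono) auto
    then show "\<bar>dir \<beta> (pos u) - dir \<beta>' (pos u)\<bar> \<le> c * R * r ^ k"
      using dir_cont[of \<beta> "pos u" \<beta>'] by (simp add: algebra_simps)
  qed (use c R_nonneg t p in \<open>auto intro: weight_words_nonneg\<close>)
  then have "ln (rsum (rexp k) p k \<beta>') \<le> ln ((2 * (c * R) + 3) powr (rexp k) * rsum (rexp k) p k \<beta>)"
    using rsum_pos[OF p] t by (intro ln_mono) auto
  also have "\<dots> = rexp k * ln (2 * (c * R) + 3) + ln (rsum (rexp k) p k \<beta>)"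
    using rsum_pos[OF p, of "rexp k" k \<beta>] t K by (simp add: ln_mult ln_powr)
  finally show ?thesis unfolding renyi_def using t by (simp add: field_simps)
qed

lemma renyi_period: "renyi p k (\<beta> + 2 * pi * of_int j) = renyi p k \<beta>"
  unfolding renyi_def rsum_def dcell_def[abs_def] dir_period ..

lemma entropy_le_renyi:
  assumes p: "pvec m p"
  shows "(\<Sum>l\<in>words m k. weight p l * - ln (mass (weight p) (words m k) (dcell k \<beta>) (dcell k \<beta> l))) \<le> renyi p k \<beta> + 1"
  unfolding renyi_def rsum_def
  using p rexp_pos[of k] m1
  by (intro entropy_le_renyi) (auto intro: weight_words_nonneg simp: sum_weight card_words rexp_def)

end

section \<open>The measure on symbol sequences\<close>

lemma weight_prod: "weight p l = (\<Prod>j<length l. p j (l ! j))"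
proof (induction l arbitrary: p)
  case (Cons i l)
  have "(\<Prod>j<Suc (length l). p j ((i # l) ! j)) = p 0 i * (\<Prod>j<length l. p (Suc j) (l ! j))"
    by (subst prod.lessThan_Suc_shift) simp
  then show ?case using Cons by simp
qed simp

definition pre :: "nat \<Rightarrow> (nat \<Rightarrow> nat) \<Rightarrow> nat list" where
  "pre n \<omega> = map \<omega> [0..<n]"

definition nu :: "nat \<Rightarrow> (nat \<Rightarrow> nat \<Rightarrow> real) \<Rightarrow> (nat \<Rightarrow> nat) measure" where
  "nu m p = (\<Pi>\<^sub>M k\<in>UNIV. point_measure {1..m} (\<lambda>i. ennreal (p k i)))"

lemma space_nu: "space (nu m p) = {\<omega>. \<forall>k. \<omega> k \<in> {1..m}}"
  unfolding nu_def by (auto simp: space_PiM space_point_measure PiE_def Pi_def)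

lemma pre_words: "\<omega> \<in> space (nu m p) \<Longrightarrow> pre n \<omega> \<in> words m n"
  unfolding space_nu pre_def words_def by auto

lemma length_pre [simp]: "length (pre n \<omega>) = n"
  by (simp add: pre_def)

lemma prob_space_marginal: "pvec m p \<Longrightarrow> prob_space (point_measure {1..m} (\<lambda>i. ennreal (p k i)))"
proof (rule prob_spaceI)
  assume p: "pvec m p"
  have "emeasure (point_measure {1..m} (\<lambda>i. ennreal (p k i))) {1..m} = (\<Sum>i=1..m. ennreal (p k i))"
    by (subst emeasure_point_measure_finite) auto
  also have "\<dots> = ennreal (\<Sum>i=1..m. p k i)" using p by (intro sum_ennreal) (auto simp: pvec_def)
  finally show "emeasure (point_measure {1..m} (\<lambda>i. ennreal (p k i))) (space (point_measure {1..m} (\<lambda>i. ennreal (p k i)))) = 1"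
    using p by (simp add: space_point_measure pvec_def)
qed

lemma prob_space_nu: "pvec m p \<Longrightarrow> prob_space (nu m p)"
  unfolding nu_def by (intro prob_space_PiM prob_space_marginal)

lemma pre_eq_iff: "length l = n \<Longrightarrow> pre n \<omega> = l \<longleftrightarrow> (\<forall>i\<in>{..<n}. \<omega> i \<in> {l ! i})"
  unfolding pre_def by (auto simp: list_eq_iff_nth_eq)

lemma nu_cylinder:
  assumes p: "pvec m p" and l: "l \<in> words m n"
  shows "{\<omega>\<in>space (nu m p). pre n \<omega> = l} \<in> sets (nu m p)"
    and "measure (nu m p) {\<omega>\<in>space (nu m p). pre n \<omega> = l} = weight p l"
proof -
  let ?M = "\<lambda>k. point_measure {1..m} (\<lambda>i. ennreal (p k i))"
  interpret product_prob_space ?M UNIV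
    by (rule product_prob_spaceI) (rule prob_space_marginal[OF p])
  have len: "length l = n" and li: "\<And>j. j < n \<Longrightarrow> l ! j \<in> {1..m}"
    using l nth_mem by (auto simp: words_def simp del: atLeastAtMost_iff)
  have eq: "{\<omega>\<in>space (nu m p). pre n \<omega> = l} = {\<omega>\<in>space (nu m p). \<forall>i\<in>{..<n}. \<omega> i \<in> {l ! i}}"
    using pre_eq_iff[OF len] by auto
  have s: "{l ! i} \<in> sets (?M i)" if "i < n" for i using li[OF that] by (simp add: sets_point_measure)
  have em: "emeasure (nu m p) {\<omega>\<in>space (nu m p). \<forall>i\<in>{..<n}. \<omega> i \<in> {l ! i}} = (\<Prod>i<n. emeasure (?M i) {l ! i})"
    unfolding nu_def by (rule emeasure_PiM_Collect) (use s in auto)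
  show "{\<omega>\<in>space (nu m p). pre n \<omega> = l} \<in> sets (nu m p)"
    unfolding eq unfolding nu_def using s by (intro sets.sets_Collect_finite_All sets_Collect_single) auto
  have "(\<Prod>i<n. emeasure (?M i) {l ! i}) = (\<Prod>i<n. ennreal (p i (l ! i)))"
    using li by (intro prod.cong refl) (subst emeasure_point_measure_finite, auto)
  also have "\<dots> = ennreal (weight p l)"
    unfolding weight_prod len using li p by (intro prod_ennreal) (auto simp: pvec_def)
  finally have "emeasure (nu m p) {\<omega>\<in>space (nu m p). pre n \<omega> = l} = ennreal (weight p l)"
    using em eq by simp
  then show "measure (nu m p) {\<omega>\<in>space (nu m p). pre n \<omega> = l} = weight p l"
    using weight_words_nonneg[OF p l] by (simp add: measure_def)
qed

text \<open>Bridge between probabilities on sequences and finite sums over words: an event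
  determined by n digits is a finite disjoint union of cylinders.\<close>

lemma nu_pre:
  assumes p: "pvec m p"
  shows "{\<omega>\<in>space (nu m p). Q (pre n \<omega>)} \<in> sets (nu m p)"
    and "measure (nu m p) {\<omega>\<in>space (nu m p). Q (pre n \<omega>)} = (\<Sum>l | l \<in> words m n \<and> Q l. weight p l)"
proof -
  interpret prob_space "nu m p" by (rule prob_space_nu[OF p])
  let ?L = "{l \<in> words m n. Q l}" and ?c = "\<lambda>l. {\<omega>\<in>space (nu m p). pre n \<omega> = l}"
  have eq: "{\<omega>\<in>space (nu m p). Q (pre n \<omega>)} = (\<Union>l\<in>?L. ?c l)" using pre_words by fastforce
  have m: "?c l \<in> sets (nu m p)" if "l \<in> ?L" for l using nu_cylinder(1)[OF p, of l n] that by auto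
  show "{\<omega>\<in>space (nu m p). Q (pre n \<omega>)} \<in> sets (nu m p)" unfolding eq using m by (intro sets.finite_UN) auto
  have "measure (nu m p) (\<Union>l\<in>?L. ?c l) = (\<Sum>l\<in>?L. measure (nu m p) (?c l))"
    using m by (intro finite_measure_finite_Union) (auto simp: disjoint_family_on_def)
  also have "\<dots> = (\<Sum>l\<in>?L. weight p l)" using nu_cylinder(2)[OF p] by (intro sum.cong) auto
  finally show "measure (nu m p) {\<omega>\<in>space (nu m p). Q (pre n \<omega>)} = (\<Sum>l | l \<in> words m n \<and> Q l. weight p l)"
    unfolding eq by simp
qed

lemma proj_line_eq: "proj_line \<beta> z = complex_of_real (dir \<beta> z) * cis \<beta>"
  unfolding proj_line_def dir_def by simp

lemma dist_proj_line: "dist (proj_line \<beta> x) (proj_line \<beta> y) = \<bar>dir \<beta> x - dir \<beta> y\<bar>"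
proof -
  have "proj_line \<beta> x - proj_line \<beta> y = complex_of_real (dir \<beta> x - dir \<beta> y) * cis \<beta>"
    unfolding proj_line_eq by (simp add: left_diff_distrib)
  then show ?thesis by (simp only: dist_norm norm_mult norm_of_real norm_cis) simp
qed

lemma continuous_proj_line: "continuous_on A (proj_line \<beta>)"
  unfolding proj_line_def by (intro continuous_intros)

section \<open>The coding map and masses of projected balls\<close>

context similarity_ifs
begin

abbreviation cod :: "(nat \<Rightarrow> nat) \<Rightarrow> complex" where
  "cod \<equiv> coding (ifs_map r \<theta> a)"

abbreviation mu :: "(nat \<Rightarrow> nat \<Rightarrow> real) \<Rightarrow> complex measure" where
  "mu p \<equiv> distr (nu m p) borel cod"

lemma ifs_iter_pos: "ifs_iter (ifs_map r \<theta> a) \<omega> n z = pos (pre n \<omega>) + S ^ n * z"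
proof (induction n arbitrary: z)
  case (Suc n)
  have "pos (pre (Suc n) \<omega>) = pos (pre n \<omega>) + S ^ n * a (\<omega> n)"
    using pos_append[of "pre n \<omega>" "[\<omega> n]"] by (simp add: pre_def)
  then show ?case using Suc by (simp add: ifs_map_def rot_def S_def algebra_simps)
qed (simp add: pre_def)

lemma pos_pre_diff:
  assumes "\<omega> \<in> space (nu m p)"
  shows "norm (pos (pre (n + k) \<omega>) - pos (pre n \<omega>)) \<le> R * r ^ n"
proof -
  have "pre (n + k) \<omega> = pre n \<omega> @ map \<omega> [n..<n+k]"
    unfolding pre_def by (simp add: upt_add_eq_append[of 0])
  then have "pos (pre (n + k) \<omega>) - pos (pre n \<omega>) = S ^ n * pos (map \<omega> [n..<n+k])"
    by (simp add: pos_append)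
  moreover have "norm (pos (map \<omega> [n..<n+k])) \<le> R"
    using assms by (intro norm_pos_le) (auto simp: space_nu)
  ultimately show ?thesis using rn[of n]
    by (simp add: norm_mult norm_power norm_S mult.commute mult_left_mono)
qed

lemma pos_pre_LIMSEQ:
  assumes w: "\<omega> \<in> space (nu m p)"
  shows "(\<lambda>n. pos (pre n \<omega>)) \<longlonglongrightarrow> cod \<omega>"
proof -
  have "Cauchy (\<lambda>n. pos (pre n \<omega>))"
  proof (rule metric_CauchyI)
    fix e :: real assume e: "e > 0"
    have "(\<lambda>n. R * r ^ n) \<longlonglongrightarrow> R * 0" using r0 r1 by (intro tendsto_intros LIMSEQ_power_zero) auto
    then have "eventually (\<lambda>n. R * r ^ n < e / 2) sequentially" using e by (intro order_tendstoD) auto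
    then obtain N where N: "R * r ^ N < e / 2" by (auto simp: eventually_sequentially)
    show "\<exists>M. \<forall>m\<ge>M. \<forall>n\<ge>M. dist (pos (pre m \<omega>)) (pos (pre n \<omega>)) < e"
    proof (intro exI allI impI)
      fix i j assume "i \<ge> N" "j \<ge> N"
      then obtain i' j' where ij: "i = N + i'" "j = N + j'" using le_Suc_ex by metis
      have "dist (pos (pre i \<omega>)) (pos (pre N \<omega>)) < e / 2" "dist (pos (pre j \<omega>)) (pos (pre N \<omega>)) < e / 2"
        using pos_pre_diff[OF w, of N i'] pos_pre_diff[OF w, of N j'] N unfolding ij dist_norm by linarith+
      then show "dist (pos (pre i \<omega>)) (pos (pre j \<omega>)) < e" by (rule dist_triangle_half_l)
    qed
  qed
  then have "convergent (\<lambda>n. pos (pre n \<omega>))" by (rule Cauchy_convergent)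
  then have "(\<lambda>n. pos (pre n \<omega>)) \<longlonglongrightarrow> lim (\<lambda>n. pos (pre n \<omega>))" by (simp add: convergent_LIMSEQ_iff)
  then show ?thesis unfolding coding_def ifs_iter_pos by simp
qed

lemma cod_approx:
  assumes w: "\<omega> \<in> space (nu m p)"
  shows "norm (cod \<omega> - pos (pre n \<omega>)) \<le> R * r ^ n"
proof (rule LIMSEQ_le_const2)
  show "(\<lambda>k. norm (pos (pre (k + n) \<omega>) - pos (pre n \<omega>))) \<longlonglongrightarrow> norm (cod \<omega> - pos (pre n \<omega>))"
    using LIMSEQ_ignore_initial_segment[OF pos_pre_LIMSEQ[OF w], of n] by (intro tendsto_intros)
  show "\<exists>N. \<forall>k\<ge>N. norm (pos (pre (k + n) \<omega>) - pos (pre n \<omega>)) \<le> R * r ^ n"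
    using pos_pre_diff[OF w, of n] by (simp add: add.commute)
qed

lemma norm_cod_le: "\<omega> \<in> space (nu m p) \<Longrightarrow> norm (cod \<omega>) \<le> R"
  using cod_approx[of \<omega> p 0] by (simp add: pre_def)

lemma pre_measurable:
  fixes F :: "nat list \<Rightarrow> 'b::topological_space"
  assumes p: "pvec m p"
  shows "(\<lambda>\<omega>. F (pre n \<omega>)) \<in> borel_measurable (nu m p)"
  using nu_pre(1)[OF p, of "\<lambda>l. F l \<in> _" n]
  by (intro measurableI) (auto simp: vimage_def Int_def conj_commute)

lemma cod_measurable:
  assumes p: "pvec m p"
  shows "cod \<in> borel_measurable (nu m p)"
  using pre_measurable[OF p, of pos] pos_pre_LIMSEQ by (rule borel_measurable_LIMSEQ_metric)

lemma distr_mu_proj: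
  assumes p: "pvec m p"
  shows "distr (mu p) borel (proj_line \<beta>) = distr (nu m p) borel (\<lambda>\<omega>. proj_line \<beta> (cod \<omega>))"
  using cod_measurable[OF p] borel_measurable_continuous_onI[OF continuous_proj_line, of \<beta>]
  by (subst distr_distr) (auto simp: comp_def)

text \<open>In the radius, 1 stands for a ball of radius \<open>r ^ n\<close>, and R for each of the
  two truncations of the coding map to n digits.\<close>

definition near_mass :: "(nat \<Rightarrow> nat \<Rightarrow> real) \<Rightarrow> nat \<Rightarrow> real \<Rightarrow> nat list \<Rightarrow> real" where
  "near_mass p n \<beta> u = (\<Sum>v | v \<in> words m n \<and> \<bar>dir \<beta> (pos v) - dir \<beta> (pos u)\<bar> \<le> (1 + 2 * R) * r ^ n. weight p v)"

text \<open>Number of cells in the window \<open>{-D..D}\<close> of \<open>near_mass_moment\<close>,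
  which holds all cells within reach of \<open>near_mass\<close>.\<close>

definition C1 :: real where "C1 = 2 * of_int (\<lceil>1 + 2 * R\<rceil> + 1) + 1"

lemma C1_pos: "C1 > 0" unfolding C1_def using R_nonneg by (auto intro!: add_nonneg_pos simp: zero_le_ceiling)

text \<open>The t-th moment of the cell mass under its own law is the power sum. Neighbouring cells
  are absorbed by the window sum \<open>h\<close>, and each of the \<open>C1\<close> shifts of the
  grid gives the same power sum.\<close>

lemma near_mass_moment:
  assumes p: "pvec m p" and t: "t \<ge> 0"
  shows "(\<Sum>u\<in>words m n. weight p u * near_mass p n \<beta> u powr t) \<le> C1 powr t * (C1 * rsum t p n \<beta>)"
proof -
  define D where "D = \<lceil>1 + 2 * R\<rceil> + 1"
  let ?q = "mass (weight p) (words m n) (dcell n \<beta>)"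
  let ?T = "{-D..D}"
  have D0: "D \<ge> 0" unfolding D_def using R_nonneg by (simp add: le_ceiling_iff)
  have cT: "real (card ?T) = C1" unfolding C1_def D_def[symmetric] using D0 by simp
  have q0: "?q c \<ge> 0" for c using p by (intro mass_nonneg) (auto intro: weight_words_nonneg)
  define h where "h c = (\<Sum>d\<in>?T. ?q (c + d))" for c
  have h0: "h c \<ge> 0" for c unfolding h_def using q0 by (intro sum_nonneg) auto
  have qh: "?q c \<le> h c" for c
  proof -
    have "?q (c + 0) \<le> h c" unfolding h_def using q0 D0 by (intro member_le_sum) auto
    then show ?thesis by simp
  qed
  have bh: "near_mass p n \<beta> u \<le> h (dcell n \<beta> u)" for u
  proof -
    let ?V = "{v \<in> words m n. \<bar>dir \<beta> (pos v) - dir \<beta> (pos u)\<bar> \<le> (1 + 2 * R) * r ^ n}"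
    have near: "dcell n \<beta> v \<in> (\<lambda>d. dcell n \<beta> u + d) ` ?T" if v: "v \<in> ?V" for v
    proof -
      have "\<bar>dir \<beta> (pos v) / r ^ n - dir \<beta> (pos u) / r ^ n\<bar> \<le> 1 + 2 * R"
        using v rn[of n] by (simp add: diff_divide_distrib[symmetric] abs_divide divide_le_eq)
      then have "\<bar>dcell n \<beta> v - dcell n \<beta> u\<bar> \<le> D" unfolding dcell_def cell_def D_def by linarith
      then show ?thesis by (intro image_eqI[of _ _ "dcell n \<beta> v - dcell n \<beta> u"]) auto
    qed
    have "near_mass p n \<beta> u = (\<Sum>c\<in>(\<lambda>d. dcell n \<beta> u + d) ` ?T. mass (weight p) ?V (dcell n \<beta>) c)"
      unfolding near_mass_def using near by (subst sum_mass) auto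
    also have "\<dots> \<le> (\<Sum>c\<in>(\<lambda>d. dcell n \<beta> u + d) ` ?T. ?q c)"
      unfolding mass_def using p by (intro sum_mono sum_mono2) (auto intro: weight_words_nonneg)
    also have "\<dots> = h (dcell n \<beta> u)" unfolding h_def by (subst sum.reindex) (auto simp: inj_on_def)
    finally show ?thesis .
  qed
  have b0: "near_mass p n \<beta> u \<ge> 0" for u unfolding near_mass_def using p by (intro sum_nonneg) (auto intro: weight_words_nonneg)
  let ?I = "dcell n \<beta> ` words m n"
  have "(\<Sum>u\<in>words m n. weight p u * near_mass p n \<beta> u powr t) \<le> (\<Sum>u\<in>words m n. weight p u * h (dcell n \<beta> u) powr t)"
    using bh b0 t p by (intro sum_mono mult_left_mono powr_mono2) (auto intro: weight_words_nonneg)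
  also have "\<dots> = (\<Sum>c\<in>?I. ?q c * h c powr t)"
    using sum_mass_mult[of "words m n" "weight p" "dcell n \<beta>" "\<lambda>c. h c powr t"] by simp
  also have "\<dots> \<le> (\<Sum>c\<in>?I. h c powr (1 + t))"
  proof (rule sum_mono)
    fix c
    have "?q c * h c powr t \<le> h c * h c powr t" using qh by (intro mult_right_mono) auto
    also have "\<dots> = h c powr (1 + t)" using h0[of c] by (cases "h c = 0") (auto simp: powr_add)
    finally show "?q c * h c powr t \<le> h c powr (1 + t)" .
  qed
  also have "\<dots> \<le> (\<Sum>c\<in>?I. C1 powr t * (\<Sum>d\<in>?T. ?q (c + d) powr (1 + t)))"
    unfolding h_def cT[symmetric] using q0 t by (intro sum_mono sum_powr_le) auto
  also have "\<dots> = C1 powr t * (\<Sum>d\<in>?T. \<Sum>c\<in>?I. ?q (c + d) powr (1 + t))"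
    unfolding sum_distrib_left[symmetric] by (subst sum.swap) simp
  also have "\<dots> \<le> C1 powr t * (\<Sum>d\<in>?T. rsum t p n \<beta>)"
  proof (intro mult_left_mono sum_mono)
    fix d
    have "(\<Sum>c\<in>?I. ?q (c + d) powr (1 + t)) = (\<Sum>c\<in>(\<lambda>c. c + d) ` ?I. ?q c powr (1 + t))"
      by (subst sum.reindex) (auto simp: inj_on_def)
    also have "\<dots> \<le> (\<Sum>c\<in>?I \<union> (\<lambda>c. c + d) ` ?I. ?q c powr (1 + t))" by (intro sum_mono2) auto
    also have "\<dots> = rsum t p n \<beta>" unfolding rsum_def by (intro power_sum_superset[symmetric]) auto
    finally show "(\<Sum>c\<in>?I. ?q (c + d) powr (1 + t)) \<le> rsum t p n \<beta>" .
  qed simp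
  also have "\<dots> = C1 powr t * (C1 * rsum t p n \<beta>)" using cT by simp
  finally show ?thesis .
qed

lemma near_mass_tail:
  assumes p: "pvec m p" and t: "t \<ge> 0"
  shows "measure (nu m p) {\<omega>\<in>space (nu m p). near_mass p n \<beta> (pre n \<omega>) > exp (- x)}
     \<le> C1 powr t * C1 * rsum t p n \<beta> * exp (t * x)"
proof -
  have "(\<Sum>l | l \<in> words m n \<and> near_mass p n \<beta> l > exp (- x). weight p l)
     \<le> (\<Sum>l | l \<in> words m n \<and> near_mass p n \<beta> l > exp (- x). weight p l * near_mass p n \<beta> l powr t * exp (t * x))"
  proof (rule sum_mono)
    fix l assume l: "l \<in> {l. l \<in> words m n \<and> near_mass p n \<beta> l > exp (- x)}"
    have "exp (- x) powr t \<le> near_mass p n \<beta> l powr t" using l t by (intro powr_mono2) auto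
    moreover have "exp (- x) powr t = exp (- (t * x))" by (simp add: powr_def)
    ultimately have "exp (- (t * x)) * exp (t * x) \<le> near_mass p n \<beta> l powr t * exp (t * x)"
      by (intro mult_right_mono) auto
    then have "1 \<le> near_mass p n \<beta> l powr t * exp (t * x)" by (simp add: exp_minus)
    then have "weight p l * 1 \<le> weight p l * (near_mass p n \<beta> l powr t * exp (t * x))"
      using l weight_words_nonneg[OF p, of l n] by (intro mult_left_mono) auto
    then show "weight p l \<le> weight p l * near_mass p n \<beta> l powr t * exp (t * x)" by (simp add: mult.assoc)
  qed
  also have "\<dots> \<le> (\<Sum>l\<in>words m n. weight p l * near_mass p n \<beta> l powr t * exp (t * x))"
    using p by (intro sum_mono2) (auto intro!: mult_nonneg_nonneg weight_words_nonneg)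
  also have "\<dots> \<le> (C1 powr t * (C1 * rsum t p n \<beta>)) * exp (t * x)"
    unfolding sum_distrib_right[symmetric] by (intro mult_right_mono near_mass_moment p t) auto
  finally show ?thesis using nu_pre(2)[OF p, of "\<lambda>l. near_mass p n \<beta> l > exp (- x)" n] by (simp add: mult.assoc)
qed

lemma ball_le_near_mass:
  assumes p: "pvec m p" and w: "\<omega> \<in> space (nu m p)" and d: "d \<le> r ^ n"
  shows "measure (nu m p) {\<omega>'\<in>space (nu m p). dist (proj_line \<beta> (cod \<omega>')) (proj_line \<beta> (cod \<omega>)) \<le> d}
    \<le> near_mass p n \<beta> (pre n \<omega>)"
proof -
  interpret prob_space "nu m p" by (rule prob_space_nu[OF p])
  let ?Q = "\<lambda>l. \<bar>dir \<beta> (pos l) - dir \<beta> (pos (pre n \<omega>))\<bar> \<le> (1 + 2 * R) * r ^ n"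
  have "measure (nu m p) {\<omega>'\<in>space (nu m p). dist (proj_line \<beta> (cod \<omega>')) (proj_line \<beta> (cod \<omega>)) \<le> d}
    \<le> measure (nu m p) {\<omega>'\<in>space (nu m p). ?Q (pre n \<omega>')}"
  proof (rule finite_measure_mono[OF _ nu_pre(1)[OF p]], safe)
    fix \<omega>' assume w': "\<omega>' \<in> space (nu m p)" and "dist (proj_line \<beta> (cod \<omega>')) (proj_line \<beta> (cod \<omega>)) \<le> d"
    then have 1: "\<bar>dir \<beta> (cod \<omega>') - dir \<beta> (cod \<omega>)\<bar> \<le> r ^ n" using d by (simp add: dist_proj_line)
    have 2: "\<bar>dir \<beta> (cod \<omega>') - dir \<beta> (pos (pre n \<omega>'))\<bar> \<le> R * r ^ n"
      using abs_dir_le[of \<beta> "cod \<omega>' - pos (pre n \<omega>')"] cod_approx[OF w', of n] by (simp add: dir_diff)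
    have 3: "\<bar>dir \<beta> (cod \<omega>) - dir \<beta> (pos (pre n \<omega>))\<bar> \<le> R * r ^ n"
      using abs_dir_le[of \<beta> "cod \<omega> - pos (pre n \<omega>)"] cod_approx[OF w, of n] by (simp add: dir_diff)
    have "(1 + 2 * R) * r ^ n = r ^ n + R * r ^ n + R * r ^ n" by (simp add: algebra_simps)
    then show "?Q (pre n \<omega>')" using 1 2 3 by linarith
  qed
  also have "\<dots> = near_mass p n \<beta> (pre n \<omega>)" unfolding near_mass_def by (rule nu_pre(2)[OF p])
  finally show ?thesis .
qed

end

section \<open>Dimension of projections for fixed weights\<close>

context similarity_ifs
begin

definition ell :: real where "ell = ln (1 / r)"

lemma ell_pos: "ell > 0" unfolding ell_def using r0 r1 by simp

lemma rpow_exp: "r ^ n = exp (- real n * ell)"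
proof -
  have "r ^ n = exp (ln r) ^ n" using r0 by simp
  also have "\<dots> = exp (real n * ln r)" by (rule exp_of_nat_mult[symmetric])
  finally show ?thesis using r0 by (simp add: ell_def ln_div)
qed

lemma rpow_powr: "(r ^ n) powr s = exp (- real n * ell * s)"
  unfolding rpow_exp by (simp add: powr_def mult.commute)

text \<open>Markov's inequality and Borel--Cantelli turn a bound on the Renyi sums into a bound on the
  masses of balls around almost every point; the mass distribution principle does the rest.\<close>

lemma proj_dim_lower:
  assumes p: "pvec m p" and t: "t > 0" and N: "N \<ge> 1" and x: "x > 0"
    and ev: "eventually (\<lambda>i. rsum t p (N * i) \<beta> \<le> exp (- t * (real i * (x + y)))) sequentially" and y: "y > 0"
  shows "x / (real N * ell) \<le> hausdorff_dim_measure (distr (mu p) borel (proj_line \<beta>))"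
proof -
  interpret prob_space "nu m p" by (rule prob_space_nu[OF p])
  let ?P = "\<lambda>\<omega>. proj_line \<beta> (cod \<omega>)"
  define s where "s = x / (real N * ell)"
  have s: "s > 0" unfolding s_def using x N ell_pos by simp
  have sx: "x = s * (real N * ell)" unfolding s_def using N ell_pos by simp
  have Pm: "?P \<in> borel_measurable (nu m p)"
    using measurable_compose[OF cod_measurable[OF p] borel_measurable_continuous_onI[OF continuous_proj_line]] .
  define G where "G i = {\<omega>\<in>space (nu m p). near_mass p (N * i) \<beta> (pre (N * i) \<omega>) \<le> exp (- (real i * x))}" for i
  define B where "B i = {\<omega>\<in>space (nu m p). near_mass p (N * i) \<beta> (pre (N * i) \<omega>) > exp (- (real i * x))}" for i
  have Gm: "G i \<in> sets (nu m p)" for i unfolding G_def by (rule nu_pre(1)[OF p])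
  have Bm: "B i \<in> sets (nu m p)" for i unfolding B_def by (rule nu_pre(1)[OF p])
  have summ: "summable (\<lambda>i. prob (B i))"
  proof (rule summable_comparison_test_ev)
    \<comment> \<open>The margin y in the assumed decay is what makes the exceptional probabilities
      geometric in i.\<close>
    show "eventually (\<lambda>i. norm (prob (B i)) \<le> C1 powr t * C1 * exp (- t * y) ^ i) sequentially"
      using ev
    proof eventually_elim
      case (elim i)
      have "prob (B i) \<le> C1 powr t * C1 * rsum t p (N * i) \<beta> * exp (t * (real i * x))"
        unfolding B_def using t by (intro near_mass_tail p) auto
      also have "\<dots> \<le> C1 powr t * C1 * exp (- t * (real i * (x + y))) * exp (t * (real i * x))"
        using elim C1_pos by (intro mult_right_mono mult_left_mono) auto
      also have "\<dots> = C1 powr t * C1 * (exp (- t * (real i * (x + y))) * exp (t * (real i * x)))" by simp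
      also have "exp (- t * (real i * (x + y))) * exp (t * (real i * x)) = exp (- t * y) ^ i"
        by (simp add: exp_add[symmetric] exp_of_nat_mult[symmetric] algebra_simps)
      finally show ?case by simp
    qed
    show "summable (\<lambda>i. C1 powr t * C1 * exp (- t * y) ^ i)"
      using t y by (intro summable_mult summable_geometric) auto
  qed
  have "AE \<omega> in nu m p. eventually (\<lambda>i. \<omega> \<in> space (nu m p) - B i) sequentially"
    by (intro borel_cantelli_AE1 Bm summ) (auto simp: emeasure_eq_measure)
  then have AEG: "AE \<omega> in nu m p. \<exists>i0. \<forall>i\<ge>i0. \<omega> \<in> G i"
    by eventually_elim (auto simp: eventually_sequentially B_def G_def not_less)
  have "s \<le> hausdorff_dim_measure (distr (nu m p) borel ?P)"
  proof (rule hausdorff_dim_measure_ge)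
    show "emeasure (distr (nu m p) borel ?P) UNIV > 0"
      using Pm emeasure_space_1 by (subst emeasure_distr) auto
    fix A :: "complex set" assume A: "A \<in> sets borel" "emeasure (distr (nu m p) borel ?P) A > 0"
    \<comment> \<open>Exhaustion by sets on which the mass bound holds from a common index on; one
      of them must have positive measure.\<close>
    define E where "E i0 = (?P -` A \<inter> space (nu m p)) \<inter> (\<Inter>i\<in>{i0..}. G i)" for i0
    have PA: "?P -` A \<inter> space (nu m p) \<in> sets (nu m p)" using Pm A by (intro measurable_sets) auto
    have Em: "E i0 \<in> sets (nu m p)" for i0 unfolding E_def
      by (rule sets.Int[OF PA], rule sets.countable_INT') (use Gm in auto)
    have "\<exists>i0. emeasure (nu m p) (E i0) > 0"
    proof (rule ccontr)
      assume "\<not> ?thesis"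
      then have "E i0 \<in> null_sets (nu m p)" for i0 using Em by (auto simp: null_sets_def not_gr_zero)
      then have "(\<Union>i0. E i0) \<in> null_sets (nu m p)" by (rule null_sets_UN)
      then have "AE \<omega> in nu m p. \<omega> \<notin> (\<Union>i0. E i0)" by (rule AE_not_in)
      with AEG have "AE \<omega> in nu m p. \<omega> \<notin> ?P -` A \<inter> space (nu m p)"
        by eventually_elim (auto simp: E_def)
      then have "emeasure (nu m p) (?P -` A \<inter> space (nu m p)) = 0"
        using PA by (simp add: AE_iff_measurable[OF _ refl] AE_iff_null_sets null_setsD1)
      then show False using A Pm by (simp add: emeasure_distr)
    qed
    then obtain i0 where i0: "emeasure (nu m p) (E i0) > 0" by auto
    show "s \<le> hausdorff_dim A"
    proof (rule hausdorff_dim_ge)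
      fix s' assume s': "0 \<le> s'" "s' < s"
      show "hausdorff_measure s' A \<noteq> 0"
      proof (rule mass_distribution[OF _ Pm Em i0])
        show "finite_measure (nu m p)" by unfold_locales
        \<comment> \<open>Masses are controlled only at the radii \<open>r ^ (N * i)\<close>; the
          ratio \<open>r ^ N\<close> of consecutive radii produces this constant.\<close>
        show "(1 / r ^ N) powr s > 0" using r0 by simp
        show "r ^ (N * i0) > 0" by (rule rn)
      next
        fix \<omega> d assume w: "\<omega> \<in> E i0" and d: "0 \<le> d" "d < r ^ (N * i0)"
        have wsp: "\<omega> \<in> space (nu m p)" using w by (auto simp: E_def)
        let ?D = "\<lambda>d. {\<omega>'\<in>space (nu m p). dist (?P \<omega>') (?P \<omega>) \<le> d}"
        have Dm: "?D d \<in> sets (nu m p)" for d using Pm by measurable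
        have le: "prob (?D d) \<le> exp (- (real i * x))" if "i \<ge> i0" "d \<le> r ^ (N * i)" for i d
        proof -
          have "prob (?D d) \<le> near_mass p (N * i) \<beta> (pre (N * i) \<omega>)" using that by (intro ball_le_near_mass p wsp)
          also have "\<dots> \<le> exp (- (real i * x))" using w that by (auto simp: E_def G_def)
          finally show ?thesis .
        qed
        have rN: "r ^ N < 1" "0 < r ^ N" using r0 r1 N by (auto simp: power_less_one_iff)
        show "prob (?D d) \<le> (1 / r ^ N) powr s * d powr s'"
        proof (cases "d = 0")
          \<comment> \<open>At radius 0 the mass is at most exp (- x i) for all i \<ge> i0, so it
            vanishes, as \<open>0 powr s' = 0\<close> demands.\<close>
          case True
          have "(\<lambda>i. exp (- x) ^ i) \<longlonglongrightarrow> 0" using x by (intro LIMSEQ_power_zero) auto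
          moreover have "\<forall>i\<ge>i0. prob (?D d) \<le> exp (- x) ^ i"
            using le[of _ d] True rn by (auto simp: exp_of_nat_mult[symmetric] intro: less_imp_le)
          ultimately have "prob (?D d) \<le> 0" by (intro LIMSEQ_le_const) auto
          then show ?thesis using True by simp
        next
          case False
          then have d0: "d > 0" using d by simp
          have "(\<lambda>i. (r ^ N) ^ i) \<longlonglongrightarrow> 0" using rN by (intro LIMSEQ_power_zero) auto
          then have "eventually (\<lambda>i. (r ^ N) ^ i < d) sequentially" using d0 by (rule order_tendstoD)
          then obtain i1 where i1: "r ^ (N * i1) < d" by (auto simp: eventually_sequentially power_mult)
          \<comment> \<open>The first scale below d. Its predecessor i has
            \<open>d <= r ^ (N * i)\<close>, and \<open>i >= i0\<close> because
            \<open>d < r ^ (N * i0)\<close>.\<close>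
          define j where "j = (LEAST i. r ^ (N * i) < d)"
          have j: "r ^ (N * j) < d" unfolding j_def by (rule LeastI[of _ i1]) (rule i1)
          have jmin: "d \<le> r ^ (N * i)" if "i < j" for i
            using not_less_Least[of i "\<lambda>i. r ^ (N * i) < d"] that by (simp add: j_def not_less)
          have ji0: "j > i0"
          proof (rule ccontr)
            assume "\<not> j > i0"
            then have "r ^ (N * i0) \<le> r ^ (N * j)" using r0 r1 by (intro power_decreasing) auto
            then show False using j d by simp
          qed
          then obtain i where i: "j = Suc i" "i \<ge> i0" by (cases j) auto
          have "prob (?D d) \<le> exp (- (real i * x))" using i jmin[of i] by (intro le) auto
          also have "\<dots> = (r ^ (N * i)) powr s" unfolding rpow_powr sx by (simp add: algebra_simps)
          also have "\<dots> \<le> ((1 / r ^ N) * d) powr s"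
          proof (rule powr_mono2)
            have "r ^ (N * i) * r ^ N < d" using j i by (simp add: power_add mult.commute)
            then show "r ^ (N * i) \<le> (1 / r ^ N) * d" using rN by (simp add: field_simps)
          qed (use s rn in \<open>auto intro: less_imp_le\<close>)
          also have "\<dots> = (1 / r ^ N) powr s * d powr s" using rN d0 by (subst powr_mult) auto
          also have "\<dots> \<le> (1 / r ^ N) powr s * d powr s'"
          proof -
            have "d \<le> 1" using d rn[of "N * i0"] by linarith
            then have "d powr s \<le> d powr s'" using s' d0 by (intro powr_mono') auto
            then show ?thesis by (intro mult_left_mono) auto
          qed
          finally show ?thesis .
        qed
      qed (auto simp: E_def)
    qed
  qed
  then show ?thesis unfolding distr_mu_proj[OF p] s_def .
qed

text \<open>The projection is carried by a compact segment, the image of the disc of radius R, and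
  O(2^n) pieces of length 2^-n cover it. The excess e makes the covering sums converge.\<close>

lemma proj_dim_le_1:
  assumes p: "pvec m p"
  shows "hausdorff_dim_measure (distr (mu p) borel (proj_line \<beta>)) \<le> 1"
proof (rule field_le_epsilon)
  interpret prob_space "nu m p" by (rule prob_space_nu[OF p])
  let ?P = "\<lambda>\<omega>. proj_line \<beta> (cod \<omega>)"
  have Pm: "?P \<in> borel_measurable (nu m p)"
    using measurable_compose[OF cod_measurable[OF p] borel_measurable_continuous_onI[OF continuous_proj_line]] .
  fix e :: real assume e: "e > 0"
  define A where "A = proj_line \<beta> ` cball 0 R"
  have "compact A" unfolding A_def by (intro compact_continuous_image continuous_proj_line) simp
  then have Ab: "A \<in> sets borel" by (intro borel_closed compact_imp_closed)
  have "emeasure (distr (nu m p) borel ?P) A = 1"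
  proof -
    have "?P -` A \<inter> space (nu m p) = space (nu m p)" using norm_cod_le by (auto simp: A_def)
    then show ?thesis using Pm Ab emeasure_space_1 by (simp add: emeasure_distr)
  qed
  then have "hausdorff_dim_measure (distr (nu m p) borel ?P) \<le> hausdorff_dim A"
    using Ab by (intro hausdorff_dim_measure_le) auto
  also have "\<dots> \<le> 1 + e"
  proof (rule hausdorff_dim_le)
    obtain K :: nat where K: "R + 1 \<le> real K" using real_arch_simple by blast
    have dirR: "\<bar>dir \<beta> z\<bar> \<le> R" if "norm z \<le> R" for z using abs_dir_le[of \<beta> z] that by simp
    define Q where "Q n c = {proj_line \<beta> z | z. \<lfloor>dir \<beta> z * 2 ^ n\<rfloor> = c}" for n :: nat and c :: int
    have diff: "norm (x - y) \<le> 1 / 2 ^ n" if "x \<in> Q n c" "y \<in> Q n c" for n c x y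
    proof -
      obtain z z' where z: "x = proj_line \<beta> z" "y = proj_line \<beta> z'" "\<lfloor>dir \<beta> z * 2 ^ n\<rfloor> = \<lfloor>dir \<beta> z' * 2 ^ n\<rfloor>"
        using \<open>x \<in> Q n c\<close> \<open>y \<in> Q n c\<close> by (auto simp: Q_def)
      then have "\<bar>dir \<beta> z * 2 ^ n - dir \<beta> z' * 2 ^ n\<bar> \<le> 1" by linarith
      then have "\<bar>dir \<beta> z - dir \<beta> z'\<bar> * 2 ^ n \<le> 1" by (simp add: left_diff_distrib[symmetric] abs_mult)
      then show ?thesis using dist_proj_line[of \<beta> z z'] z by (simp add: dist_norm field_simps)
    qed
    show "hausdorff_measure (1 + e) A = 0"
    proof (rule hausdorff_measure_limsup_cover[where Q = Q and C = "\<lambda>n. {- int (K * 2 ^ n)..int (K * 2 ^ n)}" and d = "\<lambda>n. 1 / 2 ^ n"])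
      fix x N assume "x \<in> A"
      then obtain z where z: "x = proj_line \<beta> z" "norm z \<le> R" by (auto simp: A_def)
      have "x \<in> Q N \<lfloor>dir \<beta> z * 2 ^ N\<rfloor>" using z by (auto simp: Q_def)
      moreover have "\<lfloor>dir \<beta> z * 2 ^ N\<rfloor> \<in> {- int (K * 2 ^ N)..int (K * 2 ^ N)}"
      proof -
        have "\<bar>dir \<beta> z\<bar> \<le> real K" using dirR[OF z(2)] K by simp
        then have "\<bar>dir \<beta> z * 2 ^ N\<bar> \<le> real K * 2 ^ N" by (simp add: abs_mult)
        then have "- real_of_int (int (K * 2 ^ N)) \<le> dir \<beta> z * 2 ^ N" "dir \<beta> z * 2 ^ N \<le> real_of_int (int (K * 2 ^ N))"
          by (auto simp: abs_le_iff)
        then have "- int (K * 2 ^ N) \<le> \<lfloor>dir \<beta> z * 2 ^ N\<rfloor>" "\<lfloor>dir \<beta> z * 2 ^ N\<rfloor> \<le> int (K * 2 ^ N)"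
          by (simp only: le_floor_iff of_int_minus, linarith)
        then show ?thesis by simp
      qed
      ultimately show "\<exists>n\<ge>N. \<exists>c\<in>{- int (K * 2 ^ n)..int (K * 2 ^ n)}. x \<in> Q n c" by blast
    next
      fix n c
      have "bounded (Q n c)"
      proof (cases "Q n c = {}")
        case False
        then obtain x where "x \<in> Q n c" by auto
        then have "Q n c \<subseteq> cball x (1 / 2 ^ n)" using diff by (auto simp: dist_norm)
        then show ?thesis by (rule bounded_subset[OF bounded_cball])
      qed simp
      moreover have "diameter (Q n c) \<le> 1 / 2 ^ n" using diff by (intro diameter_le) auto
      ultimately show "bounded (Q n c) \<and> diameter (Q n c) \<le> 1 / 2 ^ n" ..
    next
      show "(\<lambda>n. 1 / 2 ^ n :: real) \<longlonglongrightarrow> 0" by real_asymp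
      have "(1 / 2) powr e = exp (- (e * ln 2))" by (simp add: powr_def ln_div)
      then have q: "(1 / 2) powr e < 1" "0 < (1/2) powr e" using e by auto
      have bnd: "real (card {- int (K * 2 ^ n)..int (K * 2 ^ n)}) * (1 / 2 ^ n) powr (1 + e) \<le> (2 * real K + 1) * ((1/2) powr e) ^ n" for n :: nat
      proof -
        have "real (card {- int (K * 2 ^ n)..int (K * 2 ^ n)}) = 2 * real K * 2 ^ n + 1"
          by (simp add: nat_add_distrib nat_mult_distrib nat_power_eq)
        also have "\<dots> \<le> (2 * real K + 1) * 2 ^ n" by (simp add: algebra_simps)
        finally have "real (card {- int (K * 2 ^ n)..int (K * 2 ^ n)}) * (1 / 2 ^ n) powr (1 + e)
          \<le> (2 * real K + 1) * 2 ^ n * (1 / 2 ^ n) powr (1 + e)" by (intro mult_right_mono) auto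
        also have "\<dots> = (2 * real K + 1) * ((1/2) powr e) ^ n"
        proof -
          have "(1 / 2 ^ n :: real) = (1/2) powr real n" by (simp add: powr_realpow power_one_over)
          then have "(1 / 2 ^ n :: real) powr e = (1/2) powr (real n * e)" by (simp only: powr_powr)
          also have "\<dots> = ((1/2) powr e) ^ n" using q by (simp add: powr_realpow[symmetric] powr_powr mult.commute)
          finally have "(1 / 2 ^ n :: real) powr e = ((1/2) powr e) ^ n" .
          then have "(1 / 2 ^ n :: real) powr (1 + e) = (1 / 2 ^ n) * ((1/2) powr e) ^ n" by (simp add: powr_add)
          then show ?thesis by (simp only: mult.assoc) simp
        qed
        finally show ?thesis .
      qed
      show "summable (\<lambda>n. real (card {- int (K * 2 ^ n)..int (K * 2 ^ n)}) * (1 / 2 ^ n) powr (1 + e))"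
      proof (rule summable_comparison_test)
        show "summable (\<lambda>n. (2 * real K + 1) * ((1/2) powr e) ^ n)"
          using q by (intro summable_mult summable_geometric) auto
        show "\<exists>N. \<forall>n\<ge>N. norm (real (card {- int (K * 2 ^ n)..int (K * 2 ^ n)}) * (1 / 2 ^ n) powr (1 + e)) \<le> (2 * real K + 1) * ((1/2) powr e) ^ n"
          using bnd by (auto simp: abs_mult)
      qed
    qed (use e in auto)
  qed (use e in simp)
  finally show "hausdorff_dim_measure (distr (mu p) borel (proj_line \<beta>)) \<le> 1 + e" unfolding distr_mu_proj[OF p] .
qed

lemma proj_dim_le:
  assumes p: "pvec m p"
  shows "hausdorff_dim_measure (distr (mu p) borel (proj_line \<beta>)) \<le> hausdorff_dim_measure (mu p)"
proof (rule hausdorff_dim_measure_image_le)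
  interpret prob_space "nu m p" by (rule prob_space_nu[OF p])
  interpret d: prob_space "mu p" by (rule prob_space_distr[OF cod_measurable[OF p]])
  show "finite_measure (mu p)" by unfold_locales
  show "emeasure (mu p) UNIV > 0" using d.emeasure_space_1 by simp
  show "dist (proj_line \<beta> x) (proj_line \<beta> y) \<le> dist x y" for x y
    unfolding dist_proj_line using abs_dir_le[of \<beta> "x - y"] by (simp add: dir_diff dist_norm)
qed simp

end

section \<open>Random weights\<close>

lemma (in prob_space) indep_vars_PiM_coords:
  "prob_space.indep_vars (\<Pi>\<^sub>M n\<in>(UNIV::nat set). M) (\<lambda>_. M) (\<lambda>n w. w n) UNIV"
proof -
  let ?W = "\<Pi>\<^sub>M n\<in>(UNIV::nat set). M"
  interpret W: prob_space ?W by (rule prob_space_PiM) unfold_locales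
  have c: "distr ?W M (\<lambda>w. w i) = M" for i
    by (rule distr_PiM_component) (auto intro: prob_space_axioms)
  show ?thesis
  proof (subst W.indep_vars_iff_distr_eq_PiM)
    have "distr ?W ?W (\<lambda>x. \<lambda>i\<in>UNIV. x i) = distr ?W ?W (\<lambda>x. x)"
      by (rule distr_cong) auto
    then show "distr ?W ?W (\<lambda>x. \<lambda>i\<in>UNIV. x i) = (\<Pi>\<^sub>M i\<in>UNIV. distr ?W M (\<lambda>x. x i))"
      unfolding c by simp
  qed auto
qed

lemma (in prob_space) distr_PiM_nshift:
  "distr (\<Pi>\<^sub>M n\<in>(UNIV::nat set). M) (\<Pi>\<^sub>M n\<in>(UNIV::nat set). M) (nshift n) = (\<Pi>\<^sub>M n\<in>(UNIV::nat set). M)"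
proof -
  have "distr (Pi\<^sub>M UNIV (\<lambda>_::nat. M)) (\<Pi>\<^sub>M i\<in>UNIV. M) (\<lambda>\<omega>. \<lambda>i\<in>UNIV. \<omega> (n + i)) = (\<Pi>\<^sub>M i\<in>UNIV. M)"
    by (rule distr_PiM_reindex) (auto intro: prob_space_axioms)
  moreover have "(\<lambda>\<omega>. \<lambda>i\<in>UNIV. \<omega> (n + i)) = (nshift n :: (nat \<Rightarrow> 'a) \<Rightarrow> _)"
    by (auto simp: nshift_def fun_eq_iff)
  ultimately show ?thesis by simp
qed

locale random_ifs = similarity_ifs r \<theta> m a + prob_space M
  for r \<theta> m a and M :: "'w measure" +
  fixes X :: "'w \<Rightarrow> nat \<Rightarrow> real"
  assumes irr: "\<theta> / pi \<notin> \<rat>"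
    and X_meas: "\<And>i. i \<in> {1..m} \<Longrightarrow> (\<lambda>\<omega>. X \<omega> i) \<in> borel_measurable M"
    and X_nonneg: "\<And>\<omega> i. \<omega> \<in> space M \<Longrightarrow> i \<in> {1..m} \<Longrightarrow> 0 \<le> X \<omega> i"
    and X_sum: "\<And>\<omega>. \<omega> \<in> space M \<Longrightarrow> (\<Sum>i=1..m. X \<omega> i) = 1"
begin

definition WM :: "(nat \<Rightarrow> 'w) measure" where "WM = (\<Pi>\<^sub>M n\<in>(UNIV::nat set). M)"

sublocale W: prob_space WM
  unfolding WM_def by (rule prob_space_PiM) unfold_locales

definition pw :: "(nat \<Rightarrow> 'w) \<Rightarrow> nat \<Rightarrow> nat \<Rightarrow> real" where "pw w = (\<lambda>j i. X (w j) i)"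

lemma pvec_pw: "w \<in> space WM \<Longrightarrow> pvec m (pw w)"
proof -
  assume "w \<in> space WM"
  then have "w j \<in> space M" for j unfolding WM_def by (auto simp: space_PiM)
  then show ?thesis unfolding pvec_def pw_def using X_nonneg X_sum by blast
qed

lemma nshift_pw: "nshift n (pw w) = pw (nshift n w)"
  by (simp add: nshift_def pw_def)

text \<open>The index set K need only contain the digits of the block. With K equal to the block
  this gives measurability in its own coordinates, from which independence of blocks
  follows.\<close>

lemma weight_measurable:
  assumes "l \<in> words m k" "{n..<n+k} \<subseteq> K"
  shows "(\<lambda>v. weight (nshift n (pw v)) l) \<in> borel_measurable (PiM K (\<lambda>_. M))"
proof -
  have len: "length l = k" and li: "\<And>j. j < k \<Longrightarrow> l ! j \<in> {1..m}"
    using assms(1) nth_mem by (auto simp: words_def simp del: atLeastAtMost_iff)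
  have "(\<lambda>v. X (v (n + j)) (l ! j)) \<in> borel_measurable (PiM K (\<lambda>_. M))" if "j < k" for j
  proof -
    have "(\<lambda>v. v (n + j)) \<in> measurable (PiM K (\<lambda>_. M)) M"
      using that assms(2) by (intro measurable_component_singleton) auto
    from measurable_compose[OF this X_meas[OF li[OF that]]] show ?thesis .
  qed
  then show ?thesis unfolding weight_prod len nshift_def pw_def by (intro borel_measurable_prod) auto
qed

lemma mass_measurable:
  assumes "{n..<n+k} \<subseteq> K"
  shows "(\<lambda>v. mass (weight (nshift n (pw v))) (words m k) f c) \<in> borel_measurable (PiM K (\<lambda>_. M))"
  unfolding mass_def using assms by (intro borel_measurable_sum weight_measurable) auto

lemma rsum_measurable:
  assumes "{n..<n+k} \<subseteq> K"
  shows "(\<lambda>v. rsum t (nshift n (pw v)) k \<beta>) \<in> borel_measurable (PiM K (\<lambda>_. M))"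
  unfolding rsum_def power_sum_def
  using mass_measurable[OF assms] by (intro borel_measurable_sum powr_real_measurable borel_measurable_const)

lemma renyi_measurable:
  assumes "{n..<n+k} \<subseteq> K"
  shows "(\<lambda>v. renyi (nshift n (pw v)) k \<beta>) \<in> borel_measurable (PiM K (\<lambda>_. M))"
  unfolding renyi_def
  using rsum_measurable[OF assms]
  by (intro borel_measurable_divide borel_measurable_uminus borel_measurable_ln borel_measurable_const)

lemma renyi_measurable_WM [measurable]: "(\<lambda>w. renyi (nshift n (pw w)) k \<beta>) \<in> borel_measurable WM"
  unfolding WM_def by (rule renyi_measurable) simp

lemma renyi_measurable_WM0 [measurable]: "(\<lambda>w. renyi (pw w) k \<beta>) \<in> borel_measurable WM"
  using renyi_measurable_WM[of 0] by (simp add: nshift_def)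

lemma weight_cong: "(\<And>j. j < length l \<Longrightarrow> p j = p' j) \<Longrightarrow> weight p l = weight p' l"
  unfolding weight_prod by (intro prod.cong) auto

lemma renyi_restrict:
  assumes "{n..<n+k} \<subseteq> K"
  shows "renyi (nshift n (pw (restrict w K))) k \<beta> = renyi (nshift n (pw w)) k \<beta>"
proof -
  have "weight (nshift n (pw (restrict w K))) l = weight (nshift n (pw w)) l" if "l \<in> words m k" for l
  proof (rule weight_cong)
    fix j assume "j < length l"
    then have "n + j \<in> K" using assms that by (auto simp: words_def subset_iff)
    then show "nshift n (pw (restrict w K)) j = nshift n (pw w) j" by (simp add: nshift_def pw_def)
  qed
  then have "mass (weight (nshift n (pw (restrict w K)))) (words m k) f c = mass (weight (nshift n (pw w))) (words m k) f c" for f :: "nat list \<Rightarrow> int" and c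
    unfolding mass_def by (intro sum.cong) auto
  then show ?thesis unfolding renyi_def rsum_def power_sum_def by simp
qed

definition expected_entropy :: "nat \<Rightarrow> real \<Rightarrow> real" where "expected_entropy k \<beta> = W.expectation (\<lambda>w. renyi (pw w) k \<beta>)"

text \<open>The product measure is invariant under the shift.\<close>

lemma expectation_renyi_nshift: "W.expectation (\<lambda>w. renyi (nshift n (pw w)) k \<beta>) = expected_entropy k \<beta>"
proof -
  have ns: "nshift n \<in> measurable WM WM"
  proof -
    have "(\<lambda>\<omega>. \<lambda>i\<in>UNIV. \<omega> (n + i)) \<in> measurable WM WM" unfolding WM_def by measurable
    moreover have "(\<lambda>\<omega>. \<lambda>i\<in>UNIV. \<omega> (n + i)) = (nshift n :: (nat \<Rightarrow> 'w) \<Rightarrow> _)"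
      by (auto simp: nshift_def fun_eq_iff)
    ultimately show ?thesis by simp
  qed
  have "W.expectation (\<lambda>w. renyi (nshift n (pw w)) k \<beta>) = integral\<^sup>L (distr WM WM (nshift n)) (\<lambda>w. renyi (pw w) k \<beta>)"
    unfolding nshift_pw by (rule integral_distr[symmetric]) (use ns in measurable)
  also have "distr WM WM (nshift n) = WM" unfolding WM_def by (rule distr_PiM_nshift)
  finally show ?thesis unfolding expected_entropy_def .
qed

lemma renyi_bounds: "w \<in> space WM \<Longrightarrow> 0 \<le> renyi (nshift n (pw w)) k \<beta> \<and> renyi (nshift n (pw w)) k \<beta> \<le> real k * ln (real m)"
  using renyi_nonneg renyi_le pvec_nshift[OF pvec_pw] by blast

lemma renyi_bounds0: "w \<in> space WM \<Longrightarrow> 0 \<le> renyi (pw w) k \<beta> \<and> renyi (pw w) k \<beta> \<le> real k * ln (real m)"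
  using renyi_bounds[of w 0 k \<beta>] by (simp add: nshift_def)

lemma integrable_renyi: "integrable WM (\<lambda>w. renyi (pw w) k \<beta>)"
  by (rule W.integrable_const_bound[where B = "real k * ln (real m)"]) (use renyi_bounds0 in auto)

lemma expected_entropy_period: "expected_entropy k (\<beta> + 2 * pi * of_int j) = expected_entropy k \<beta>"
  unfolding expected_entropy_def renyi_period ..

lemma expected_entropy_le: "expected_entropy k \<beta> \<le> real k * ln (real m)"
proof -
  have "expected_entropy k \<beta> \<le> W.expectation (\<lambda>_. real k * ln (real m))"
    unfolding expected_entropy_def using renyi_bounds0 by (intro integral_mono integrable_renyi) auto
  then show ?thesis by (simp add: W.prob_space)
qed

text \<open>Cost of turning by \<open>4 * pi * r ^ k\<close>, which bounds the distance 4 pi / q in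
  \<open>rotation_block_sum\<close> when \<open>1 / q <= r ^ k\<close>.\<close>

definition C2 :: real where "C2 = ln (2 * (4 * pi * R) + 3)"

lemma C2_nonneg: "C2 \<ge> 0" unfolding C2_def using R_nonneg by (intro ln_ge_zero) simp

lemma renyi_cont4:
  "w \<in> space WM \<Longrightarrow> \<bar>\<beta> - \<beta>'\<bar> \<le> 4 * pi * r ^ k \<Longrightarrow> renyi (nshift n (pw w)) k \<beta> \<le> renyi (nshift n (pw w)) k \<beta>' + C2"
  unfolding C2_def using renyi_cont[OF pvec_nshift[OF pvec_pw], of w "4 * pi"] by simp

lemma expected_entropy_cont: "\<bar>\<beta> - \<beta>'\<bar> \<le> 4 * pi * r ^ k \<Longrightarrow> expected_entropy k \<beta> \<le> expected_entropy k \<beta>' + C2"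
proof -
  assume d: "\<bar>\<beta> - \<beta>'\<bar> \<le> 4 * pi * r ^ k"
  have "expected_entropy k \<beta> \<le> W.expectation (\<lambda>w. renyi (pw w) k \<beta>' + C2)"
    unfolding expected_entropy_def using renyi_cont4[OF _ d, where n=0]
    by (intro integral_mono Bochner_Integration.integrable_add integrable_renyi W.integrable_const) (simp add: nshift_def)
  also have "\<dots> = expected_entropy k \<beta>' + C2"
    unfolding expected_entropy_def by (subst Bochner_Integration.integral_add) (auto intro: integrable_renyi simp: W.prob_space)
  finally show ?thesis .
qed

text \<open>Along \<open>q\<close> consecutive rotations by \<open>k * \<theta>\<close>, every orbit visits each arc of a grid of \<open>q\<close> directions, up to
  an error of the order of the mesh.\<close>

definition good_den :: "nat \<Rightarrow> nat \<Rightarrow> bool" where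
  "good_den k q \<longleftrightarrow> q > 0 \<and> 1 / real q \<le> r ^ k \<and>
     (\<exists>p. coprime p (int q) \<and> \<bar>real k * \<theta> / (2 * pi) - of_int p / real q\<bar> \<le> 1 / (real q)\<^sup>2)"

definition grid :: "nat \<Rightarrow> nat" where "grid k = (SOME q. good_den k q)"

lemma good_den_grid: "k \<ge> 1 \<Longrightarrow> good_den k (grid k)"
proof -
  assume k: "k \<ge> 1"
  have "real k * \<theta> / (2 * pi) \<notin> \<rat>"
  proof
    assume "real k * \<theta> / (2 * pi) \<in> \<rat>"
    moreover have "2 / real k \<in> \<rat>" by (intro Rats_divide) auto
    ultimately have "real k * \<theta> / (2 * pi) * (2 / real k) \<in> \<rat>" by (rule Rats_mult)
    moreover have "real k * \<theta> / (2 * pi) * (2 / real k) = \<theta> / pi" using k by simp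
    ultimately show False using irr by simp
  qed
  then obtain p q where pq: "q > nat \<lceil>1 / r ^ k\<rceil>" "coprime p (int q)"
    "\<bar>real k * \<theta> / (2 * pi) - of_int p / real q\<bar> \<le> 1 / (real q)\<^sup>2"
    by (rule irrational_good_approx)
  have "1 / r ^ k \<le> real q" using pq(1) by linarith
  moreover have "q > 0" using pq(1) by simp
  ultimately have "1 / real q \<le> r ^ k" using rn[of k] by (simp add: field_simps)
  then have "good_den k q" unfolding good_den_def using pq by auto
  then show ?thesis unfolding grid_def by (rule someI)
qed

lemma grid_pos: "k \<ge> 1 \<Longrightarrow> grid k > 0"
  using good_den_grid by (auto simp: good_den_def)

text \<open>Stands in for the integral of the expected entropy over all directions; the grid is fine
  enough for \<open>expected_entropy_cont\<close>.\<close>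

definition mean_entropy :: "nat \<Rightarrow> real" where
  "mean_entropy k = (\<Sum>i<grid k. expected_entropy k (2 * pi * real i / real (grid k))) / real (grid k)"

lemma mean_entropy_le: "k \<ge> 1 \<Longrightarrow> mean_entropy k \<le> real k * ln (real m)"
proof -
  assume "k \<ge> 1"
  then have q: "grid k > 0" by (rule grid_pos)
  have "(\<Sum>i<grid k. expected_entropy k (2 * pi * real i / real (grid k))) \<le> (\<Sum>i<grid k. real k * ln (real m))"
    by (intro sum_mono expected_entropy_le)
  then show ?thesis unfolding mean_entropy_def using q by (simp add: field_simps)
qed

text \<open>Block j is seen in the direction \<beta> - j k \<theta>. Equidistribution of the
  rotation by k \<theta> makes the bound independent of the starting direction.\<close>

lemma expected_entropy_sum_ge:
  assumes k: "k \<ge> 1"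
  shows "real (grid k * N) * (mean_entropy k - C2) \<le> (\<Sum>j<grid k * N. expected_entropy k (\<beta> - real (j * k) * \<theta>))"
proof -
  let ?q = "grid k"
  from good_den_grid[OF k] obtain p where q: "?q > 0" "1 / real ?q \<le> r ^ k" and p: "coprime p (int ?q)"
    "\<bar>real k * \<theta> / (2 * pi) - of_int p / real ?q\<bar> \<le> 1 / (real ?q)\<^sup>2" by (auto simp: good_den_def)
  have c: "expected_entropy k x \<le> expected_entropy k y + C2" if "\<bar>x - y\<bar> \<le> 4 * pi / real ?q" for x y
  proof (rule expected_entropy_cont)
    have "4 * pi * (1 / real ?q) \<le> 4 * pi * r ^ k" using q by (intro mult_left_mono) auto
    then show "\<bar>x - y\<bar> \<le> 4 * pi * r ^ k" using that by simp
  qed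
  have "real N * (\<Sum>i<?q. expected_entropy k (2 * pi * real i / real ?q)) \<le> (\<Sum>j<?q * N. expected_entropy k (\<beta> - 2 * pi * real j * (real k * \<theta> / (2 * pi)))) + real (?q * N) * C2"
    by (rule rotation_sum[OF expected_entropy_period q(1) p c])
  moreover have "(\<Sum>j<?q * N. expected_entropy k (\<beta> - 2 * pi * real j * (real k * \<theta> / (2 * pi)))) = (\<Sum>j<?q * N. expected_entropy k (\<beta> - real (j * k) * \<theta>))"
    by (intro sum.cong refl arg_cong[where f="expected_entropy k"]) simp
  moreover have "real (?q * N) * mean_entropy k = real N * (\<Sum>i<?q. expected_entropy k (2 * pi * real i / real ?q))"
    unfolding mean_entropy_def using q by simp
  ultimately show ?thesis unfolding right_diff_distrib by linarith
qed

section \<open>Large deviations, uniformly in the direction\<close>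

definition entropy_sum :: "nat \<Rightarrow> nat \<Rightarrow> real \<Rightarrow> (nat \<Rightarrow> 'w) \<Rightarrow> real" where
  "entropy_sum k J \<beta> w = (\<Sum>j<J. renyi (nshift (j * k) (pw w)) k (\<beta> - real (j * k) * \<theta>))"

lemma entropy_sum_measurable [measurable]: "entropy_sum k J \<beta> \<in> borel_measurable WM"
  unfolding entropy_sum_def by measurable

text \<open>Hoeffding's inequality with a deviation of 1 per block. The blocks are independent
  because they read disjoint sets of coordinates, as made explicit by
  \<open>renyi_restrict\<close>.\<close>

lemma entropy_sum_tail:
  assumes k: "k \<ge> 1" and J: "J \<ge> 1"
  shows "W.prob {w\<in>space WM. entropy_sum k J \<beta> w \<le> (\<Sum>j<J. expected_entropy k (\<beta> - real (j * k) * \<theta>)) - real J}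
     \<le> exp (- 2 * real J / (real k * ln (real m) + 1)\<^sup>2)"
proof -
  \<comment> \<open>The added 1 keeps the range of positive length when
    \<open>m = 1\<close>.\<close>
  let ?B = "real k * ln (real m) + 1"
  let ?K = "\<lambda>j. {j * k..<j * k + k}"
  let ?Z = "\<lambda>j w. renyi (nshift (j * k) (pw w)) k (\<beta> - real (j * k) * \<theta>)"
  have B: "?B > 0" using m1 by (simp add: add_nonneg_pos)
  have "W.indep_vars (\<lambda>_. M) (\<lambda>n w. w n) UNIV" unfolding WM_def by (rule indep_vars_PiM_coords)
  moreover have "disjoint_family_on ?K {..<J}"
  proof (unfold disjoint_family_on_def, intro ballI impI)
    fix i j :: nat assume "i \<noteq> j"
    have "i = j" if "x \<in> ?K i" "x \<in> ?K j" for x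
    proof -
      have "x div k = i" "x div k = j" using that k
        by (auto intro!: div_nat_eqI simp: algebra_simps)
      then show ?thesis by simp
    qed
    then show "?K i \<inter> ?K j = {}" using \<open>i \<noteq> j\<close> by blast
  qed
  ultimately have "W.indep_vars (\<lambda>j. PiM (?K j) (\<lambda>_. M)) (\<lambda>j w. restrict (\<lambda>n. w n) (?K j)) {..<J}"
    by (intro W.indep_vars_restrict) auto
  then have "W.indep_vars (\<lambda>_. borel) (\<lambda>j w. ?Z j (restrict (\<lambda>n. w n) (?K j))) {..<J}"
    by (rule W.indep_vars_compose2) (rule renyi_measurable, simp)
  then have ind: "W.indep_vars (\<lambda>_. borel) ?Z {..<J}"
    by (simp add: renyi_restrict)
  interpret Hoeffding_ineq WM "{..<J}" ?Z "\<lambda>_. 0" "\<lambda>_. ?B" "\<Sum>j<J. W.expectation (?Z j)"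
  proof unfold_locales
    show "AE w in WM. ?Z j w \<in> {0..?B}" for j
    proof (rule AE_I2)
      fix w assume "w \<in> space WM"
      then show "?Z j w \<in> {0..?B}"
        using renyi_bounds[of w "j * k" k "\<beta> - real (j * k) * \<theta>"] by auto
    qed
  qed (use ind in auto)
  have "W.prob {w\<in>space WM. (\<Sum>j<J. ?Z j w) \<le> (\<Sum>j<J. W.expectation (?Z j)) - real J}
     \<le> exp (- 2 * (real J)\<^sup>2 / (\<Sum>j<J. (?B - 0)\<^sup>2))"
    by (rule Hoeffding_ineq_le) (use J B in auto)
  also have "- 2 * (real J)\<^sup>2 / (\<Sum>j<J. (?B - 0)\<^sup>2) = - 2 * real J / ?B\<^sup>2"
  proof -
    have "- 2 * (real J)\<^sup>2 / (real J * b) = - 2 * real J / b" for b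
      using J by (simp add: power2_eq_square)
    then show ?thesis by simp
  qed
  finally show ?thesis unfolding expectation_renyi_nshift entropy_sum_def .
qed

text \<open>Losses per block: \<open>C2\<close> for the average over directions, \<open>C2\<close>
  for moving to a grid direction, 1 for the deviation, \<open>ln C0\<close> for
  submultiplicativity.\<close>

definition C3 :: real where "C3 = 2 * C2 + 1 + ln C0"

text \<open>Only grid directions are tested, so a finite union bound preserves the exponential decay
  in N.\<close>

definition Bad :: "nat \<Rightarrow> nat \<Rightarrow> (nat \<Rightarrow> 'w) set" where
  "Bad k N = (\<Union>i<grid k. {w\<in>space WM. entropy_sum k (grid k * N) (2 * pi * real i / real (grid k)) w \<le> real (grid k * N) * (mean_entropy k - C2 - 1)})"

lemma Bad_sets [measurable]: "Bad k N \<in> sets WM"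
  unfolding Bad_def by measurable

lemma Bad_prob:
  assumes k: "k \<ge> 1"
  obtains c where "0 < c" "c < 1" "\<And>N. N \<ge> 1 \<Longrightarrow> W.prob (Bad k N) \<le> real (grid k) * c ^ N"
proof -
  let ?B = "real k * ln (real m) + 1"
  define c where "c = exp (- 2 * real (grid k) / ?B\<^sup>2)"
  have B: "?B > 0" using m1 by (simp add: add_nonneg_pos)
  have q: "grid k > 0" using k by (rule grid_pos)
  show ?thesis
  proof (rule that[of c])
    show "0 < c" "c < 1" unfolding c_def using q B by auto
    fix N :: nat assume N: "N \<ge> 1"
    let ?E = "\<lambda>i. {w\<in>space WM. entropy_sum k (grid k * N) (2 * pi * real i / real (grid k)) w \<le> real (grid k * N) * (mean_entropy k - C2 - 1)}"
    have "W.prob (Bad k N) \<le> (\<Sum>i<grid k. W.prob (?E i))"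
      unfolding Bad_def by (intro W.finite_measure_subadditive_finite) auto
    also have "\<dots> \<le> (\<Sum>i<grid k. c ^ N)"
    proof (rule sum_mono)
      fix i
      let ?\<beta> = "2 * pi * real i / real (grid k)"
      have "W.prob (?E i) \<le> W.prob {w\<in>space WM. entropy_sum k (grid k * N) ?\<beta> w \<le> (\<Sum>j<grid k * N. expected_entropy k (?\<beta> - real (j * k) * \<theta>)) - real (grid k * N)}"
      proof (rule W.finite_measure_mono)
        show "?E i \<subseteq> {w\<in>space WM. entropy_sum k (grid k * N) ?\<beta> w \<le> (\<Sum>j<grid k * N. expected_entropy k (?\<beta> - real (j * k) * \<theta>)) - real (grid k * N)}"
          using expected_entropy_sum_ge[OF k, of N ?\<beta>] by (auto simp: algebra_simps)
      qed measurable
      also have "\<dots> \<le> exp (- 2 * real (grid k * N) / ?B\<^sup>2)" by (rule entropy_sum_tail[OF k]) (use q N in auto)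
      also have "\<dots> = c ^ N" unfolding c_def exp_of_nat_mult[symmetric] by (simp add: field_simps)
      finally show "W.prob (?E i) \<le> c ^ N" .
    qed
    finally show "W.prob (Bad k N) \<le> real (grid k) * c ^ N" by simp
  qed
qed

text \<open>Modulo 2 pi, every direction is within \<open>2 * pi * r ^ k\<close> of a grid
  direction, and stays so along the orbit because both are turned by the same angles. Hence a single
  exceptional event serves all directions.\<close>

lemma not_Bad_rsum:
  assumes k: "k \<ge> 1" and w: "w \<in> space WM" "w \<notin> Bad k N"
  shows "rsum (rexp k) (pw w) (grid k * N * k) \<beta> \<le> exp (- rexp k * (real (grid k * N) * (mean_entropy k - C3)))"
proof -
  let ?q = "grid k" and ?J = "grid k * N"
  have q: "?q > 0" "1 / real ?q \<le> r ^ k" using good_den_grid[OF k] by (auto simp: good_den_def)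
  obtain i z where i: "i < ?q" "\<bar>\<beta> - (2 * pi * real i / real ?q + 2 * pi * of_int z)\<bar> \<le> 2 * pi / real ?q"
    by (rule near_grid_angle[OF q(1)])
  let ?\<beta>' = "2 * pi * real i / real ?q"
  have "real ?J * (mean_entropy k - C2 - 1) \<le> entropy_sum k ?J ?\<beta>' w" using w i by (auto simp: Bad_def not_le intro: less_imp_le)
  also have "\<dots> \<le> (\<Sum>j<?J. renyi (nshift (j * k) (pw w)) k (\<beta> - real (j * k) * \<theta>) + C2)"
    unfolding entropy_sum_def
  proof (rule sum_mono)
    fix j
    have "renyi (nshift (j * k) (pw w)) k (?\<beta>' - real (j * k) * \<theta>) = renyi (nshift (j * k) (pw w)) k (?\<beta>' - real (j * k) * \<theta> + 2 * pi * of_int z)"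
      by (rule renyi_period[symmetric])
    also have "\<dots> \<le> renyi (nshift (j * k) (pw w)) k (\<beta> - real (j * k) * \<theta>) + C2"
    proof (rule renyi_cont4[OF w(1)])
      have "2 * pi * (1 / real ?q) \<le> 2 * pi * r ^ k" using q by (intro mult_left_mono) auto
      moreover have "0 \<le> 2 * pi * r ^ k" using r0 by simp
      ultimately show "\<bar>?\<beta>' - real (j * k) * \<theta> + 2 * pi * of_int z - (\<beta> - real (j * k) * \<theta>)\<bar> \<le> 4 * pi * r ^ k"
        using i(2) by (simp add: abs_le_iff)
    qed
    finally show "renyi (nshift (j * k) (pw w)) k (?\<beta>' - real (j * k) * \<theta>) \<le> renyi (nshift (j * k) (pw w)) k (\<beta> - real (j * k) * \<theta>) + C2" .
  qed
  also have "\<dots> = (\<Sum>j<?J. renyi (nshift (j * k) (pw w)) k (\<beta> - real (j * k) * \<theta>)) + real ?J * C2"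
    by (simp add: sum.distrib)
  finally have *: "real ?J * ln C0 - (\<Sum>j<?J. renyi (nshift (j * k) (pw w)) k (\<beta> - real (j * k) * \<theta>)) \<le> - (real ?J * (mean_entropy k - C3))"
    unfolding C3_def by (simp add: algebra_simps)
  have "rsum (rexp k) (pw w) (?J * k) \<beta> \<le> exp (rexp k * (real ?J * ln C0 - (\<Sum>j<?J. renyi (nshift (j * k) (pw w)) k (\<beta> - real (j * k) * \<theta>))))"
    by (rule rsum_iter_exp[OF pvec_pw[OF w(1)]])
  also have "\<dots> \<le> exp (rexp k * (- (real ?J * (mean_entropy k - C3))))"
    using * rexp_pos[of k] by (subst exp_le_cancel_iff) (intro mult_left_mono, auto)
  finally show ?thesis by simp
qed

lemma AE_eventually_good:
  assumes k: "k \<ge> 1"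
  shows "AE w in WM. eventually (\<lambda>N. w \<notin> Bad k N) sequentially"
proof -
  obtain c where c: "0 < c" "c < 1" "\<And>N. N \<ge> 1 \<Longrightarrow> W.prob (Bad k N) \<le> real (grid k) * c ^ N"
    by (rule Bad_prob[OF k]) blast
  have "AE w in WM. eventually (\<lambda>N. w \<in> space WM - Bad k N) sequentially"
  proof (rule borel_cantelli_AE1)
    show "summable (\<lambda>N. W.prob (Bad k N))"
    proof (rule summable_comparison_test)
      show "\<exists>N. \<forall>n\<ge>N. norm (W.prob (Bad k n)) \<le> real (grid k) * c ^ n" using c(3) by auto
      show "summable (\<lambda>N. real (grid k) * c ^ N)" using c by (intro summable_mult summable_geometric) auto
    qed
  qed (auto simp: W.emeasure_eq_measure)
  then show ?thesis by eventually_elim (auto elim: eventually_mono)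
qed

section \<open>The common rate and the lower bound for all projections\<close>

definition C4 :: real where "C4 = C3 + 1"

lemma C4_nonneg: "C4 \<ge> 0"
  unfolding C4_def C3_def using C2_nonneg C0_ge by (simp add: add_nonneg_nonneg)

text \<open>The 1 by which \<open>C4\<close> exceeds \<open>C3\<close> is the margin that makes tail
  probabilities decay. After subtraction of \<open>C4\<close>, each single k gives a lower bound for
  the dimension, while \<open>dim_rate_upper\<close> returns the entropy bound with a loss of only
  \<open>C4\<close>, negligible against k.\<close>

definition dim_rate :: real where "dim_rate = (SUP k\<in>{1..}. (mean_entropy k - C4) / (real k * ell))"

lemma dim_rate_bdd: "bdd_above ((\<lambda>k. (mean_entropy k - C4) / (real k * ell)) ` {1..})"
proof (rule bdd_aboveI2)
  fix k :: nat assume k: "k \<in> {1..}"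
  have "mean_entropy k - C4 \<le> real k * ln (real m)" using mean_entropy_le[of k] C4_nonneg k by simp
  then have "(mean_entropy k - C4) / (real k * ell) \<le> real k * ln (real m) / (real k * ell)"
    using ell_pos by (intro divide_right_mono) auto
  also have "\<dots> = ln (real m) / ell" using k by simp
  finally show "(mean_entropy k - C4) / (real k * ell) \<le> ln (real m) / ell" .
qed

lemma dim_rate_upper: "k \<ge> 1 \<Longrightarrow> mean_entropy k \<le> real k * ell * dim_rate + C4"
proof -
  assume k: "k \<ge> 1"
  have "(mean_entropy k - C4) / (real k * ell) \<le> dim_rate" unfolding dim_rate_def using k by (intro cSUP_upper dim_rate_bdd) auto
  then show ?thesis using k ell_pos by (simp add: field_simps)
qed

lemma dim_rate_approx: "e > 0 \<Longrightarrow> \<exists>k\<ge>1. real k * ell * (dim_rate - e) < mean_entropy k - C4"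
proof -
  assume e: "e > 0"
  have "\<exists>k\<in>{1..}. dim_rate - e < (mean_entropy k - C4) / (real k * ell)"
    using e dim_rate_bdd unfolding dim_rate_def by (subst less_cSUP_iff[symmetric]) auto
  then obtain k where k: "k \<ge> 1" "dim_rate - e < (mean_entropy k - C4) / (real k * ell)" by auto
  then have "real k * ell * (dim_rate - e) < mean_entropy k - C4" using ell_pos by (simp add: field_simps)
  then show ?thesis using k by blast
qed

text \<open>Each k gives its bound off one null set, and the supremum involves countably many k.
  \<open>proj_dim_lower\<close> is applied along the multiples of \<open>grid k * k\<close> with
  margin \<open>grid k\<close>, that is, 1 per block.\<close>

lemma AE_proj_dim_ge:
  "AE w in WM. \<forall>\<beta>. max 0 dim_rate \<le> hausdorff_dim_measure (distr (mu (pw w)) borel (proj_line \<beta>))"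
proof -
  have "AE w in WM. \<forall>k\<in>{1..}. eventually (\<lambda>N. w \<notin> Bad k N) sequentially"
    by (subst AE_ball_countable) (auto intro: AE_eventually_good)
  moreover have "AE w in WM. w \<in> space WM" by simp
  ultimately show ?thesis
  proof eventually_elim
    case (elim w)
    have p: "pvec m (pw w)" using elim by (intro pvec_pw)
    interpret nu: prob_space "nu m (pw w)" by (rule prob_space_nu[OF p])
    show ?case
    proof
      fix \<beta>
      let ?L = "distr (mu (pw w)) borel (proj_line \<beta>)"
      interpret mu: prob_space "mu (pw w)" by (rule nu.prob_space_distr[OF cod_measurable[OF p]])
      interpret L: prob_space ?L
        by (rule mu.prob_space_distr) (simp add: borel_measurable_continuous_onI[OF continuous_proj_line])
      have nn: "0 \<le> hausdorff_dim_measure ?L"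
        using L.emeasure_space_1 by (intro hausdorff_dim_measure_ge hausdorff_dim_nonneg) simp
      have "(mean_entropy k - C4) / (real k * ell) \<le> hausdorff_dim_measure ?L" if k: "k \<in> {1..}" for k
      proof (cases "mean_entropy k - C4 > 0")
        case False
        then have "(mean_entropy k - C4) / (real k * ell) \<le> 0" using k ell_pos by (intro divide_nonpos_pos) auto
        then show ?thesis using nn by simp
      next
        case True
        have q: "grid k > 0" using k by (intro grid_pos) simp
        have "real (grid k) * (mean_entropy k - C4) / (real (grid k * k) * ell) \<le> hausdorff_dim_measure ?L"
        proof (rule proj_dim_lower[OF p rexp_pos])
          show "grid k * k \<ge> 1" using q k by simp
          show "real (grid k) * (mean_entropy k - C4) > 0" using q True by simp
          show "real (grid k) > 0" using q by simp
          show "eventually (\<lambda>i. rsum (rexp k) (pw w) (grid k * k * i) \<beta> \<le> exp (- rexp k * (real i * (real (grid k) * (mean_entropy k - C4) + real (grid k))))) sequentially"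
            using elim(1)[rule_format, OF k]
          proof eventually_elim
            case (elim i)
            have "rsum (rexp k) (pw w) (grid k * i * k) \<beta> \<le> exp (- rexp k * (real (grid k * i) * (mean_entropy k - C3)))"
              using k \<open>w \<in> space WM\<close> elim by (intro not_Bad_rsum) auto
            then show ?case by (simp add: C4_def algebra_simps)
          qed
        qed
        moreover have "real (grid k) * (mean_entropy k - C4) / (real (grid k * k) * ell) = (mean_entropy k - C4) / (real k * ell)"
          using q by simp
        ultimately show ?thesis by simp
      qed
      then have "dim_rate \<le> hausdorff_dim_measure ?L" unfolding dim_rate_def by (intro cSUP_least) auto
      then show "max 0 dim_rate \<le> hausdorff_dim_measure ?L" using nn by simp
    qed
  qed
qed

end

section \<open>Typical information of projections\<close>

context similarity_ifs
begin

text \<open>Its mean under the word weights is the Shannon entropy of the projected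
  partition.\<close>

definition info :: "(nat \<Rightarrow> nat \<Rightarrow> real) \<Rightarrow> nat \<Rightarrow> real \<Rightarrow> nat list \<Rightarrow> real" where
  "info p n \<beta> u = - ln (mass (weight p) (words m n) (dcell n \<beta>) (dcell n \<beta> u))"

definition high :: "(nat \<Rightarrow> nat \<Rightarrow> real) \<Rightarrow> nat \<Rightarrow> real \<Rightarrow> real \<Rightarrow> real" where
  "high p n \<beta> s = (\<Sum>u\<in>words m n. if info p n \<beta> u > s then weight p u else 0)"

lemma mass_ge_weight: "pvec m p \<Longrightarrow> u \<in> words m n \<Longrightarrow> weight p u \<le> mass (weight p) (words m n) f (f u)"
  unfolding mass_def by (intro member_le_sum) (auto intro: weight_words_nonneg)

lemma mass_words_le_1: "pvec m p \<Longrightarrow> mass (weight p) (words m n) f c \<le> 1"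
  using mass_le_total[of "words m n" "weight p" f c] by (simp add: weight_words_nonneg sum_weight)

lemma mass_words_nonneg: "pvec m p \<Longrightarrow> 0 \<le> mass (weight p) (words m n) f c"
  by (intro mass_nonneg weight_words_nonneg)

text \<open>A cell of mass 0 has information 0, by the convention \<open>ln 0 = 0\<close>.\<close>

lemma info_nonneg: "pvec m p \<Longrightarrow> 0 \<le> info p n \<beta> u"
  unfolding info_def using mass_words_le_1[of p n] mass_words_nonneg[of p n]
  by (metis less_eq_real_def ln_0 ln_le_zero_iff neg_0_le_iff_le)

lemma high_nonneg: "pvec m p \<Longrightarrow> 0 \<le> high p n \<beta> s"
  unfolding high_def by (intro sum_nonneg) (auto intro: weight_words_nonneg)

lemma high_le_1: "pvec m p \<Longrightarrow> high p n \<beta> s \<le> 1"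
proof -
  assume p: "pvec m p"
  have "high p n \<beta> s \<le> (\<Sum>u\<in>words m n. weight p u)"
    unfolding high_def using p by (intro sum_mono) (auto intro: weight_words_nonneg)
  then show ?thesis using p by (simp add: sum_weight)
qed

lemma mass_le_near_mass: "pvec m p \<Longrightarrow> mass (weight p) (words m n) (dcell n \<beta>) (dcell n \<beta> u) \<le> near_mass p n \<beta> u"
proof -
  assume p: "pvec m p"
  have "\<bar>dir \<beta> (pos v) - dir \<beta> (pos u)\<bar> \<le> (1 + 2 * R) * r ^ n" if "dcell n \<beta> v = dcell n \<beta> u" for v
  proof -
    have "\<bar>dir \<beta> (pos v) / r ^ n - dir \<beta> (pos u) / r ^ n\<bar> \<le> 1"
      using that unfolding dcell_def cell_def by linarith
    then have "\<bar>(dir \<beta> (pos v) - dir \<beta> (pos u)) / r ^ n\<bar> \<le> 1" by (simp add: diff_divide_distrib)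
    then have "\<bar>dir \<beta> (pos v) - dir \<beta> (pos u)\<bar> \<le> 1 * r ^ n" using rn[of n] by (simp add: abs_divide)
    also have "\<dots> \<le> (1 + 2 * R) * r ^ n" using rn[of n] R_nonneg by (intro mult_right_mono) auto
    finally show ?thesis .
  qed
  then show ?thesis unfolding mass_def near_mass_def using p
    by (intro sum_mono2) (auto intro: weight_words_nonneg)
qed

text \<open>Low information means a large cell mass, which \<open>near_mass\<close> dominates, so
  Markov's inequality for its t-th moment applies. Words of weight 0 are set apart because their
  cells may be null.\<close>

lemma low_info_le:
  assumes p: "pvec m p" and t: "t \<ge> 0"
  shows "(\<Sum>u\<in>words m n. if info p n \<beta> u < c then weight p u else 0) \<le> C1 powr t * C1 * rsum t p n \<beta> * exp (t * c)"
proof -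
  have "(\<Sum>u\<in>words m n. if info p n \<beta> u < c then weight p u else 0)
     \<le> (\<Sum>u\<in>words m n. if near_mass p n \<beta> u > exp (- c) then weight p u else 0)"
  proof (rule sum_mono)
    fix u assume u: "u \<in> words m n"
    let ?q = "mass (weight p) (words m n) (dcell n \<beta>) (dcell n \<beta> u)"
    have w0: "weight p u \<ge> 0" using p u by (rule weight_words_nonneg)
    show "(if info p n \<beta> u < c then weight p u else 0) \<le> (if near_mass p n \<beta> u > exp (- c) then weight p u else 0)"
    proof (cases "info p n \<beta> u < c \<and> weight p u > 0")
      case True
      then have q: "?q > 0" using mass_ge_weight[OF p u, of "dcell n \<beta>"] by linarith
      have "- c < ln ?q" using True by (simp add: info_def)
      then have "exp (- c) < exp (ln ?q)" by simp
      then have "exp (- c) < ?q" using q by simp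
      then have "exp (- c) < near_mass p n \<beta> u" using mass_le_near_mass[OF p, of n \<beta> u] by linarith
      then show ?thesis using w0 by simp
    qed (use w0 in auto)
  qed
  also have "\<dots> = (\<Sum>u | u \<in> words m n \<and> near_mass p n \<beta> u > exp (- c). weight p u)"
    by (simp add: sum.inter_filter)
  also have "\<dots> = measure (nu m p) {\<omega>\<in>space (nu m p). near_mass p n \<beta> (pre n \<omega>) > exp (- c)}"
    by (rule nu_pre(2)[OF p, symmetric])
  also have "\<dots> \<le> C1 powr t * C1 * rsum t p n \<beta> * exp (t * c)" by (rule near_mass_tail[OF p t])
  finally show ?thesis .
qed

text \<open>Markov's inequality for \<open>info - c\<close>, corrected for the negative part: where
  \<open>info\<close> is below c the deficit is at most \<open>max 0 c\<close>, as information is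
  nonnegative.\<close>

lemma high_le:
  assumes p: "pvec m p" and c: "c \<le> s"
  shows "(s - c) * high p n \<beta> s \<le> renyi p n \<beta> + 1 - c + max 0 c * (\<Sum>u\<in>words m n. if info p n \<beta> u < c then weight p u else 0)"
proof -
  have "(s - c) * high p n \<beta> s = (\<Sum>u\<in>words m n. weight p u * ((s - c) * (if info p n \<beta> u > s then 1 else 0)))"
    unfolding high_def sum_distrib_left by (intro sum.cong) auto
  also have "\<dots> \<le> (\<Sum>u\<in>words m n. weight p u * (info p n \<beta> u - c + max 0 c * (if info p n \<beta> u < c then 1 else 0)))"
  proof (intro sum_mono mult_left_mono)
    fix u
    show "(s - c) * (if info p n \<beta> u > s then 1 else 0) \<le> info p n \<beta> u - c + max 0 c * (if info p n \<beta> u < c then 1 else 0)"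
      using info_nonneg[OF p, of n \<beta> u] c by auto
  qed (use p in \<open>auto intro: weight_words_nonneg\<close>)
  also have "\<dots> = (\<Sum>u\<in>words m n. weight p u * info p n \<beta> u) - c * (\<Sum>u\<in>words m n. weight p u)
      + max 0 c * (\<Sum>u\<in>words m n. if info p n \<beta> u < c then weight p u else 0)"
    unfolding sum_distrib_left sum.distrib[symmetric] sum_subtractf[symmetric]
    by (intro sum.cong) (auto simp: algebra_simps)
  also have "(\<Sum>u\<in>words m n. weight p u * info p n \<beta> u) \<le> renyi p n \<beta> + 1"
    unfolding info_def by (rule entropy_le_renyi[OF p])
  finally show ?thesis using p by (simp add: sum_weight)
qed

end

section \<open>Information averaged over weights and directions\<close>

context random_ifs
begin

definition mean_high :: "nat \<Rightarrow> real \<Rightarrow> (nat \<Rightarrow> nat \<Rightarrow> real) \<Rightarrow> real" where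
  "mean_high n s p = (\<Sum>i<grid n. high p n (2 * pi * real i / real (grid n)) (real n * ell * s)) / real (grid n)"

lemma high_measurable [measurable]: "(\<lambda>w. high (pw w) n \<beta> s) \<in> borel_measurable WM"
proof -
  have W: "(\<lambda>w. weight (pw w) l) \<in> borel_measurable WM" if "l \<in> words m n" for l
    using weight_measurable[OF that, of 0 UNIV] by (simp add: nshift_def WM_def)
  have M: "(\<lambda>w. mass (weight (pw w)) (words m n) f c) \<in> borel_measurable WM" for f :: "nat list \<Rightarrow> int" and c
    using mass_measurable[of 0 n UNIV f c] by (simp add: nshift_def WM_def)
  have I: "(\<lambda>w. info (pw w) n \<beta> u) \<in> borel_measurable WM" for u
    unfolding info_def using M by measurable
  show ?thesis unfolding high_def
    by (intro borel_measurable_sum measurable_If W borel_measurable_const) (use I in measurable)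
qed

lemma mean_high_measurable [measurable]: "(\<lambda>w. mean_high n s (pw w)) \<in> borel_measurable WM"
  unfolding mean_high_def by measurable

lemma mean_high_bounds:
  assumes n: "n \<ge> 1" and p: "pvec m p"
  shows "0 \<le> mean_high n s p" "mean_high n s p \<le> 1"
proof -
  show "0 \<le> mean_high n s p" unfolding mean_high_def using p by (intro divide_nonneg_nonneg sum_nonneg high_nonneg) auto
  have "(\<Sum>i<grid n. high p n (2 * pi * real i / real (grid n)) (real n * ell * s)) \<le> (\<Sum>i<grid n. 1)"
    using p by (intro sum_mono high_le_1)
  then show "mean_high n s p \<le> 1" unfolding mean_high_def using grid_pos[OF n] by simp
qed

lemma integrable_mean_high: "n \<ge> 1 \<Longrightarrow> integrable WM (\<lambda>w. mean_high n s (pw w))"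
proof (rule W.integrable_const_bound[where B = 1])
  assume "n \<ge> 1"
  then show "AE w in WM. norm (mean_high n s (pw w)) \<le> 1"
    using mean_high_bounds[OF _ pvec_pw] by (intro AE_I2) auto
qed measurable

text \<open>The mean information of n digits is at most \<open>n * ell * dim_rate + C4 + 1\<close>.
  If c lies just below \<open>n * ell * dim_rate\<close> and the information is rarely below c,
  little weight can lie above \<open>n * ell * s\<close>. Two exponents are at work:
  \<open>rexp n\<close>, inside \<open>renyi\<close>, for the mean, and \<open>rexp k\<close> with k
  fixed for the lower tail; the latter is why n is a multiple of \<open>grid k * k\<close>.\<close>

lemma expectation_bb_le:
  assumes k: "k \<ge> 1" and e: "e > 0" "real k * ell * (dim_rate - e) < mean_entropy k - C4" and s: "dim_rate < s" and N: "N \<ge> 1"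
  defines "n \<equiv> grid k * N * k"
  shows "real n * ell * (s - dim_rate) * W.expectation (\<lambda>w. mean_high n s (pw w))
    \<le> real n * ell * e + C4 + 1 + real n * ell * \<bar>dim_rate\<bar> * (C1 powr rexp k * C1 * exp (- rexp k * real (grid k * N)) + W.prob (Bad k N))"
proof -
  have n: "n \<ge> 1" unfolding n_def using grid_pos[OF k] k N by simp
  have q: "grid n > 0" using n by (rule grid_pos)
  let ?J = "grid k * N"
  let ?\<beta> = "\<lambda>i. 2 * pi * real i / real (grid n)"
  define c where "c = real n * ell * (dim_rate - e)"
  define \<eta> where "\<eta> = C1 powr rexp k * C1 * exp (- rexp k * real ?J)"
  have nl: "real n * ell > 0" using n ell_pos by simp
  have cs: "c \<le> real n * ell * s" unfolding c_def using e s nl by (intro mult_left_mono) auto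
  have scd: "real n * ell * (s - dim_rate) \<le> real n * ell * s - c" unfolding c_def using e nl by (simp add: algebra_simps)
  have cmax: "max 0 c \<le> real n * ell * \<bar>dim_rate\<bar>"
  proof -
    have "dim_rate - e \<le> \<bar>dim_rate\<bar>" using e by simp
    then have "c \<le> real n * ell * \<bar>dim_rate\<bar>" unfolding c_def using nl by (intro mult_left_mono) auto
    then show ?thesis using nl by simp
  qed
  have cJ: "c \<le> real ?J * (mean_entropy k - C4)"
  proof -
    have "c = real ?J * (real k * ell * (dim_rate - e))" unfolding c_def n_def by simp
    also have "\<dots> \<le> real ?J * (mean_entropy k - C4)" using e by (intro mult_left_mono) auto
    finally show ?thesis .
  qed
  \<comment> \<open>On \<open>Bad k N\<close> the trivial bound 1 is used. Elsewhere the gap of 1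
    per block between \<open>C4\<close> and \<open>C3\<close> leaves the decaying factor in
    \<eta>.\<close>
  have low: "(\<Sum>u\<in>words m n. if info (pw w) n \<beta> u < c then weight (pw w) u else 0) \<le> \<eta> + indicator (Bad k N) w"
    if w: "w \<in> space WM" for w \<beta>
  proof (cases "w \<in> Bad k N")
    case True
    have "(\<Sum>u\<in>words m n. if info (pw w) n \<beta> u < c then weight (pw w) u else 0) \<le> (\<Sum>u\<in>words m n. weight (pw w) u)"
      using pvec_pw[OF w] by (intro sum_mono) (auto intro: weight_words_nonneg)
    also have "\<dots> = 1" using pvec_pw[OF w] by (rule sum_weight)
    also have "1 \<le> \<eta> + indicator (Bad k N) w" using True C1_pos by (simp add: \<eta>_def)
    finally show ?thesis .
  next
    case False
    have "(\<Sum>u\<in>words m n. if info (pw w) n \<beta> u < c then weight (pw w) u else 0)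
      \<le> C1 powr rexp k * C1 * rsum (rexp k) (pw w) n \<beta> * exp (rexp k * c)"
      using rexp_pos[of k] by (intro low_info_le pvec_pw[OF w]) auto
    also have "\<dots> \<le> C1 powr rexp k * C1 * exp (- rexp k * (real ?J * (mean_entropy k - C3))) * exp (rexp k * (real ?J * (mean_entropy k - C4)))"
      using not_Bad_rsum[OF k w False, of \<beta>] C1_pos cJ rexp_pos[of k] rsum_pos[OF pvec_pw[OF w], of "rexp k" n \<beta>]
      unfolding n_def[symmetric]
      by (intro mult_mono) auto
    also have "\<dots> = C1 powr rexp k * C1 * (exp (- rexp k * (real ?J * (mean_entropy k - C3))) * exp (rexp k * (real ?J * (mean_entropy k - C4))))" by simp
    also have "exp (- rexp k * (real ?J * (mean_entropy k - C3))) * exp (rexp k * (real ?J * (mean_entropy k - C4))) = exp (- rexp k * real ?J)"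
      by (simp add: exp_add[symmetric] C4_def algebra_simps)
    finally show ?thesis using False by (simp add: \<eta>_def)
  qed
  have pt: "real n * ell * (s - dim_rate) * mean_high n s (pw w)
     \<le> (\<Sum>i<grid n. renyi (pw w) n (?\<beta> i)) / real (grid n) + 1 - c + real n * ell * \<bar>dim_rate\<bar> * (\<eta> + indicator (Bad k N) w)"
    if w: "w \<in> space WM" for w
  proof -
    have p: "pvec m (pw w)" using w by (rule pvec_pw)
    have one: "real n * ell * (s - dim_rate) * high (pw w) n (?\<beta> i) (real n * ell * s)
      \<le> renyi (pw w) n (?\<beta> i) + (1 - c + real n * ell * \<bar>dim_rate\<bar> * (\<eta> + indicator (Bad k N) w))" for i
    proof -
      have "real n * ell * (s - dim_rate) * high (pw w) n (?\<beta> i) (real n * ell * s)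
        \<le> (real n * ell * s - c) * high (pw w) n (?\<beta> i) (real n * ell * s)"
        using scd high_nonneg[OF p] by (intro mult_right_mono) auto
      also have "\<dots> \<le> renyi (pw w) n (?\<beta> i) + 1 - c + max 0 c * (\<Sum>u\<in>words m n. if info (pw w) n (?\<beta> i) u < c then weight (pw w) u else 0)"
        by (rule high_le[OF p cs])
      also have "max 0 c * (\<Sum>u\<in>words m n. if info (pw w) n (?\<beta> i) u < c then weight (pw w) u else 0)
         \<le> real n * ell * \<bar>dim_rate\<bar> * (\<eta> + indicator (Bad k N) w)"
        using cmax low[OF w] nl p by (intro mult_mono sum_nonneg) (auto intro: weight_words_nonneg)
      finally show ?thesis by simp
    qed
    have "real n * ell * (s - dim_rate) * mean_high n s (pw w) = (\<Sum>i<grid n. real n * ell * (s - dim_rate) * high (pw w) n (?\<beta> i) (real n * ell * s)) / real (grid n)"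
      unfolding mean_high_def by (simp add: sum_distrib_left)
    also have "\<dots> \<le> (\<Sum>i<grid n. renyi (pw w) n (?\<beta> i) + (1 - c + real n * ell * \<bar>dim_rate\<bar> * (\<eta> + indicator (Bad k N) w))) / real (grid n)"
      by (intro divide_right_mono sum_mono one) simp
    also have "\<dots> = (\<Sum>i<grid n. renyi (pw w) n (?\<beta> i)) / real (grid n) + (1 - c + real n * ell * \<bar>dim_rate\<bar> * (\<eta> + indicator (Bad k N) w))"
      using q by (simp add: sum.distrib add_divide_distrib)
    finally show ?thesis by simp
  qed
  have intA: "integrable WM (\<lambda>w. (\<Sum>i<grid n. renyi (pw w) n (?\<beta> i)) / real (grid n))"
    by (intro integrable_divide Bochner_Integration.integrable_sum integrable_renyi)
  have intB: "integrable WM (\<lambda>w. real n * ell * \<bar>dim_rate\<bar> * (\<eta> + indicator (Bad k N) w))"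
    by (intro integrable_mult_right Bochner_Integration.integrable_add W.integrable_const) (auto simp: W.emeasure_eq_measure)
  have EA: "W.expectation (\<lambda>w. (\<Sum>i<grid n. renyi (pw w) n (?\<beta> i)) / real (grid n)) = mean_entropy n"
    unfolding mean_entropy_def expected_entropy_def by (simp add: Bochner_Integration.integral_sum integrable_renyi)
  have EB: "W.expectation (\<lambda>w. real n * ell * \<bar>dim_rate\<bar> * (\<eta> + indicator (Bad k N) w)) = real n * ell * \<bar>dim_rate\<bar> * (\<eta> + W.prob (Bad k N))"
  proof -
    have "W.expectation (\<lambda>w. \<eta> + indicator (Bad k N) w) = \<eta> + W.prob (Bad k N)"
      by (subst Bochner_Integration.integral_add) (auto simp: W.prob_space W.emeasure_eq_measure)
    then show ?thesis by simp
  qed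
  have "real n * ell * (s - dim_rate) * W.expectation (\<lambda>w. mean_high n s (pw w)) = W.expectation (\<lambda>w. real n * ell * (s - dim_rate) * mean_high n s (pw w))"
    by simp
  also have "\<dots> \<le> W.expectation (\<lambda>w. (\<Sum>i<grid n. renyi (pw w) n (?\<beta> i)) / real (grid n) + (1 - c) + real n * ell * \<bar>dim_rate\<bar> * (\<eta> + indicator (Bad k N) w))"
  proof (rule integral_mono)
    show "integrable WM (\<lambda>w. real n * ell * (s - dim_rate) * mean_high n s (pw w))"
      using integrable_mean_high[OF n] by (intro integrable_mult_right) auto
    show "integrable WM (\<lambda>w. (\<Sum>i<grid n. renyi (pw w) n (?\<beta> i)) / real (grid n) + (1 - c) + real n * ell * \<bar>dim_rate\<bar> * (\<eta> + indicator (Bad k N) w))"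
      by (intro Bochner_Integration.integrable_add intA intB W.integrable_const)
    show "real n * ell * (s - dim_rate) * mean_high n s (pw w)
      \<le> (\<Sum>i<grid n. renyi (pw w) n (?\<beta> i)) / real (grid n) + (1 - c) + real n * ell * \<bar>dim_rate\<bar> * (\<eta> + indicator (Bad k N) w)"
      if "w \<in> space WM" for w
      using pt[OF that] by linarith
  qed
  also have "\<dots> = mean_entropy n + (1 - c) + real n * ell * \<bar>dim_rate\<bar> * (\<eta> + W.prob (Bad k N))"
  proof -
    have "W.expectation (\<lambda>w. (\<Sum>i<grid n. renyi (pw w) n (?\<beta> i)) / real (grid n) + (1 - c)) = mean_entropy n + (1 - c)"
      by (subst Bochner_Integration.integral_add[OF intA W.integrable_const]) (simp only: EA, simp add: W.prob_space)
    then show ?thesis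
      using Bochner_Integration.integral_add[OF Bochner_Integration.integrable_add[OF intA W.integrable_const[of "1 - c"]] intB]
      by (simp only: EB)
  qed
  \<comment> \<open>The rate bounds the mean at length n, so the leading terms of the mean and of c
    cancel up to \<open>n * ell * e\<close>.\<close>
  also have "\<dots> \<le> real n * ell * dim_rate + C4 + (1 - c) + real n * ell * \<bar>dim_rate\<bar> * (\<eta> + W.prob (Bad k N))"
    using dim_rate_upper[OF n] by simp
  also have "\<dots> = real n * ell * e + C4 + 1 + real n * ell * \<bar>dim_rate\<bar> * (\<eta> + W.prob (Bad k N))"
    unfolding c_def by (simp add: algebra_simps)
  finally show ?thesis unfolding \<eta>_def .
qed

lemma expectation_mean_high_small:
  assumes s: "dim_rate < s" and \<epsilon>: "\<epsilon> > 0"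
  shows "\<exists>n\<ge>n0. n \<ge> 1 \<and> W.expectation (\<lambda>w. mean_high n s (pw w)) \<le> \<epsilon>"
proof -
  \<comment> \<open>Half of \<epsilon> pays for the leading error e / (s - \<open>dim_rate\<close>),
    the other half for the terms of \<open>g\<close> that vanish as N grows.\<close>
  define e where "e = \<epsilon> * (s - dim_rate) / 2"
  have e: "e > 0" unfolding e_def using s \<epsilon> by simp
  obtain k where k: "k \<ge> 1" "real k * ell * (dim_rate - e) < mean_entropy k - C4" using dim_rate_approx[OF e] by blast
  have q: "grid k > 0" using k by (intro grid_pos)
  obtain c where c: "0 < c" "c < 1" "\<And>N. N \<ge> 1 \<Longrightarrow> W.prob (Bad k N) \<le> real (grid k) * c ^ N"
    by (rule Bad_prob[OF k(1)]) blast
  let ?n = "\<lambda>N. grid k * N * k"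
  define d where "d = exp (- rexp k * real (grid k))"
  have d: "0 < d" "d < 1" unfolding d_def using rexp_pos[of k] q by auto
  define g where "g N = e + (C4 + 1) / (real (grid k * k) * ell) * (1 / real N) + \<bar>dim_rate\<bar> * (C1 powr rexp k * C1 * d ^ N + real (grid k) * c ^ N)" for N
  have "g \<longlonglongrightarrow> e + (C4 + 1) / (real (grid k * k) * ell) * 0 + \<bar>dim_rate\<bar> * (C1 powr rexp k * C1 * 0 + real (grid k) * 0)"
    unfolding g_def using c d by (intro tendsto_intros lim_1_over_n LIMSEQ_power_zero) auto
  moreover have "e + (C4 + 1) / (real (grid k * k) * ell) * 0 + \<bar>dim_rate\<bar> * (C1 powr rexp k * C1 * 0 + real (grid k) * 0) < 2 * e" using e by simp
  ultimately have "eventually (\<lambda>N. g N < 2 * e) sequentially" by (rule order_tendstoD)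
  then obtain N0 where N0: "\<And>N. N \<ge> N0 \<Longrightarrow> g N < 2 * e" by (auto simp: eventually_sequentially)
  define N where "N = max N0 (max n0 1)"
  have N: "N \<ge> N0" "N \<ge> n0" "N \<ge> 1" unfolding N_def by auto
  let ?E = "W.expectation (\<lambda>w. mean_high (?n N) s (pw w))"
  have nN: "?n N \<ge> N" "?n N \<ge> 1" using q k N by (auto simp: Suc_le_eq)
  have nl: "real (?n N) * ell > 0" using nN ell_pos by simp
  have "real (?n N) * ell * (s - dim_rate) * ?E \<le> real (?n N) * ell * e + C4 + 1 + real (?n N) * ell * \<bar>dim_rate\<bar> * (C1 powr rexp k * C1 * exp (- rexp k * real (grid k * N)) + W.prob (Bad k N))"
    by (rule expectation_bb_le[OF k(1) e k(2) s N(3)])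
  also have "\<dots> \<le> real (?n N) * ell * e + C4 + 1 + real (?n N) * ell * \<bar>dim_rate\<bar> * (C1 powr rexp k * C1 * d ^ N + real (grid k) * c ^ N)"
  proof -
    have "exp (- rexp k * real (grid k * N)) = d ^ N"
      unfolding d_def exp_of_nat_mult[symmetric] by (simp add: algebra_simps)
    then show ?thesis using c(3)[OF N(3)] nl by (intro add_left_mono mult_left_mono) auto
  qed
  also have "\<dots> = real (?n N) * ell * g N"
  proof -
    have "real (?n N) * ell * ((C4 + 1) / (real (grid k * k) * ell) * (1 / real N)) = C4 + 1"
      using q k N ell_pos by (simp add: field_simps)
    then show ?thesis unfolding g_def by (simp add: distrib_left algebra_simps)
  qed
  finally have "real (?n N) * ell * ((s - dim_rate) * ?E) \<le> real (?n N) * ell * g N" by (simp add: mult.assoc)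
  then have "(s - dim_rate) * ?E \<le> g N" using nl by (simp only: mult_le_cancel_left_pos)
  also have "\<dots> \<le> 2 * e" using N0[OF N(1)] by simp
  also have "\<dots> = (s - dim_rate) * \<epsilon>" unfolding e_def by simp
  finally have "?E \<le> \<epsilon>" using s by simp
  then show ?thesis using order_trans[OF N(2) nN(1)] nN(2) by blast
qed

text \<open>Small expectations at arbitrarily late n suffice, without any summability: the event
  that \<open>mean_high\<close> exceeds 1/2 from n0 on is contained in the event for each single n,
  so its probability is below every \<epsilon>.\<close>

lemma AE_mean_high:
  assumes s: "dim_rate < s"
  shows "AE w in WM. \<forall>n0. \<exists>n\<ge>n0. n \<ge> 1 \<and> mean_high n s (pw w) \<le> 1 / 2"
proof (subst AE_all_countable, rule allI)
  fix n0
  let ?F = "{w\<in>space WM. \<forall>n\<in>{n0..}. n \<ge> 1 \<longrightarrow> mean_high n s (pw w) > 1 / 2}"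
  have F: "?F \<in> sets WM" by measurable
  have "W.prob ?F \<le> 0 + \<epsilon>" if \<epsilon>: "\<epsilon> > 0" for \<epsilon>
  proof -
    obtain n where n: "n \<ge> n0" "n \<ge> 1" "W.expectation (\<lambda>w. mean_high n s (pw w)) \<le> \<epsilon> / 2"
      using expectation_mean_high_small[OF s, of "\<epsilon>/2" n0] \<epsilon> by auto
    have "W.prob ?F \<le> W.prob {w\<in>space WM. mean_high n s (pw w) \<ge> 1 / 2}"
      using n by (intro W.finite_measure_mono) (auto intro: less_imp_le)
    also have "\<dots> \<le> W.expectation (\<lambda>w. mean_high n s (pw w)) / (1 / 2)"
      using n mean_high_bounds(1)[OF n(2) pvec_pw] by (intro integral_Markov_inequality_measure[where A="space WM"] integrable_mean_high) auto
    also have "\<dots> \<le> \<epsilon>" using n by simp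
    finally show ?thesis by simp
  qed
  then have "W.prob ?F \<le> 0" by (rule field_le_epsilon)
  then have "?F \<in> null_sets WM" using F by (auto simp: null_sets_def W.emeasure_eq_measure measure_le_0_iff)
  then have "AE w in WM. w \<notin> ?F" by (rule AE_not_in)
  moreover have "AE w in WM. w \<in> space WM" by simp
  ultimately show "AE w in WM. \<exists>n\<ge>n0. n \<ge> 1 \<and> mean_high n s (pw w) \<le> 1 / 2"
    by eventually_elim (auto simp: not_less)
qed

end

section \<open>Short projections and small balls\<close>

text \<open>A weak form of Jordan's inequality, from \<open>sin x >= x * cos x\<close> at x = y / 2
  and the double angle formulas.\<close>

lemma abs_sin_ge_half:
  fixes y :: real
  assumes "\<bar>y\<bar> \<le> pi / 2"
  shows "\<bar>y\<bar> / 2 \<le> \<bar>sin y\<bar>"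
proof -
  have pos: "y / 2 \<le> sin y" if y: "0 \<le> y" "y \<le> pi / 2" for y :: real
  proof -
    have "0 - 0 * cos 0 \<le> sin (y/2) - y/2 * cos (y/2)"
    proof -
      define g where "g x = sin x - x * cos x" for x :: real
      have "g 0 \<le> g (y / 2)"
      proof (rule DERIV_nonneg_imp_nondecreasing[where f = g and a = 0 and b = "y / 2"])
        fix x assume x: "0 \<le> x" "x \<le> y / 2"
        have "(g has_real_derivative x * sin x) (at x)"
          unfolding g_def by (auto intro!: derivative_eq_intros)
        moreover have "x * sin x \<ge> 0" using x y by (intro mult_nonneg_nonneg sin_ge_zero) auto
        ultimately show "\<exists>z. (g has_real_derivative z) (at x) \<and> 0 \<le> z" by blast
      qed (use y in simp)
      then show ?thesis by (simp add: g_def)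
    qed
    then have s: "y/2 * cos (y/2) \<le> sin (y/2)" by simp
    have c: "cos (y/2) \<ge> 0" using y by (intro cos_ge_zero) auto
    have "y / 2 \<le> y / 2 * (1 + cos y)" using y cos_ge_zero[of y] by (simp add: mult_le_cancel_left1)
    also have "\<dots> = y / 2 * (2 * (cos (y/2))\<^sup>2)" using cos_double_cos[of "y/2"] by simp
    also have "\<dots> = 2 * (y/2 * cos (y/2)) * cos (y/2)" by (simp add: power2_eq_square)
    also have "\<dots> \<le> 2 * sin (y/2) * cos (y/2)" using s c by (intro mult_right_mono) auto
    also have "\<dots> = sin y" using sin_double[of "y/2"] by simp
    finally show ?thesis .
  qed
  show ?thesis
  proof (cases "y \<ge> 0")
    case True then show ?thesis using pos[of y] assms by simp
  next
    case False then show ?thesis using pos[of "-y"] assms by simp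
  qed
qed

text \<open>The set of directions in which \<open>v\<close> has a short projection consists of arcs of length
  comparable to \<open>\<delta> / norm v\<close>.\<close>

lemma card_short_projections:
  assumes v: "v \<noteq> 0" and Q: "Q > 0" and \<delta>: "\<delta> \<ge> 0"
  shows "real (card {i. i < Q \<and> \<bar>dir (2 * pi * real i / real Q) v\<bar> \<le> \<delta>}) \<le> 9 * (real Q * (\<delta> / norm v) + 1)"
proof -
  define \<phi> where "\<phi> = Arg v"
  define \<epsilon> where "\<epsilon> = \<delta> / norm v"
  have nv: "norm v > 0" using v by simp
  have \<epsilon>0: "\<epsilon> \<ge> 0" unfolding \<epsilon>_def using \<delta> by simp
  have \<phi>: "- pi < \<phi>" "\<phi> \<le> pi" unfolding \<phi>_def using Arg_bounded by auto
  have dirv: "dir \<beta> v = norm v * cos (\<phi> - \<beta>)" for \<beta>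
  proof -
    have "v = complex_of_real (norm v) * cis \<phi>" unfolding \<phi>_def
      using v by (metis rcis_cmod_Arg rcis_def)
    then have "v * cis (- \<beta>) = complex_of_real (norm v) * cis (\<phi> - \<beta>)"
      by (metis cis_mult mult.assoc diff_conv_add_uminus)
    then show ?thesis unfolding dir_def by simp
  qed
  \<comment> \<open>Grid indices near the direction \<phi> - pi / 2 - l pi orthogonal to v, with
    distances measured in grid steps.\<close>
  define I where "I l = {i :: nat. \<bar>real i - (\<phi> - pi / 2 - of_int l * pi) * real Q / (2 * pi)\<bar> \<le> real Q * \<epsilon> / 2}" for l :: int
  have Icard: "finite (I l) \<and> real (card (I l)) \<le> real Q * \<epsilon> + 1" for l
  proof -
    define x where "x = (\<phi> - pi / 2 - of_int l * pi) * real Q / (2 * pi)"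
    have "x - real Q * \<epsilon> / 2 \<le> real_of_int z \<and> real_of_int z \<le> x + real Q * \<epsilon> / 2" if z: "z \<in> int ` I l" for z
    proof -
      obtain i where i: "z = int i" "\<bar>real i - x\<bar> \<le> real Q * \<epsilon> / 2" using z unfolding I_def x_def by blast
      then show ?thesis unfolding i(1) by (simp only: of_int_of_nat_eq abs_le_iff) linarith
    qed
    then have fi: "finite (int ` I l)" "real (card (int ` I l)) \<le> (x + real Q * \<epsilon> / 2) - (x - real Q * \<epsilon> / 2) + 1"
      using card_int_interval_le[of "int ` I l" "x - real Q * \<epsilon> / 2" "x + real Q * \<epsilon> / 2"] \<epsilon>0
      by simp_all
    moreover have "card (int ` I l) = card (I l)" by (intro card_image) (auto simp: inj_on_def)
    moreover have "finite (I l)" using fi(1) by (rule finite_imageD) (auto simp: inj_on_def)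
    ultimately show ?thesis by (simp add: mult.commute)
  qed
  have "{i. i < Q \<and> \<bar>dir (2 * pi * real i / real Q) v\<bar> \<le> \<delta>} \<subseteq> (\<Union>l\<in>{-4..4}. I l)"
  proof safe
    fix i assume i: "i < Q" "\<bar>dir (2 * pi * real i / real Q) v\<bar> \<le> \<delta>"
    define \<beta> where "\<beta> = 2 * pi * real i / real Q"
    have \<beta>: "0 \<le> \<beta>" "\<beta> \<le> 2 * pi" unfolding \<beta>_def using i by (auto simp: field_simps)
    have "norm v * \<bar>cos (\<phi> - \<beta>)\<bar> \<le> \<delta>" using i(2) nv unfolding \<beta>_def[symmetric] dirv by (simp add: abs_mult)
    then have ce: "\<bar>cos (\<phi> - \<beta>)\<bar> \<le> \<epsilon>" unfolding \<epsilon>_def using nv by (simp add: field_simps)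
    define x where "x = (\<phi> - \<beta> - pi / 2) / pi"
    define l where "l = round x"
    define y where "y = \<phi> - \<beta> - pi / 2 - of_int l * pi"
    have xl: "\<bar>x - of_int l\<bar> \<le> 1 / 2" unfolding l_def using of_int_round_abs_le[of x] by (simp add: abs_minus_commute)
    have "pi * x = \<phi> - \<beta> - pi / 2" unfolding x_def by simp
    then have yx: "y = pi * (x - of_int l)" unfolding y_def by (simp add: right_diff_distrib mult.commute)
    have ypi: "\<bar>y\<bar> \<le> pi / 2"
    proof -
      have "pi * \<bar>x - of_int l\<bar> \<le> pi * (1 / 2)" using xl by (intro mult_left_mono) auto
      then show ?thesis unfolding yx by (simp add: abs_mult)
    qed
    have "\<bar>cos (\<phi> - \<beta>)\<bar> = \<bar>sin y\<bar>"
    proof -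
      have "\<phi> - \<beta> = y + pi / 2 + of_int l * pi" unfolding y_def by simp
      then have "cos (\<phi> - \<beta>) = cos (y + pi / 2) * cos (of_int l * pi) - sin (y + pi / 2) * sin (of_int l * pi)"
        by (simp only: cos_add)
      moreover have "sin (of_int l * pi) = 0" by (simp add: sin_zero_iff_int2)
      moreover have "\<bar>cos (of_int l * pi)\<bar> = 1"
      proof -
        have "(cos (of_int l * pi))\<^sup>2 = 1" using sin_cos_squared_add[of "of_int l * pi"] \<open>sin (of_int l * pi) = 0\<close> by simp
        then show ?thesis by (auto simp: power2_eq_1_iff)
      qed
      moreover have "cos (y + pi / 2) = - sin y" by (simp add: cos_add)
      ultimately show ?thesis by (simp add: abs_mult)
    qed
    then have ye: "\<bar>y\<bar> \<le> 2 * \<epsilon>" using abs_sin_ge_half[OF ypi] ce by simp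
    have "\<bar>real i - (\<phi> - pi / 2 - of_int l * pi) * real Q / (2 * pi)\<bar> = \<bar>y\<bar> * real Q / (2 * pi)"
    proof -
      have "real i = \<beta> * real Q / (2 * pi)" unfolding \<beta>_def using Q by simp
      moreover define e where "e = \<phi> - pi / 2 - of_int l * pi"
      moreover have "y = e - \<beta>" by (simp add: y_def e_def)
      ultimately have "real i - e * real Q / (2 * pi) = - (y * real Q / (2 * pi))"
        by (simp only: left_diff_distrib diff_divide_distrib minus_diff_eq)
      then have "\<bar>real i - e * real Q / (2 * pi)\<bar> = \<bar>y\<bar> * real Q / (2 * pi)"
        by (simp add: abs_mult)
      then show ?thesis unfolding e_def .
    qed
    also have "\<dots> \<le> 2 * \<epsilon> * real Q / (2 * pi)" using ye by (intro divide_right_mono mult_right_mono) auto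
    also have "\<dots> \<le> real Q * \<epsilon> / 2"
    proof -
      have "\<epsilon> * real Q * 2 \<le> \<epsilon> * real Q * pi" using pi_gt3 \<epsilon>0 by (intro mult_left_mono) auto
      then show ?thesis by (simp add: field_simps)
    qed
    finally have "i \<in> I l" by (simp add: I_def)
    \<comment> \<open>The angle \<open>\<phi> - \<beta> - pi / 2\<close> lies between -4 pi and pi,
      so a window of nine values of l contains every case; this is the factor 9.\<close>
    moreover have "l \<in> {-4..4}"
    proof -
      have "- 4 * pi < \<phi> - \<beta> - pi / 2" "\<phi> - \<beta> - pi / 2 < 1 * pi" using \<phi> \<beta> pi_gt_zero by linarith+
      then have "-4 < x" "x < 1" unfolding x_def by (simp_all only: pos_less_divide_eq[OF pi_gt_zero] pos_divide_less_eq[OF pi_gt_zero])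
      then have "-5 < real_of_int l" "real_of_int l < 2" using xl by linarith+
      then show ?thesis by simp
    qed
    ultimately show "i \<in> (\<Union>l\<in>{-4..4}. I l)" by blast
  qed
  then have "card {i. i < Q \<and> \<bar>dir (2 * pi * real i / real Q) v\<bar> \<le> \<delta>} \<le> card (\<Union>l\<in>{-4..4}. I l)"
    using Icard by (intro card_mono) auto
  also have "\<dots> \<le> (\<Sum>l\<in>{-4..4}. card (I l))" by (rule card_UN_le) simp
  finally have "real (card {i. i < Q \<and> \<bar>dir (2 * pi * real i / real Q) v\<bar> \<le> \<delta>}) \<le> real (\<Sum>l\<in>{-4..4}. card (I l))"
    by (simp only: of_nat_le_iff)
  also have "\<dots> = (\<Sum>l\<in>{-4..4}. real (card (I l)))" by (rule of_nat_sum)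
  also have "\<dots> \<le> (\<Sum>l\<in>{-4..4::int}. real Q * \<epsilon> + 1)" using Icard by (intro sum_mono) auto
  also have "\<dots> = 9 * (real Q * \<epsilon> + 1)" by simp
  finally show ?thesis unfolding \<epsilon>_def .
qed

section \<open>Averaged masses of projected cells against masses of planar balls\<close>

context similarity_ifs
begin

text \<open>9 from \<open>card_short_projections\<close>, doubled because the grid error 1 / Q is at
  most the main term, times the factor in the radius of \<open>near_mass\<close>.\<close>

definition C5 :: real where "C5 = 18 * (1 + 2 * R)"

text \<open>The fraction of directions is of order \<open>r ^ n / norm v\<close>. Written as a sum
  over scales with indicators of the size of v, it becomes a combination of ball masses once it is
  summed over v. Only the last scale J whose disc still contains v is needed; the factor 1 / r pays
  for the gap to the next scale.\<close>

lemma short_projections_dyadic: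
  assumes v: "norm v \<le> 2 * R" and Q: "Q > 0" "1 / real Q \<le> r ^ n"
  shows "real (card {i. i < Q \<and> \<bar>dir (2 * pi * real i / real Q) v\<bar> \<le> (1 + 2 * R) * r ^ n}) / real Q
    \<le> C5 * (\<Sum>j\<le>n. r ^ (n - j) / r * (if norm v \<le> (1 + 2 * R) * r ^ j then 1 else 0))"
proof -
  let ?c = "real (card {i. i < Q \<and> \<bar>dir (2 * pi * real i / real Q) v\<bar> \<le> (1 + 2 * R) * r ^ n}) / real Q"
  let ?f = "\<lambda>j. r ^ (n - j) / r * (if norm v \<le> (1 + 2 * R) * r ^ j then 1 else 0)"
  have C5: "C5 \<ge> 1" unfolding C5_def using R_nonneg by simp
  have le1: "?c \<le> 1"
  proof -
    have "card {i. i < Q \<and> \<bar>dir (2 * pi * real i / real Q) v\<bar> \<le> (1 + 2 * R) * r ^ n} \<le> card {..<Q}"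
      by (intro card_mono) auto
    then show ?thesis using Q by simp
  qed
  have one: "?f J \<le> (\<Sum>j\<le>n. ?f j)" if "J \<le> n" for J
    using that r0 by (intro member_le_sum) auto
  show ?thesis
  proof (cases "norm v \<le> (1 + 2 * R) * r ^ n")
    case True
    have "1 \<le> ?f n" using True r0 r1 by simp
    also have "\<dots> \<le> (\<Sum>j\<le>n. ?f j)" by (rule one) simp
    finally have "1 * 1 \<le> C5 * (\<Sum>j\<le>n. ?f j)" using C5 by (intro mult_mono) auto
    then show ?thesis using le1 by simp
  next
    case False
    define P where "P j \<longleftrightarrow> \<not> norm v \<le> (1 + 2 * R) * r ^ j" for j
    have "\<not> P 0" unfolding P_def using v R_nonneg by simp
    define j where "j = (LEAST j. P j)"
    have Pj: "P j" unfolding j_def by (rule LeastI[of P n]) (use False in \<open>simp add: P_def\<close>)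
    have jn: "j \<le> n" unfolding j_def by (rule Least_le) (use False in \<open>simp add: P_def\<close>)
    have "j \<noteq> 0" using Pj \<open>\<not> P 0\<close> by metis
    then obtain J where J: "j = Suc J" by (cases j) auto
    have PJ: "\<not> P J" using not_less_Least[of J P] J by (simp add: j_def)
    have nv: "norm v > (1 + 2 * R) * r ^ Suc J" using Pj J by (simp add: P_def)
    moreover have "0 < (1 + 2 * R) * r ^ Suc J" using R_nonneg r0 by simp
    ultimately have v0: "norm v > 0" by linarith
    have "?c \<le> 9 * (real Q * ((1 + 2 * R) * r ^ n / norm v) + 1) / real Q"
      using v0 Q rn[of n] R_nonneg by (intro divide_right_mono card_short_projections) auto
    also have "\<dots> = 9 * ((1 + 2 * R) * r ^ n / norm v + 1 / real Q)" using Q by (simp add: field_simps)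
    \<comment> \<open>Since \<open>norm v <= 2 * R\<close>, the grid error is at most the main
      term.\<close>
    also have "\<dots> \<le> 9 * ((1 + 2 * R) * r ^ n / norm v + (1 + 2 * R) * r ^ n / norm v)"
    proof -
      have "1 / real Q \<le> r ^ n" by (rule Q)
      also have "r ^ n = norm v * r ^ n / norm v" using v0 by simp
      also have "\<dots> \<le> (1 + 2 * R) * r ^ n / norm v" using v rn[of n] v0 by (intro divide_right_mono mult_right_mono) auto
      finally show ?thesis by (intro mult_left_mono add_left_mono) auto
    qed
    also have "\<dots> = C5 * (r ^ n / norm v)" unfolding C5_def by simp
    also have "\<dots> \<le> C5 * (r ^ n / r ^ Suc J)"
    proof -
      have "1 * r ^ Suc J \<le> (1 + 2 * R) * r ^ Suc J" using R_nonneg r0 by (intro mult_right_mono) auto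
      then have "r ^ Suc J \<le> norm v" using nv by simp
      then show ?thesis using C5 r0 v0 rn[of n] by (intro mult_left_mono divide_left_mono mult_pos_pos) auto
    qed
    also have "r ^ n / r ^ Suc J = ?f J"
    proof -
      have "r ^ n = r ^ (n - J) * r ^ J" using jn J by (simp flip: power_add)
      then show ?thesis using PJ r0 by (simp add: P_def field_simps)
    qed
    also have "C5 * ?f J \<le> C5 * (\<Sum>j\<le>n. ?f j)" using one[of J] C5 jn J by (intro mult_left_mono) auto
    finally show ?thesis .
  qed
qed

text \<open>Marstrand's averaging: the sums over directions and words are exchanged, and for each
  word only the directions that almost identify it with \<omega> count. The radius grows from
  \<open>1 + 2 * R\<close> to \<open>1 + 4 * R\<close> by the truncation errors of both
  points.\<close>

lemma mean_mass_le:
  assumes p: "pvec m p" and w: "\<omega> \<in> space (nu m p)" and Q: "Q > 0" "1 / real Q \<le> r ^ n"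
  shows "(\<Sum>i<Q. mass (weight p) (words m n) (dcell n (2 * pi * real i / real Q)) (dcell n (2 * pi * real i / real Q) (pre n \<omega>))) / real Q
    \<le> C5 * (\<Sum>j\<le>n. r ^ (n - j) / r * measure (nu m p) {\<omega>'\<in>space (nu m p). norm (cod \<omega>' - cod \<omega>) \<le> (1 + 4 * R) * r ^ j})"
proof -
  interpret prob_space "nu m p" by (rule prob_space_nu[OF p])
  let ?u = "pre n \<omega>" and ?\<beta> = "\<lambda>i. 2 * pi * real i / real Q"
  let ?N = "\<lambda>v j. norm (pos v - pos ?u) \<le> (1 + 2 * R) * r ^ j"
  have u: "?u \<in> words m n" using w by (rule pre_words)
  have C5: "C5 \<ge> 0" unfolding C5_def using R_nonneg by simp
  have "(\<Sum>i<Q. mass (weight p) (words m n) (dcell n (?\<beta> i)) (dcell n (?\<beta> i) ?u)) / real Q \<le> (\<Sum>i<Q. near_mass p n (?\<beta> i) ?u) / real Q"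
    by (intro divide_right_mono sum_mono mass_le_near_mass p) simp
  also have "(\<Sum>i<Q. near_mass p n (?\<beta> i) ?u) = (\<Sum>v\<in>words m n. \<Sum>i<Q. if \<bar>dir (?\<beta> i) (pos v - pos ?u)\<bar> \<le> (1 + 2 * R) * r ^ n then weight p v else 0)"
    unfolding near_mass_def dir_diff by (subst sum.swap) (simp add: sum.inter_filter)
  also have "\<dots> = (\<Sum>v\<in>words m n. weight p v * real (card {i. i < Q \<and> \<bar>dir (?\<beta> i) (pos v - pos ?u)\<bar> \<le> (1 + 2 * R) * r ^ n}))"
  proof (intro sum.cong refl)
    fix v
    have "(\<Sum>i<Q. if \<bar>dir (?\<beta> i) (pos v - pos ?u)\<bar> \<le> (1 + 2 * R) * r ^ n then weight p v else 0)
      = (\<Sum>i | i \<in> {..<Q} \<and> \<bar>dir (?\<beta> i) (pos v - pos ?u)\<bar> \<le> (1 + 2 * R) * r ^ n. weight p v)"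
      by (rule sum.inter_filter[symmetric]) simp
    then show "(\<Sum>i<Q. if \<bar>dir (?\<beta> i) (pos v - pos ?u)\<bar> \<le> (1 + 2 * R) * r ^ n then weight p v else 0)
      = weight p v * real (card {i. i < Q \<and> \<bar>dir (?\<beta> i) (pos v - pos ?u)\<bar> \<le> (1 + 2 * R) * r ^ n})" by simp
  qed
  also have "\<dots> / real Q = (\<Sum>v\<in>words m n. weight p v * (real (card {i. i < Q \<and> \<bar>dir (?\<beta> i) (pos v - pos ?u)\<bar> \<le> (1 + 2 * R) * r ^ n}) / real Q))"
    by (simp add: sum_divide_distrib)
  also have "\<dots> \<le> (\<Sum>v\<in>words m n. weight p v * (C5 * (\<Sum>j\<le>n. r ^ (n - j) / r * (if ?N v j then 1 else 0))))"
  proof (intro sum_mono mult_left_mono short_projections_dyadic Q)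
    fix v assume v: "v \<in> words m n"
    have "norm (pos v) \<le> R" "norm (pos ?u) \<le> R" using v u by (auto intro!: norm_pos_le simp: words_def)
    then show "norm (pos v - pos ?u) \<le> 2 * R" using norm_triangle_ineq4[of "pos v" "pos ?u"] by simp
    show "0 \<le> weight p v" using p v by (rule weight_words_nonneg)
  qed
  also have "\<dots> = C5 * (\<Sum>j\<le>n. \<Sum>v\<in>words m n. r ^ (n - j) / r * (if ?N v j then weight p v else 0))"
    unfolding sum_distrib_left by (subst sum.swap) (intro sum.cong, auto)
  also have "\<dots> = C5 * (\<Sum>j\<le>n. r ^ (n - j) / r * (\<Sum>v | v \<in> words m n \<and> ?N v j. weight p v))"
    by (simp only: sum_distrib_left[symmetric] sum.inter_filter[OF finite_words])
  also have "\<dots> \<le> C5 * (\<Sum>j\<le>n. r ^ (n - j) / r * prob {\<omega>'\<in>space (nu m p). norm (cod \<omega>' - cod \<omega>) \<le> (1 + 4 * R) * r ^ j})"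
  proof (rule mult_left_mono[OF sum_mono C5])
    fix j assume j: "j \<in> {..n}"
    have "(\<Sum>v | v \<in> words m n \<and> ?N v j. weight p v) = prob {\<omega>'\<in>space (nu m p). ?N (pre n \<omega>') j}"
      by (rule nu_pre(2)[OF p, symmetric])
    also have "\<dots> \<le> prob {\<omega>'\<in>space (nu m p). norm (cod \<omega>' - cod \<omega>) \<le> (1 + 4 * R) * r ^ j}"
    proof (rule finite_measure_mono)
      show "{\<omega>'\<in>space (nu m p). norm (cod \<omega>' - cod \<omega>) \<le> (1 + 4 * R) * r ^ j} \<in> events"
        using cod_measurable[OF p] by measurable
      show "{\<omega>'\<in>space (nu m p). ?N (pre n \<omega>') j} \<subseteq> {\<omega>'\<in>space (nu m p). norm (cod \<omega>' - cod \<omega>) \<le> (1 + 4 * R) * r ^ j}"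
      proof safe
        fix \<omega>' assume w': "\<omega>' \<in> space (nu m p)" and N: "?N (pre n \<omega>') j"
        have rnj: "R * r ^ n \<le> R * r ^ j" using j r0 r1 R_nonneg by (intro mult_left_mono power_decreasing) auto
        have "cod \<omega>' - cod \<omega> = (cod \<omega>' - pos (pre n \<omega>')) + (pos (pre n \<omega>') - pos ?u) - (cod \<omega> - pos ?u)" by simp
        then have "norm (cod \<omega>' - cod \<omega>) \<le> norm (cod \<omega>' - pos (pre n \<omega>')) + norm (pos (pre n \<omega>') - pos ?u) + norm (cod \<omega> - pos ?u)"
          by (metis norm_triangle_ineq norm_triangle_ineq4 add_right_mono order_trans)
        also have "\<dots> \<le> R * r ^ j + (1 + 2 * R) * r ^ j + R * r ^ j"
          using N cod_approx[OF w', of n] cod_approx[OF w, of n] rnj by linarith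
        also have "\<dots> = (1 + 4 * R) * r ^ j" by (simp add: algebra_simps)
        finally show "norm (cod \<omega>' - cod \<omega>) \<le> (1 + 4 * R) * r ^ j" .
      qed
    qed
    finally show "r ^ (n - j) / r * (\<Sum>v | v \<in> words m n \<and> ?N v j. weight p v)
      \<le> r ^ (n - j) / r * prob {\<omega>'\<in>space (nu m p). norm (cod \<omega>' - cod \<omega>) \<le> (1 + 4 * R) * r ^ j}"
      using r0 by (intro mult_left_mono) auto
  qed
  finally show ?thesis .
qed

text \<open>The points whose cell of side \<open>r ^ n\<close> has an enlargement of mass above \<open>r ^ (n * s)\<close> for infinitely
  many \<open>n\<close> are covered by few cells at each scale, hence form a set of dimension at most \<open>s\<close>.\<close>

lemma AE_ball_mass_le:
  assumes p: "pvec m p" and s: "0 \<le> s" "s < hausdorff_dim_measure (mu p)"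
  shows "AE \<omega> in nu m p. \<exists>N. \<forall>n\<ge>N.
    measure (nu m p) {\<omega>'\<in>space (nu m p). norm (cod \<omega>' - cod \<omega>) \<le> (1 + 4 * R) * r ^ n} \<le> (r ^ n) powr s"
proof -
  interpret prob_space "nu m p" by (rule prob_space_nu[OF p])
  define K where "K = \<lceil>1 + 4 * R\<rceil> + 1"
  define T where "T = {-K..K} \<times> {-K..K}"
  have K0: "K \<ge> 0" unfolding K_def using R_nonneg by (simp add: le_ceiling_iff)
  have finT: "finite T" unfolding T_def by simp
  define V where "V n c = {\<omega>\<in>space (nu m p). cod \<omega> \<in> square (r ^ n) c}" for n c
  have Vm: "V n c \<in> events" for n c
    unfolding V_def using measurable_sets[OF cod_measurable[OF p] square_borel] by (simp add: vimage_def Int_def conj_commute)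
  have Vdisj: "V n c \<inter> V n c' = {}" if "c \<noteq> c'" for n c c'
    using that by (auto simp: V_def square_def prod_eq_iff)
  \<comment> \<open>The window T of neighbours is so large that \<open>nb n c\<close> contains the
    whole ball about every point coded into the square c.\<close>
  define nb where "nb n c = (\<Union>d\<in>T. V n (fst c + fst d, snd c + snd d))" for n c
  have nbm: "nb n c \<in> events" for n c unfolding nb_def using finT Vm by (intro sets.finite_UN) auto
  define Heavy where "Heavy n = {c. prob (nb n c) > (r ^ n) powr s}" for n
  have rp0: "(r ^ n) powr s > 0" for n using r0 by simp
  \<comment> \<open>Each square belongs to at most \<open>card T\<close> windows, which limits the
    number of heavy squares to \<open>card T / (r ^ n) powr s\<close>.\<close>
  have nbsum: "(\<Sum>c\<in>G. prob (nb n c)) \<le> real (card T)" if G: "finite G" for G n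
  proof -
    have "(\<Sum>c\<in>G. prob (nb n c)) \<le> (\<Sum>c\<in>G. \<Sum>d\<in>T. prob (V n (fst c + fst d, snd c + snd d)))"
      unfolding nb_def using Vm finT by (intro sum_mono finite_measure_subadditive_finite) auto
    also have "\<dots> = (\<Sum>d\<in>T. \<Sum>c\<in>G. prob (V n (fst c + fst d, snd c + snd d)))" by (rule sum.swap)
    also have "\<dots> \<le> (\<Sum>d\<in>T. 1)"
    proof (rule sum_mono)
      fix d
      have "(\<Sum>c\<in>G. prob (V n (fst c + fst d, snd c + snd d))) = prob (\<Union>c\<in>G. V n (fst c + fst d, snd c + snd d))"
        using Vm G Vdisj by (intro finite_measure_finite_Union[symmetric]) (auto simp: disjoint_family_on_def prod_eq_iff)
      then show "(\<Sum>c\<in>G. prob (V n (fst c + fst d, snd c + snd d))) \<le> 1" by simp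
    qed
    finally show ?thesis by simp
  qed
  have Hcard: "finite (Heavy n) \<and> real (card (Heavy n)) * (r ^ n) powr s \<le> real (card T)" for n
  proof -
    have bd: "real (card G) * (r ^ n) powr s \<le> real (card T)" if "G \<subseteq> Heavy n" "finite G" for G
    proof -
      have "real (card G) * (r ^ n) powr s = (\<Sum>c\<in>G. (r ^ n) powr s)" by simp
      also have "\<dots> \<le> (\<Sum>c\<in>G. prob (nb n c))" using that by (intro sum_mono) (auto simp: Heavy_def intro: less_imp_le)
      also have "\<dots> \<le> real (card T)" using that by (intro nbsum)
      finally show ?thesis .
    qed
    have "finite (Heavy n)"
    proof -
      have "card G \<le> nat \<lfloor>real (card T) / (r ^ n) powr s\<rfloor>" if "G \<subseteq> Heavy n" "finite G" for G
        using bd[OF that] rp0[of n] by (simp add: le_nat_floor field_simps)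
      then show ?thesis using finite_if_finite_subsets_card_bdd[of "Heavy n"] by blast
    qed
    then show ?thesis using bd by blast
  qed
  define A where "A = {z. \<forall>N. \<exists>n\<ge>N. \<exists>c\<in>Heavy n. z \<in> square (r ^ n) c}"
  have Ab: "A \<in> sets borel"
  proof -
    have "A = (\<Inter>N. \<Union>n\<in>{N..}. \<Union>c\<in>Heavy n. square (r ^ n) c)" unfolding A_def by (intro set_eqI) (simp add: Bex_def)
    also have "\<dots> \<in> sets borel"
      using Hcard square_borel by (intro sets.countable_INT sets.countable_UN' sets.finite_UN) (auto simp: image_subset_iff)
    finally show ?thesis .
  qed
  \<comment> \<open>The room between s and s2 makes the covering sums geometric.\<close>
  obtain s2 where s2: "s < s2" "s2 < hausdorff_dim_measure (mu p)" using dense[OF s(2)] by blast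
  have H0: "hausdorff_measure s2 A = 0"
  proof (rule hausdorff_measure_limsup_cover[where C = Heavy and Q = "\<lambda>n. square (r ^ n)" and d = "\<lambda>n. 2 * r ^ n"])
    show "\<exists>n\<ge>N. \<exists>c\<in>Heavy n. x \<in> square (r ^ n) c" if "x \<in> A" for x N using that by (simp add: A_def)
    show "bounded (square (r ^ n) c) \<and> diameter (square (r ^ n) c) \<le> 2 * r ^ n" for n c by (rule square_diam) (rule rn)
    have "(\<lambda>n. 2 * r ^ n) \<longlonglongrightarrow> 2 * 0" using r0 r1 by (intro tendsto_intros LIMSEQ_power_zero) auto
    then show "(\<lambda>n. 2 * r ^ n) \<longlonglongrightarrow> 0" by simp
    have q: "0 < r powr (s2 - s)" "r powr (s2 - s) < 1"
    proof -
      have "r powr (s2 - s) = exp (- (ell * (s2 - s)))" using rpow_powr[of 1 "s2 - s"] by simp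
      then show "0 < r powr (s2 - s)" "r powr (s2 - s) < 1" using ell_pos s2 by simp_all
    qed
    show "summable (\<lambda>n. real (card (Heavy n)) * (2 * r ^ n) powr s2)"
    proof (rule summable_comparison_test)
      show "summable (\<lambda>n. real (card T) * 2 powr s2 * (r powr (s2 - s)) ^ n)"
        using q by (intro summable_mult summable_geometric) auto
      show "\<exists>N. \<forall>n\<ge>N. norm (real (card (Heavy n)) * (2 * r ^ n) powr s2) \<le> real (card T) * 2 powr s2 * (r powr (s2 - s)) ^ n"
      proof (intro exI allI impI)
        fix n
        have e: "(r ^ n) powr s2 = (r ^ n) powr s * (r powr (s2 - s)) ^ n"
        proof -
          have "(r powr (s2 - s)) ^ n = (r ^ n) powr (s2 - s)"
            using r0 q by (simp add: powr_realpow[symmetric] powr_powr mult.commute)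
          then show ?thesis by (simp flip: powr_add)
        qed
        have "norm (real (card (Heavy n)) * (2 * r ^ n) powr s2) = (real (card (Heavy n)) * (r ^ n) powr s) * (2 powr s2 * (r powr (s2 - s)) ^ n)"
          using rn[of n] e by (simp add: powr_mult)
        also have "\<dots> \<le> real (card T) * (2 powr s2 * (r powr (s2 - s)) ^ n)"
          using Hcard[of n] q by (intro mult_right_mono) auto
        finally show "norm (real (card (Heavy n)) * (2 * r ^ n) powr s2) \<le> real (card T) * 2 powr s2 * (r powr (s2 - s)) ^ n"
          by (simp add: mult.assoc)
      qed
    qed
  qed (use Hcard s s2 rn in \<open>auto intro: less_imp_le\<close>)
  have "emeasure (mu p) A = 0"
  proof (rule ccontr)
    assume "emeasure (mu p) A \<noteq> 0"
    then have "hausdorff_dim_measure (mu p) \<le> hausdorff_dim A" using Ab by (intro hausdorff_dim_measure_le) (auto simp: zero_less_iff_neq_zero)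
    also have "\<dots> \<le> s2" using H0 s s2 by (intro hausdorff_dim_le) auto
    finally show False using s2 by simp
  qed
  then have "cod -` A \<inter> space (nu m p) \<in> null_sets (nu m p)"
    using cod_measurable[OF p] Ab by (simp add: emeasure_distr null_sets_def measurable_sets)
  then have "AE \<omega> in nu m p. \<omega> \<notin> cod -` A \<inter> space (nu m p)" by (rule AE_not_in)
  moreover have "AE \<omega> in nu m p. \<omega> \<in> space (nu m p)" by simp
  ultimately show ?thesis
  proof eventually_elim
    case (elim \<omega>)
    then have "cod \<omega> \<notin> A" by auto
    then obtain N where N: "\<And>n c. n \<ge> N \<Longrightarrow> c \<in> Heavy n \<Longrightarrow> cod \<omega> \<notin> square (r ^ n) c" unfolding A_def by auto
    show ?case
    proof (intro exI allI impI)
      fix n assume n: "N \<le> n"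
      define c where "c = (\<lfloor>Re (cod \<omega>) / r ^ n\<rfloor>, \<lfloor>Im (cod \<omega>) / r ^ n\<rfloor>)"
      have "cod \<omega> \<in> square (r ^ n) c" by (simp add: c_def square_def)
      then have "c \<notin> Heavy n" using N n by blast
      then have "prob (nb n c) \<le> (r ^ n) powr s" by (simp add: Heavy_def)
      moreover have "{\<omega>'\<in>space (nu m p). norm (cod \<omega>' - cod \<omega>) \<le> (1 + 4 * R) * r ^ n} \<subseteq> nb n c"
      proof safe
        fix \<omega>' assume w': "\<omega>' \<in> space (nu m p)" and d: "norm (cod \<omega>' - cod \<omega>) \<le> (1 + 4 * R) * r ^ n"
        have fl: "\<lfloor>x / r ^ n\<rfloor> - \<lfloor>y / r ^ n\<rfloor> \<in> {-K..K}" if "\<bar>x - y\<bar> \<le> (1 + 4 * R) * r ^ n" for x y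
        proof -
          have "\<bar>x / r ^ n - y / r ^ n\<bar> \<le> 1 + 4 * R"
            using that rn[of n] by (simp add: diff_divide_distrib[symmetric] abs_divide divide_le_eq)
          then have "\<bar>\<lfloor>x / r ^ n\<rfloor> - \<lfloor>y / r ^ n\<rfloor>\<bar> \<le> K" unfolding K_def by linarith
          then show ?thesis by auto
        qed
        have "\<bar>Re (cod \<omega>') - Re (cod \<omega>)\<bar> \<le> (1 + 4 * R) * r ^ n" "\<bar>Im (cod \<omega>') - Im (cod \<omega>)\<bar> \<le> (1 + 4 * R) * r ^ n"
          using d abs_Re_le_cmod[of "cod \<omega>' - cod \<omega>"] abs_Im_le_cmod[of "cod \<omega>' - cod \<omega>"] by auto
        note this[THEN fl]
        then have "(\<lfloor>Re (cod \<omega>') / r ^ n\<rfloor> - fst c, \<lfloor>Im (cod \<omega>') / r ^ n\<rfloor> - snd c) \<in> T"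
          unfolding c_def T_def by simp
        moreover have "\<omega>' \<in> V n (fst c + (\<lfloor>Re (cod \<omega>') / r ^ n\<rfloor> - fst c), snd c + (\<lfloor>Im (cod \<omega>') / r ^ n\<rfloor> - snd c))"
          using w' by (simp add: V_def square_def)
        ultimately show "\<omega>' \<in> nb n c" unfolding nb_def by force
      qed
      ultimately show "prob {\<omega>'\<in>space (nu m p). norm (cod \<omega>' - cod \<omega>) \<le> (1 + 4 * R) * r ^ n} \<le> (r ^ n) powr s"
        using finite_measure_mono[OF _ nbm, of _ n c] by (meson order_trans)
    qed
  qed
qed

end

section \<open>The upper bound for the dimension of the measure\<close>

context similarity_ifs
begin

text \<open>If the dimension exceeded s, then on an event of probability above 3/4 the
  direction-averaged cell masses would be at most a constant times \<open>(r ^ n) powr s\<close>. As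
  \<open>s' < s\<close>, Markov's inequality over the directions then gives, for large n,
  information above \<open>n * ell * s'\<close> in 7/8 of them. The product 21/32 contradicts the
  assumed 1/2.\<close>

lemma dim_mu_le:
  assumes p: "pvec m p" and s: "0 < s" "s' < s" "s < 1"
    and Q: "\<And>n. n \<ge> 1 \<Longrightarrow> Q n > 0 \<and> 1 / real (Q n) \<le> r ^ n"
    and io: "\<And>n0. \<exists>n\<ge>n0. n \<ge> 1 \<and> (\<Sum>i<Q n. high p n (2 * pi * real i / real (Q n)) (real n * ell * s')) / real (Q n) \<le> 1 / 2"
  shows "hausdorff_dim_measure (mu p) \<le> s"
proof (rule ccontr)
  assume "\<not> ?thesis"
  then have sd: "s < hausdorff_dim_measure (mu p)" by simp
  interpret prob_space "nu m p" by (rule prob_space_nu[OF p])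
  define T where "T \<omega> n = prob {\<omega>'\<in>space (nu m p). norm (cod \<omega>' - cod \<omega>) \<le> (1 + 4 * R) * r ^ n}" for \<omega> n
  define q where "q n i u = mass (weight p) (words m n) (dcell n (2 * pi * real i / real (Q n))) (dcell n (2 * pi * real i / real (Q n)) u)" for n i u
  have q0: "q n i u \<ge> 0" for n i u unfolding q_def using p by (rule mass_words_nonneg)
  have AET: "AE \<omega> in nu m p. \<exists>N. \<forall>n\<ge>N. T \<omega> n \<le> (r ^ n) powr s"
    unfolding T_def using p s sd by (intro AE_ball_mass_le) auto
  \<comment> \<open>Sum of the geometric series over scales, times the loss
    \<open>1 / (r ^ N) powr s\<close> for the scales before N, where T is merely bounded by
    1.\<close>
  define K where "K N = C5 / r * (1 / (1 - r powr (1 - s))) * (1 / (r ^ N) powr s)" for N :: nat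
  have C5: "C5 \<ge> 0" unfolding C5_def using R_nonneg by simp
  \<comment> \<open>The point where \<open>s < 1\<close> enters: the sum over scales is geometric
    with ratio \<open>r powr (1 - s)\<close>. This is the origin of the minimum with 1.\<close>
  have rs: "0 < r powr (1 - s)" "r powr (1 - s) < 1"
  proof -
    have "r powr (1 - s) = exp (- (ell * (1 - s)))" using rpow_powr[of 1 "1 - s"] by simp
    then show "0 < r powr (1 - s)" "r powr (1 - s) < 1" using ell_pos s by simp_all
  qed
  have K0: "K N \<ge> 0" for N unfolding K_def using C5 r0 rs by simp
  have mean: "(\<Sum>i<Q n. q n i (pre n \<omega>)) / real (Q n) \<le> K N * (r ^ n) powr s"
    if w: "\<omega> \<in> space (nu m p)" and N: "\<forall>n\<ge>N. T \<omega> n \<le> (r ^ n) powr s" and n: "n \<ge> 1" for \<omega> N n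
  proof -
    have TN: "T \<omega> j \<le> (1 / (r ^ N) powr s) * (r ^ j) powr s" for j
    proof (cases "j \<ge> N")
      case True
      have "(r ^ N) powr s \<le> 1" using rn[of N] s by (intro powr_le1) (auto intro: less_imp_le)
      then have "1 \<le> 1 / (r ^ N) powr s" using r0 by (simp add: field_simps)
      then have "1 * (r ^ j) powr s \<le> (1 / (r ^ N) powr s) * (r ^ j) powr s" by (intro mult_right_mono) auto
      moreover have "T \<omega> j \<le> (r ^ j) powr s" using N True by blast
      ultimately show ?thesis by linarith
    next
      case False
      have "(r ^ N) powr s \<le> (r ^ j) powr s" using False r0 r1 s by (intro powr_mono2 power_decreasing) auto
      then have "1 \<le> (1 / (r ^ N) powr s) * (r ^ j) powr s" using r0 by (simp add: field_simps)
      moreover have "T \<omega> j \<le> 1" unfolding T_def by simp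
      ultimately show ?thesis by linarith
    qed
    have "(\<Sum>i<Q n. q n i (pre n \<omega>)) / real (Q n) \<le> C5 * (\<Sum>j\<le>n. r ^ (n - j) / r * T \<omega> j)"
      unfolding q_def T_def using Q[OF n] by (intro mean_mass_le p w) auto
    also have "\<dots> \<le> C5 * (\<Sum>j\<le>n. r ^ (n - j) / r * ((1 / (r ^ N) powr s) * (r ^ j) powr s))"
      using C5 r0 TN by (intro mult_left_mono[OF sum_mono] mult_left_mono[OF TN]) auto
    also have "\<dots> = C5 / r * (1 / (r ^ N) powr s) * (\<Sum>j\<le>n. r ^ (n - j) * (r ^ j) powr s)"
      by (simp add: sum_distrib_left sum_divide_distrib mult.assoc mult.left_commute)
    also have "(\<Sum>j\<le>n. r ^ (n - j) * (r ^ j) powr s) = (\<Sum>j\<le>n. (r ^ n) powr s * (r powr (1 - s)) ^ (n - j))"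
    proof (intro sum.cong refl)
      fix j assume j: "j \<in> {..n}"
      have "(r powr (1 - s)) ^ (n - j) = (r ^ (n - j)) powr (1 - s)"
        using r0 rs by (simp add: powr_realpow[symmetric] powr_powr mult.commute)
      moreover have "(r ^ n) powr s = (r ^ j) powr s * (r ^ (n - j)) powr s"
        using j r0 by (simp flip: powr_mult power_add)
      moreover have "(r ^ (n - j)) powr s * (r ^ (n - j)) powr (1 - s) = r ^ (n - j)"
        using r0 by (simp flip: powr_add)
      ultimately show "r ^ (n - j) * (r ^ j) powr s = (r ^ n) powr s * (r powr (1 - s)) ^ (n - j)" by (simp add: mult_ac)
    qed
    also have "\<dots> = (r ^ n) powr s * (\<Sum>j\<le>n. (r powr (1 - s)) ^ j)"
    proof -
      have "(\<Sum>j\<le>n. (r powr (1 - s)) ^ (n - j)) = (\<Sum>j\<le>n. (r powr (1 - s)) ^ j)"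
        by (rule sum.nat_diff_reindex[of "\<lambda>j. (r powr (1 - s)) ^ j" "Suc n", unfolded lessThan_Suc_atMost, simplified])
      then show ?thesis by (simp only: sum_distrib_left[symmetric])
    qed
    also have "C5 / r * (1 / (r ^ N) powr s) * ((r ^ n) powr s * (\<Sum>j\<le>n. (r powr (1 - s)) ^ j))
      \<le> C5 / r * (1 / (r ^ N) powr s) * ((r ^ n) powr s * (1 / (1 - r powr (1 - s))))"
    proof (intro mult_left_mono)
      have "(\<Sum>j<Suc n. (r powr (1 - s)) ^ j) \<le> (\<Sum>j. (r powr (1 - s)) ^ j)"
        using rs by (intro sum_le_suminf summable_geometric) auto
      also have "\<dots> = 1 / (1 - r powr (1 - s))" using rs by (intro suminf_geometric) auto
      finally show "(\<Sum>j\<le>n. (r powr (1 - s)) ^ j) \<le> 1 / (1 - r powr (1 - s))"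
        by (simp add: lessThan_Suc_atMost)
    qed (use C5 r0 in auto)
    finally show ?thesis unfolding K_def by (simp add: mult_ac)
  qed
  define E where "E N n = {\<omega>\<in>space (nu m p). (\<Sum>i<Q n. q n i (pre n \<omega>)) / real (Q n) \<le> K N * (r ^ n) powr s}" for N n
  have Em: "E N n \<in> events" for N n unfolding E_def by (rule nu_pre(1)[OF p])
  define F where "F N = (\<Inter>n\<in>{1..}. E N n)" for N
  have Fm: "F N \<in> events" for N unfolding F_def by (rule sets.countable_INT') (use Em in auto)
  have incF: "incseq F"
  proof (rule incseq_SucI)
    fix N
    have "K N \<le> K (Suc N)"
    proof -
      have "(r ^ Suc N) powr s \<le> (r ^ N) powr s" using r0 r1 s by (intro powr_mono2 power_decreasing) auto
      then have "1 / (r ^ N) powr s \<le> 1 / (r ^ Suc N) powr s" using r0 by (intro divide_left_mono) auto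
      then show ?thesis unfolding K_def using C5 r0 rs by (intro mult_left_mono) auto
    qed
    then have "K N * (r ^ n) powr s \<le> K (Suc N) * (r ^ n) powr s" for n by (intro mult_right_mono) auto
    then show "F N \<subseteq> F (Suc N)" unfolding F_def E_def by (auto intro: order_trans)
  qed
  have "AE \<omega> in nu m p. \<omega> \<in> (\<Union>N. F N)"
  proof -
    have "AE \<omega> in nu m p. \<omega> \<in> space (nu m p)" by simp
    with AET show ?thesis
    proof eventually_elim
      case (elim \<omega>)
      then obtain N where "\<forall>n\<ge>N. T \<omega> n \<le> (r ^ n) powr s" by blast
      then have "\<omega> \<in> F N" unfolding F_def E_def using mean elim by auto
      then show ?case by blast
    qed
  qed
  then have "prob (\<Union>N. F N) = 1" using Fm by (subst prob_eq_1) auto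
  then have "(\<lambda>N. prob (F N)) \<longlonglongrightarrow> 1" using finite_Lim_measure_incseq[of F] Fm incF by auto
  then have "eventually (\<lambda>N. prob (F N) > 3 / 4) sequentially" by (rule order_tendstoD) simp
  then obtain N where N: "prob (F N) > 3 / 4" by (auto simp: eventually_sequentially)
  have ss: "0 < r powr (s - s')" "r powr (s - s') < 1"
  proof -
    have "r powr (s - s') = exp (- (ell * (s - s')))" using rpow_powr[of 1 "s - s'"] by simp
    then show "0 < r powr (s - s')" "r powr (s - s') < 1" using ell_pos s by simp_all
  qed
  have "(\<lambda>n. K N * (r powr (s - s')) ^ n) \<longlonglongrightarrow> K N * 0" using ss by (intro tendsto_intros LIMSEQ_power_zero) auto
  then have "eventually (\<lambda>n. K N * (r powr (s - s')) ^ n < 1 / 8) sequentially" by (rule order_tendstoD) simp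
  then obtain n1 where n1: "\<And>n. n \<ge> n1 \<Longrightarrow> K N * (r powr (s - s')) ^ n < 1 / 8" by (auto simp: eventually_sequentially)
  obtain n where n: "n \<ge> n1" "n \<ge> 1" and b: "(\<Sum>i<Q n. high p n (2 * pi * real i / real (Q n)) (real n * ell * s')) / real (Q n) \<le> 1 / 2"
    using io by blast
  have Qn: "Q n > 0" using Q[OF n(2)] by simp
  let ?S = "real n * ell * s'" and ?\<beta> = "\<lambda>i. 2 * pi * real i / real (Q n)"
  let ?G = "\<lambda>u. (\<Sum>i<Q n. q n i u) / real (Q n) \<le> K N * (r ^ n) powr s"
  \<comment> \<open>Markov's inequality in the direction: low information forces a cell mass of at
    least \<open>(r ^ n) powr s'\<close>. Positive weight of u excludes null cells, whose
    information is 0 by convention.\<close>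
  have cnt: "7 / 8 * real (Q n) \<le> (\<Sum>i<Q n. if info p n (?\<beta> i) u > ?S then 1 else 0)"
    if u: "u \<in> words m n" "?G u" "weight p u > 0" for u
  proof -
    have "(\<Sum>i<Q n. if info p n (?\<beta> i) u > ?S then 0 else (1::real)) \<le> (\<Sum>i<Q n. q n i u / (r ^ n) powr s')"
    proof (rule sum_mono)
      fix i
      have qp: "q n i u > 0" unfolding q_def using mass_ge_weight[OF p u(1), of "dcell n (?\<beta> i)"] u(3) by linarith
      show "(if info p n (?\<beta> i) u > ?S then 0 else (1::real)) \<le> q n i u / (r ^ n) powr s'"
      proof (cases "info p n (?\<beta> i) u > ?S")
        case True then show ?thesis using qp by simp
      next
        case False
        then have "- ?S \<le> ln (q n i u)" unfolding info_def q_def by simp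
        then have "exp (- ?S) \<le> exp (ln (q n i u))" by simp
        then have "(r ^ n) powr s' \<le> q n i u" unfolding rpow_powr using qp by simp
        then show ?thesis using False r0 by (simp add: le_divide_eq)
      qed
    qed
    also have "\<dots> = (\<Sum>i<Q n. q n i u) / (r ^ n) powr s'" by (rule sum_divide_distrib[symmetric])
    also have "\<dots> \<le> real (Q n) * (K N * (r ^ n) powr s) / (r ^ n) powr s'"
      using u(2) Qn by (intro divide_right_mono) (auto simp: field_simps)
    also have "\<dots> = real (Q n) * (K N * (r powr (s - s')) ^ n)"
    proof -
      have "(r powr (s - s')) ^ n = (r ^ n) powr (s - s')"
        using r0 ss by (simp add: powr_realpow[symmetric] powr_powr mult.commute)
      then have "(r powr (s - s')) ^ n = (r ^ n) powr s / (r ^ n) powr s'" by (simp add: powr_diff)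
      then show ?thesis by simp
    qed
    also have "\<dots> \<le> real (Q n) * (1 / 8)" using n1[OF n(1)] by (intro mult_left_mono) auto
    finally have *: "(\<Sum>i<Q n. if info p n (?\<beta> i) u > ?S then 0 else (1::real)) \<le> real (Q n) / 8" by simp
    have "(\<Sum>i<Q n. if info p n (?\<beta> i) u > ?S then 0 else (1::real)) + (\<Sum>i<Q n. if info p n (?\<beta> i) u > ?S then 1 else 0) = (\<Sum>i<Q n. 1)"
      unfolding sum.distrib[symmetric] by (intro sum.cong) auto
    then show ?thesis using * by simp
  qed
  have "3 / 4 < prob (F N)" by (rule N)
  also have "\<dots> \<le> prob (E N n)" using n Em by (intro finite_measure_mono) (auto simp: F_def)
  also have "\<dots> = (\<Sum>u | u \<in> words m n \<and> ?G u. weight p u)" unfolding E_def by (rule nu_pre(2)[OF p])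
  finally have G: "3 / 4 < (\<Sum>u | u \<in> words m n \<and> ?G u. weight p u)" .
  have "7 / 8 * real (Q n) * (\<Sum>u | u \<in> words m n \<and> ?G u. weight p u)
     \<le> (\<Sum>u | u \<in> words m n \<and> ?G u. weight p u * (\<Sum>i<Q n. if info p n (?\<beta> i) u > ?S then 1 else 0))"
    unfolding sum_distrib_left
  proof (rule sum_mono)
    fix u assume u: "u \<in> {u. u \<in> words m n \<and> ?G u}"
    then have w0: "weight p u \<ge> 0" using p by (auto intro: weight_words_nonneg)
    show "7 / 8 * real (Q n) * weight p u \<le> (\<Sum>i<Q n. weight p u * (if info p n (?\<beta> i) u > ?S then 1 else 0))"
    proof (cases "weight p u = 0")
      case False
      then have "7 / 8 * real (Q n) * weight p u \<le> (\<Sum>i<Q n. if info p n (?\<beta> i) u > ?S then 1 else 0) * weight p u"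
        using u w0 by (intro mult_right_mono cnt) auto
      then show ?thesis by (simp add: sum_distrib_left[symmetric] mult.commute)
    qed simp
  qed
  also have "\<dots> \<le> (\<Sum>u\<in>words m n. weight p u * (\<Sum>i<Q n. if info p n (?\<beta> i) u > ?S then 1 else 0))"
    using p by (intro sum_mono2) (auto intro!: mult_nonneg_nonneg sum_nonneg weight_words_nonneg)
  also have "\<dots> = (\<Sum>i<Q n. high p n (?\<beta> i) ?S)"
    unfolding high_def sum_distrib_left by (subst sum.swap) (intro sum.cong, auto)
  also have "\<dots> \<le> real (Q n) / 2" using b Qn by (simp add: field_simps)
  finally have "7 / 8 * (\<Sum>u | u \<in> words m n \<and> ?G u. weight p u) \<le> 1 / 2"
    using Qn by (simp add: field_simps)
  then show False using G by simp
qed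

end

context random_ifs
begin

text \<open>Each rational level strictly between the rate and 1 bounds the dimension off a null set,
  and countably many levels suffice. For a rate of at least 1 the minimum settles the claim.\<close>

lemma AE_dim_mu_le: "AE w in WM. min 1 (hausdorff_dim_measure (mu (pw w))) \<le> max 0 dim_rate"
proof (cases "max 0 dim_rate < 1")
  case False then show ?thesis by (intro AE_I2) auto
next
  case True
  have "AE w in WM. \<forall>q\<in>{q. max 0 dim_rate < of_rat q \<and> of_rat q < (1::real)}. hausdorff_dim_measure (mu (pw w)) \<le> of_rat q"
  proof (subst AE_ball_countable)
    show "countable {q. max 0 dim_rate < of_rat q \<and> of_rat q < (1::real)}" by (rule countableI_type)
    show "\<forall>q\<in>{q. max 0 dim_rate < of_rat q \<and> of_rat q < (1::real)}. AE w in WM. hausdorff_dim_measure (mu (pw w)) \<le> of_rat q"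
    proof
      fix q assume "q \<in> {q. max 0 dim_rate < of_rat q \<and> of_rat q < (1::real)}"
      then have q: "0 < (of_rat q :: real)" "dim_rate < of_rat q" "of_rat q < (1::real)" by auto
      obtain s' where s': "dim_rate < s'" "s' < of_rat q" using dense[OF q(2)] by blast
      have "AE w in WM. w \<in> space WM" by simp
      with AE_mean_high[OF s'(1)] show "AE w in WM. hausdorff_dim_measure (mu (pw w)) \<le> of_rat q"
      proof eventually_elim
        case (elim w)
        show ?case
        proof (rule dim_mu_le[where Q = grid, OF pvec_pw[OF elim(2)] q(1) s'(2) q(3)])
          show "0 < grid n \<and> 1 / real (grid n) \<le> r ^ n" if "n \<ge> 1" for n
            using good_den_grid[OF that] by (simp add: good_den_def)
          show "\<exists>n\<ge>n0. n \<ge> 1 \<and> (\<Sum>i<grid n. high (pw w) n (2 * pi * real i / real (grid n)) (real n * ell * s')) / real (grid n) \<le> 1 / 2" for n0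
            using elim(1) unfolding mean_high_def by blast
        qed
      qed
    qed
  qed
  then show ?thesis
  proof eventually_elim
    case (elim w)
    have "hausdorff_dim_measure (mu (pw w)) \<le> max 0 dim_rate"
    proof (rule ccontr)
      assume "\<not> ?thesis"
      then have "max 0 dim_rate < min 1 (hausdorff_dim_measure (mu (pw w)))"
        using True by (auto simp only: not_le min_less_iff_conj)
      then obtain q where "max 0 dim_rate < of_rat q" "of_rat q < min 1 (hausdorff_dim_measure (mu (pw w)))"
        using of_rat_dense by blast
      then show False using elim by force
    qed
    then show ?case by simp
  qed
qed

text \<open>The number \<open>max 0 dim_rate\<close> separates the two sides: it is at most every
  projected dimension and at least the minimum, and drops out of the statement.\<close>

lemma AE_proj_dim_eq:
  "AE w in WM. \<forall>\<beta>. hausdorff_dim_measure (distr (mu (pw w)) borel (proj_line \<beta>)) = min 1 (hausdorff_dim_measure (mu (pw w)))"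
proof -
  have "AE w in WM. w \<in> space WM" by simp
  with AE_dim_mu_le AE_proj_dim_ge show ?thesis
  proof eventually_elim
    case (elim w)
    have p: "pvec m (pw w)" using elim(3) by (rule pvec_pw)
    show ?case
      using elim(1,2) proj_dim_le_1[OF p] proj_dim_le[OF p] by (meson min.boundedI order_antisym order_trans)
  qed
qed

end

theorem theorem4p3:
  fixes r \<theta> :: real and m :: nat and a :: "nat \<Rightarrow> complex"
    and M :: "'w measure" and X :: "'w \<Rightarrow> nat \<Rightarrow> real"
  assumes "0 < r" "r < 1"
    and "0 \<le> \<theta>" "\<theta> < 2 * pi"
    and "\<theta> / pi \<notin> \<rat>"
    and "prob_space M"
    and "\<And>i. i \<in> {1..m} \<Longrightarrow> (\<lambda>\<omega>. X \<omega> i) \<in> borel_measurable M"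
    and "\<And>\<omega> i. \<omega> \<in> space M \<Longrightarrow> i \<in> {1..m} \<Longrightarrow> 0 \<le> X \<omega> i"
    and "\<And>\<omega>. \<omega> \<in> space M \<Longrightarrow> (\<Sum>i=1..m. X \<omega> i) = 1"
  shows "AE w in (\<Pi>\<^sub>M n\<in>(UNIV::nat set). M).
           \<forall>\<beta>\<in>{0..<pi}.
             hausdorff_dim_measure (distr (random_mu r \<theta> a m X w) borel (proj_line \<beta>))
               = min 1 (hausdorff_dim_measure (random_mu r \<theta> a m X w))"
proof -
  interpret prob_space M by fact
  \<comment> \<open>For \<open>m = 0\<close> the weights would have the empty sum 0 instead of
    1.\<close>
  have m: "1 \<le> m"
  proof (rule ccontr)
    assume "\<not> 1 \<le> m"
    moreover obtain \<omega> where "\<omega> \<in> space M" using not_empty by blast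
    ultimately show False using assms(9)[of \<omega>] by simp
  qed
  interpret random_ifs r \<theta> m a M X
    by unfold_locales (use assms m in auto)
  show ?thesis
    using AE_proj_dim_eq unfolding WM_def random_mu_def random_nu_def nu_def pw_def
    by eventually_elim blast
qed

end
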